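(* Let $n,\ell \in \mathbb{N}$, let $\mathcal{P}$ be a hereditary property of ordered graphs, and suppose that $|\mathcal{P}_n| < F_{n,\ell+1}$. Then there exist $k,k' \in \mathbb{N}$ such that every ordered graph $G \in \mathcal{P}$ is of the form $G = H \triangle J$ (symmetric difference of edge sets on the common vertex set $V(G)$), where $H$ is an ordered graph with at most $k$ homogeneous blocks and $J \in \mathcal{J}(k',\ell)$.
   Context: Ordered graphs of order $N$ have vertex set $[N]$ with natural order; induced ordered subgraphs are given by injective order-preserving maps preserving adjacency and non-adjacency, written $A \leqslant B$. A hereditary property is a collection of ordered graphs closed under order-preserving isomorphism and induced ordered subgraphs; $\mathcal{P}_n$ is the set of its members with vertex set $[n]$. $F_{n,k}$: $F_{n,k}=0$ for $n<0$, $F_{0,k}=1$, $F_{n,k}=F_{n-1,k}+\dots+F_{n-k,k}$ for $n\geqslant1$. Homogeneous blocks: $\Gamma(x)$ is the neighbourhood of $x$. A homogeneous block of $G$ is a maximal set $B$ of consecutive vertices such that $\Gamma(x)\setminus\{y\}=\Gamma(y)\setminus\{x\}$ for all $x,y\in B$ (these partition $V(G)$ uniquely). Sums: for ordered graphs $G_1,\dots,G_m$ of orders $n_1,\dots,n_m$, $G_1+\dots+G_m$ is the ordered graph on $[n_1+\dots+n_m]$ obtained by placing copies of $G_1,\dots,G_m$ consecutively from left to right with no edges between different copies. Special graphs: for $n\in\mathbb{N}$, $J^{(n)}_1=K_n$; $J^{(n)}_2$ on $[n]$ with edge set $\{1n\}$ if $n\geqslant 2$ (empty if $n=1$); $J^{(n)}_3$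 on $[n]$ with edges $\{1i: i\in[2,n]\}$; $J^{(n)}_4$ on $[n]$ with edges $\{in : i\in[n-1]\}$; $L^{(n)}$ on $[n]$ with edges $\{i(i+1): i\in[n-1]\}$; $Q_1$ on $[4]$ with edges $\{13,24\}$; $Q_2$ on $[4]$ with edges $\{14,23\}$. For $\ell\in\{1,2,3\}$, $\mathcal{J}_\ell=\{J^{(n)}_i: i\in[4], n\leqslant \ell\}\cup\{L^{(n)}: n\leqslant \ell\}$, and for $\ell\geqslant4$, $\mathcal{J}_\ell$ is this set together with $Q_1,Q_2$. $\mathcal{J}(k,\ell)$: an ordered graph $G$ belongs to $\mathcal{J}(k,\ell)$ iff there are $s\leqslant k$ ordered graphs $A_1,\dots,A_s$ with $G=A_1+\dots+A_s$ such that each $A_i = B^{(i)}_1+\dots+B^{(i)}_{t(i)}$ with every $B^{(i)}_j\in\mathcal{J}_\ell$ and, for every pair $j,j'$, $B^{(i)}_j\leqslant B^{(i)}_{j'}$ or $B^{(i)}_{j'}\leqslant B^{(i)}_j$. *)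

theory Defs
  imports Main
begin

text \<open>An ordered graph of order N is a pair (N, E) with vertex set {1..N} (natural order)
  and edge set E given canonically as pairs (i,j) with 1 \<le> i < j \<le> N.\<close>

type_synonym ograph = "nat \<times> (nat \<times> nat) set"

definition ord_graph :: "ograph \<Rightarrow> bool" where
  "ord_graph G \<longleftrightarrow> snd G \<subseteq> {(i,j). 1 \<le> i \<and> i < j \<and> j \<le> fst G}"

definition adj :: "ograph \<Rightarrow> nat \<Rightarrow> nat \<Rightarrow> bool" where
  "adj G x y \<longleftrightarrow> x \<noteq> y \<and> (min x y, max x y) \<in> snd G"

definition nbhd :: "ograph \<Rightarrow> nat \<Rightarrow> nat set" where
  "nbhd G x = {y \<in> {1..fst G}. adj G x y}"

definition ind_sub :: "ograph \<Rightarrow> ograph \<Rightarrow> bool" where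
  "ind_sub A B \<longleftrightarrow> (\<exists>f. f ` {1..fst A} \<subseteq> {1..fst B} \<and> strict_mono_on {1..fst A} f \<and>
      (\<forall>i\<in>{1..fst A}. \<forall>j\<in>{1..fst A}. adj A i j \<longleftrightarrow> adj B (f i) (f j)))"

text \<open>Hereditary property: a set of ordered graphs closed under induced ordered subgraphs
  (closure under order-preserving isomorphism is automatic with the canonical representation).\<close>
definition hereditary :: "ograph set \<Rightarrow> bool" where
  "hereditary P \<longleftrightarrow> (\<forall>G\<in>P. ord_graph G) \<and>
     (\<forall>G\<in>P. \<forall>H. ord_graph H \<and> ind_sub H G \<longrightarrow> H \<in> P)"

definition level :: "ograph set \<Rightarrow> nat \<Rightarrow> ograph set" where
  "level P n = {G \<in> P. fst G = n}"

text \<open>F_{n,k}: F_{0,k} = 1, F_{n,k} = F_{n-1,k} + ... + F_{n-k,k}, with F_{m,k} = 0 for m < 0.\<close>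
function F :: "nat \<Rightarrow> nat \<Rightarrow> nat" where
  "F n k = (if n = 0 then 1 else (\<Sum>i\<in>{1..min n k}. F (n - i) k))"
  by auto
termination
  by (relation "measure fst") auto

definition twins :: "ograph \<Rightarrow> nat \<Rightarrow> nat \<Rightarrow> bool" where
  "twins G x y \<longleftrightarrow> nbhd G x - {y} = nbhd G y - {x}"

definition homog_set :: "ograph \<Rightarrow> nat set \<Rightarrow> bool" where
  "homog_set G B \<longleftrightarrow> B \<noteq> {} \<and> B \<subseteq> {1..fst G} \<and>
     (\<forall>x\<in>B. \<forall>z\<in>B. \<forall>y. x \<le> y \<and> y \<le> z \<longrightarrow> y \<in> B) \<and>
     (\<forall>x\<in>B. \<forall>y\<in>B. twins G x y)"

definition homog_block :: "ograph \<Rightarrow> nat set \<Rightarrow> bool" where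
  "homog_block G B \<longleftrightarrow> homog_set G B \<and> (\<forall>B'. homog_set G B' \<and> B \<subseteq> B' \<longrightarrow> B' = B)"

definition num_blocks :: "ograph \<Rightarrow> nat" where
  "num_blocks G = card {B. homog_block G B}"

definition og_plus :: "ograph \<Rightarrow> ograph \<Rightarrow> ograph" where
  "og_plus A B = (fst A + fst B, snd A \<union> (\<lambda>(i,j). (i + fst A, j + fst A)) ` snd B)"

definition og_sum :: "ograph list \<Rightarrow> ograph" where
  "og_sum Gs = foldr og_plus Gs (0, {})"

definition J1 :: "nat \<Rightarrow> ograph" where
  "J1 n = (n, {(i,j). 1 \<le> i \<and> i < j \<and> j \<le> n})"
definition J2 :: "nat \<Rightarrow> ograph" where
  "J2 n = (n, if n \<ge> 2 then {(1,n)} else {})"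
definition J3 :: "nat \<Rightarrow> ograph" where
  "J3 n = (n, {(1,i) | i. 2 \<le> i \<and> i \<le> n})"
definition J4 :: "nat \<Rightarrow> ograph" where
  "J4 n = (n, {(i,n) | i. 1 \<le> i \<and> i \<le> n - 1})"
definition Lg :: "nat \<Rightarrow> ograph" where
  "Lg n = (n, {(i,i+1) | i. 1 \<le> i \<and> i \<le> n - 1})"
definition Q1 :: ograph where "Q1 = (4, {(1,3),(2,4)})"
definition Q2 :: ograph where "Q2 = (4, {(1,4),(2,3)})"

definition Jset :: "nat \<Rightarrow> ograph set" where
  "Jset l = {G. \<exists>n. 1 \<le> n \<and> n \<le> l \<and> (G = J1 n \<or> G = J2 n \<or> G = J3 n \<or> G = J4 n \<or> G = Lg n)}
            \<union> (if l \<ge> 4 then {Q1, Q2} else {})"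

definition Jcal :: "nat \<Rightarrow> nat \<Rightarrow> ograph set" where
  "Jcal k l = {G. \<exists>As. length As \<le> k \<and> G = og_sum As \<and>
      (\<forall>A\<in>set As. \<exists>Bs. A = og_sum Bs \<and> (\<forall>B\<in>set Bs. B \<in> Jset l) \<and>
         (\<forall>B\<in>set Bs. \<forall>B'\<in>set Bs. ind_sub B B' \<or> ind_sub B' B))}"

end

theory Submission
  imports Defs "HOL-Library.Ramsey"
begin

text \<open>Everything is done for a single graph with few induced subgraphs of order \<open>n\<close>. Two Ramsey
  arguments drive the proof. First, the bipartite graph across any cut of the vertex set has a bounded
  number of row and column changes: otherwise one finds a large ordered matching or half graph between
  two homogeneous sets, and each of these has at least \<open>2 ^ (n - 1)\<close> induced subgraphs of order \<open>n\<close>.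
  Second, call an interval bad if it contains, both for the graph and for its complement, either an
  indecomposable graph on \<open>l + 1\<close> vertices or two different indecomposable graphs of the same order.
  Many consecutive bad intervals yield arbitrarily long sums of these indecomposables; as a sum
  determines its summands, there would be at least \<open>F n (l + 1)\<close> induced subgraphs. So \<open>V(G)\<close> splits
  into boundedly many intervals that are not bad, on each of which the graph or its complement is a
  sum of comparable members of \<open>Jset l\<close>. These sums form \<open>J\<close>, and \<open>H = G \<triangle> J\<close> is constant on each
  interval, so that consecutive vertices are twins in \<open>H\<close> except at the boundedly many changes
  across the ends of the intervals.\<close>

section \<open>Induced patterns\<close>

text \<open>\<open>F n k\<close> counts the compositions of \<open>n\<close> into parts of size at
  most \<open>k\<close>, and all compositions together number \<open>2 ^ (n - 1)\<close>. So a
  configuration with \<open>2 ^ (n - 1)\<close> induced subgraphs contradicts the hypothesis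
  whatever \<open>l\<close> is. The parameter \<open>l\<close> matters only for sums: an
  indecomposable graph contains indecomposable graphs of every smaller order, so a single one of
  order \<open>l + 1\<close> supplies a summand for each part \<open>1, ..., l + 1\<close>, while
  two of the same order double the largest part, and this already raises the growth to powers of 2.
  Badness is asked of the graph and of its complement because Ramsey's theorem makes the pairs
  between different intervals all edges or all non-edges without letting one choose which; if they
  are edges, the sums live in the complement. An interval that is not bad may therefore be well
  structured for only one of the two, which is what the symmetric difference absorbs. Between the
  intervals \<open>J\<close> has no edges and \<open>H\<close> agrees with \<open>G\<close>, so that
  there the bound on changes across a cut is needed.\<close>

definition emb :: "nat \<Rightarrow> nat set \<Rightarrow> (nat \<Rightarrow> nat) \<Rightarrow> bool" where
  "emb n V f \<longleftrightarrow> strict_mono_on {1..n} f \<and> f ` {1..n} \<subseteq> V"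

definition pat :: "nat \<Rightarrow> (nat \<Rightarrow> nat \<Rightarrow> bool) \<Rightarrow> (nat \<Rightarrow> nat) \<Rightarrow> (nat \<times> nat) set" where
  "pat n e f = {(i, j). 1 \<le> i \<and> i < j \<and> j \<le> n \<and> e (f i) (f j)}"

text \<open>Vertices are relabelled to \<open>1, ..., n\<close>, so each isomorphism type of ordered
  graphs is exactly one edge set, and counting subgraphs is counting sets of pairs.\<close>

definition subs :: "nat \<Rightarrow> nat set \<Rightarrow> (nat \<Rightarrow> nat \<Rightarrow> bool) \<Rightarrow> (nat \<times> nat) set set" where
  "subs n V e = pat n e ` {f. emb n V f}"

lemma embI:
  assumes "\<And>i j. 1 \<le> i \<Longrightarrow> i < j \<Longrightarrow> j \<le> n \<Longrightarrow> f i < f j" "\<And>i. 1 \<le> i \<Longrightarrow> i \<le> n \<Longrightarrow> f i \<in> V"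
  shows "emb n V f"
  using assms by (auto simp: emb_def strict_mono_on_def)

lemma emb_less: "emb n V f \<Longrightarrow> 1 \<le> i \<Longrightarrow> i < j \<Longrightarrow> j \<le> n \<Longrightarrow> f i < f j"
  by (auto simp: emb_def strict_mono_on_def)

lemma emb_in: "emb n V f \<Longrightarrow> 1 \<le> i \<Longrightarrow> i \<le> n \<Longrightarrow> f i \<in> V"
  by (auto simp: emb_def)

lemma emb_less_iff:
  "emb n V f \<Longrightarrow> 1 \<le> i \<Longrightarrow> i \<le> n \<Longrightarrow> 1 \<le> j \<Longrightarrow> j \<le> n \<Longrightarrow> f i < f j \<longleftrightarrow> i < j"
  by (metis emb_less less_asym linorder_neqE_nat)

lemma emb_inj_on: "emb n V f \<Longrightarrow> inj_on f {1..n}"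
  by (metis emb_def strict_mono_on_imp_inj_on)

lemma emb_mono: "emb n V f \<Longrightarrow> V \<subseteq> W \<Longrightarrow> emb n W f"
  by (auto simp: emb_def)

lemma emb_comp: "emb n {1..m} h \<Longrightarrow> emb m V f \<Longrightarrow> emb n V (\<lambda>i. f (h i))"
  by (rule embI) (metis atLeastAtMost_iff emb_in emb_less le_less_trans less_imp_le less_le_trans)+

lemma emb_enum:
  assumes "finite S"
  obtains f where "emb (card S) S f" "f ` {1..card S} = S"
proof
  let ?f = "\<lambda>i. enumerate S (i - 1)"
  show e: "emb (card S) S ?f"
    using assms by (intro embI) (auto intro!: finite_enumerate_in_set finite_enumerate_mono)
  have "card (?f ` {1..card S}) = card S"
    using card_image[OF emb_inj_on[OF e]] by simp
  then show "?f ` {1..card S} = S"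
    using e assms by (meson card_subset_eq emb_def)
qed

lemma pat_compl: "pat n (\<lambda>i j. \<not> e i j) f = {(i, j). 1 \<le> i \<and> i < j \<and> j \<le> n} - pat n e f"
  by (auto simp: pat_def)

lemma pat_sub: "pat n e f \<subseteq> {(i, j). 1 \<le> i \<and> i < j \<and> j \<le> n}"
  by (auto simp: pat_def)

lemma finite_pairs: "finite {(i, j). 1 \<le> i \<and> i < j \<and> j \<le> (n::nat)}"
  by (rule finite_subset[of _ "{..n} \<times> {..n}"]) auto

lemma finite_subs: "finite (subs n V e)"
proof (rule finite_subset)
  show "subs n V e \<subseteq> Pow {(i, j). 1 \<le> i \<and> i < j \<and> j \<le> n}"
    unfolding subs_def using pat_sub by blast
qed (use finite_pairs in blast)

lemma subsI: "emb n V f \<Longrightarrow> pat n e f \<in> subs n V e"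
  by (auto simp: subs_def)

lemma card_subs_ge:
  assumes "inj_on g A" "\<And>S. S \<in> A \<Longrightarrow> g S \<in> subs n V e"
  shows "card A \<le> card (subs n V e)"
  using assms by (intro card_inj_on_le[OF _ _ finite_subs]) auto

text \<open>Format of most lower bounds below: a set \<open>S\<close> is hidden in an induced
  subgraph from which \<open>dec\<close> reads it back, which makes the encoding injective at
  once.\<close>

lemma card_subs_ge_decode:
  assumes "\<And>S. S \<in> A \<Longrightarrow> \<exists>f. emb n V f \<and> dec (pat n e f) = S"
  shows "card A \<le> card (subs n V e)"
proof -
  obtain g where g: "\<And>S. S \<in> A \<Longrightarrow> emb n V (g S) \<and> dec (pat n e (g S)) = S"
    using assms by metis
  show ?thesis
    by (rule card_subs_ge[of "\<lambda>S. pat n e (g S)"]) (use g in \<open>auto intro: subsI inj_on_inverseI\<close>)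
qed

lemma card_subs_compl: "card (subs n V (\<lambda>i j. \<not> e i j)) = card (subs n V e)"
proof -
  let ?c = "\<lambda>p. {(i, j). 1 \<le> i \<and> i < j \<and> j \<le> n} - p"
  have "subs n V (\<lambda>i j. \<not> e i j) = ?c ` subs n V e"
    unfolding subs_def image_image pat_compl by simp
  moreover have "inj_on ?c (subs n V e)"
    using pat_sub by (intro inj_onI) (fastforce simp: subs_def)
  ultimately show ?thesis by (simp add: card_image)
qed

text \<open>Reflecting the vertex order turns each pattern into its mirror image. This later
  transfers the bound on row changes of a cut to column changes.\<close>

lemma card_subs_rev:
  assumes "V \<subseteq> {..N}"
  shows "card (subs n ((\<lambda>i. N - i) ` V) (\<lambda>i j. e (N - j) (N - i))) \<le> card (subs n V e)"
proof -
  let ?r = "\<lambda>p. (\<lambda>(i, j). (n + 1 - j, n + 1 - i)) ` p"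
  have "subs n ((\<lambda>i. N - i) ` V) (\<lambda>i j. e (N - j) (N - i)) \<subseteq> ?r ` subs n V e"
  proof
    fix p assume "p \<in> subs n ((\<lambda>i. N - i) ` V) (\<lambda>i j. e (N - j) (N - i))"
    then obtain f where f: "emb n ((\<lambda>i. N - i) ` V) f" and p: "p = pat n (\<lambda>i j. e (N - j) (N - i)) f"
      by (auto simp: subs_def)
    let ?g = "\<lambda>i. N - f (n + 1 - i)"
    have fV: "N - f i \<in> V \<and> f i \<le> N" if "1 \<le> i" "i \<le> n" for i
      using emb_in[OF f that] assms by (auto simp: subset_iff)
    have "emb n V ?g"
    proof (rule embI)
      fix i j assume ij: "1 \<le> i" "i < j" "j \<le> n"
      have "f (n + 1 - j) < f (n + 1 - i)" using ij by (intro emb_less[OF f]) auto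
      then show "?g i < ?g j" using fV[of "n + 1 - i"] ij by linarith
    next
      fix i assume "1 \<le> i" "i \<le> n"
      then show "?g i \<in> V" using fV[of "n + 1 - i"] by auto
    qed
    moreover have "p = ?r (pat n e ?g)"
    proof -
      have "(i, j) \<in> p \<longleftrightarrow> (i, j) \<in> ?r (pat n e ?g)" for i j
      proof
        assume "(i, j) \<in> p"
        then show "(i, j) \<in> ?r (pat n e ?g)"
          unfolding p pat_def by (intro image_eqI[of _ _ "(n + 1 - j, n + 1 - i)"]) auto
      next
        assume "(i, j) \<in> ?r (pat n e ?g)"
        then show "(i, j) \<in> p" unfolding p pat_def by auto
      qed
      then show ?thesis by auto
    qed
    ultimately show "p \<in> ?r ` subs n V e" by (auto simp: subs_def)
  qed
  then show ?thesis
    by (meson card_image_le card_mono finite_imageI finite_subs le_trans)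
qed

section \<open>Generalised Fibonacci numbers and powers of two\<close>

declare F.simps [simp del]

lemma F_0: "F 0 k = 1"
  by (simp add: F.simps)

lemma F_rec: "0 < n \<Longrightarrow> F n k = (\<Sum>i\<in>{1..min n k}. F (n - i) k)"
  by (subst F.simps) simp

lemma sum_pow2_le:
  fixes g :: "nat \<Rightarrow> nat"
  assumes "g 0 = 1" "\<And>i. 0 < i \<Longrightarrow> i < n \<Longrightarrow> g i \<le> 2 ^ (i - 1)" "0 < n"
  shows "(\<Sum>i\<in>{1..n}. g (n - i)) \<le> 2 ^ (n - 1)"
proof -
  have "(\<Sum>i\<in>{1..n}. g (n - i)) = (\<Sum>i<n. g i)"
    by (rule sum.reindex_bij_witness[of _ "\<lambda>i. n - i" "\<lambda>i. n - i"]) auto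
  also have "\<dots> \<le> 2 ^ (n - 1)"
    using assms(2,3)
  proof (induction n)
    case (Suc m)
    show ?case
    proof (cases "m = 0")
      case True then show ?thesis using assms(1) by simp
    next
      case False
      then have "(\<Sum>i<m. g i) \<le> 2 ^ (m - 1)" "g m \<le> 2 ^ (m - 1)"
        using Suc by auto
      then have "(\<Sum>i<Suc m. g i) \<le> 2 * 2 ^ (m - 1)" by simp
      also have "\<dots> = 2 ^ m" using False by (metis Suc_pred' neq0_conv power_Suc)
      finally show ?thesis by simp
    qed
  qed simp
  finally show ?thesis .
qed

text \<open>Dropping the bound \<open>k\<close> on the parts leaves all compositions of
  \<open>n\<close>; the recursion then becomes \<open>1 + 1 + 2 + ... + 2 ^ (n - 2)\<close>, which
  is \<open>2 ^ (n - 1)\<close>.\<close>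

lemma F_le: "0 < n \<Longrightarrow> F n k \<le> 2 ^ (n - 1)"
proof (induction n rule: less_induct)
  case (less n)
  have "F n k \<le> (\<Sum>i\<in>{1..n}. F (n - i) k)"
    using less by (simp only: F_rec) (intro sum_mono2, auto)
  also have "\<dots> \<le> 2 ^ (n - 1)"
    using less by (intro sum_pow2_le) (auto simp: F_0)
  finally show ?case .
qed

text \<open>Choosing one vertex of each pair prescribes the neighbourhood of \<open>y\<close> arbitrarily.\<close>
lemma pair_choice_right:
  assumes "1 \<le> n"
    and V: "y \<in> V" "\<And>j. 1 \<le> j \<Longrightarrow> j < n \<Longrightarrow> x j \<in> V \<and> x' j \<in> V \<and> x j < y \<and> x' j < y"
    and ord: "\<And>j k. 1 \<le> j \<Longrightarrow> j < k \<Longrightarrow> k < n \<Longrightarrow> x j < x k \<and> x j < x' k \<and> x' j < x k \<and> x' j < x' k"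
    and ne: "\<And>j. 1 \<le> j \<Longrightarrow> j < n \<Longrightarrow> e (x j) y \<noteq> e (x' j) y"
  shows "2 ^ (n - 1) \<le> card (subs n V e)"
proof -
  let ?f = "\<lambda>S j. if j = n then y else if e (x j) y = (j \<in> S) then x j else x' j"
  have "card (Pow {1..<n}) \<le> card (subs n V e)"
  proof (rule card_subs_ge_decode[where dec = "\<lambda>p. {j. (j, n) \<in> p}"])
    fix S assume S: "S \<in> Pow {1..<n}"
    have "emb n V (?f S)" using V ord by (intro embI) auto
    moreover have "{j. (j, n) \<in> pat n e (?f S)} = S"
      using S ne by (auto simp: pat_def)
    ultimately show "\<exists>f. emb n V f \<and> {j. (j, n) \<in> pat n e f} = S" by blast
  qed
  then show ?thesis by (simp add: card_Pow)
qed

lemma pair_choice_left: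
  assumes "1 \<le> n"
    and V: "y \<in> V" "\<And>j. 1 \<le> j \<Longrightarrow> j < n \<Longrightarrow> x j \<in> V \<and> x' j \<in> V \<and> y < x j \<and> y < x' j"
    and ord: "\<And>j k. 1 \<le> j \<Longrightarrow> j < k \<Longrightarrow> k < n \<Longrightarrow> x j < x k \<and> x j < x' k \<and> x' j < x k \<and> x' j < x' k"
    and ne: "\<And>j. 1 \<le> j \<Longrightarrow> j < n \<Longrightarrow> e y (x j) \<noteq> e y (x' j)"
  shows "2 ^ (n - 1) \<le> card (subs n V e)"
proof -
  let ?f = "\<lambda>S j. if j = 1 then y else if e y (x (j - 1)) = (j - 1 \<in> S) then x (j - 1) else x' (j - 1)"
  have "card (Pow {1..<n}) \<le> card (subs n V e)"
  proof (rule card_subs_ge_decode[where dec = "\<lambda>p. {j. (1, j + 1) \<in> p \<and> 1 \<le> j}"])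
    fix S assume S: "S \<in> Pow {1..<n}"
    have "emb n V (?f S)" using V ord by (intro embI) auto
    moreover have "(1, j + 1) \<in> pat n e (?f S) \<and> 1 \<le> j \<longleftrightarrow> j \<in> S" for j
      using S ne[of j] by (cases "1 \<le> j \<and> j < n") (auto simp: pat_def)
    then have "{j. (1, j + 1) \<in> pat n e (?f S) \<and> 1 \<le> j} = S" by blast
    ultimately show "\<exists>f. emb n V f \<and> {j. (1, j + 1) \<in> pat n e f \<and> 1 \<le> j} = S" by blast
  qed
  then show ?thesis by (simp add: card_Pow)
qed

section \<open>Ramsey's theorem for colourings of increasing pairs\<close>

lemma ramsey_pairs:
  assumes "finite (K :: 'c set)"
  shows "\<exists>R. \<forall>c :: nat \<Rightarrow> nat \<Rightarrow> 'c. (\<forall>i j. i < j \<longrightarrow> j < R \<longrightarrow> c i j \<in> K) \<longrightarrow>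
    (\<exists>h k. emb m {..<R} h \<and> (\<forall>i j. 1 \<le> i \<longrightarrow> i < j \<longrightarrow> j \<le> m \<longrightarrow> c (h i) (h j) = k))"
proof -
  obtain b where b: "bij_betw b K {..<card K}"
    using assms by (metis bij_betw_inv ex_bij_betw_nat_finite lessThan_atLeast0)
  obtain R :: nat where R: "partn_lst {..<R} (replicate (card K) m) 2"
    using ramsey_full[of "replicate (card K) m" 2] by blast
  show ?thesis
  proof (rule exI[of _ R], intro allI impI)
    fix c :: "nat \<Rightarrow> nat \<Rightarrow> 'c"
    assume c: "\<forall>i j. i < j \<longrightarrow> j < R \<longrightarrow> c i j \<in> K"
    \<comment> \<open>Ramsey's theorem colours unordered pairs; \<open>Min\<close> and
      \<open>Max\<close> restore the order of the arguments of \<open>c\<close>, and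
      \<open>b\<close> numbers the colours.\<close>
    let ?g = "\<lambda>X. b (c (Min X) (Max X))"
    have "?g \<in> nsets {..<R} 2 \<rightarrow> {..<card K}"
    proof
      fix X assume "X \<in> nsets {..<R} 2"
      then obtain i j where "X = {i, j}" "i < j" "j < R"
        by (auto simp: ordered_nsets_2_eq)
      then show "?g X \<in> {..<card K}"
        using c b by (auto simp: min_def max_def bij_betw_def)
    qed
    then obtain t H where t: "t < card K" and H: "H \<in> nsets {..<R} m" and g: "?g ` nsets H 2 \<subseteq> {t}"
      by (rule partn_lstE[OF R]) auto
    from H have H': "finite H" "card H = m" "H \<subseteq> {..<R}" by (auto simp: nsets_def)
    obtain h where h: "emb m H h" using emb_enum[OF H'(1)] H' by metis
    obtain k where k: "k \<in> K" "b k = t" using b t by (metis bij_betw_def imageE lessThan_iff)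
    have "c (h i) (h j) = k" if ij: "1 \<le> i" "i < j" "j \<le> m" for i j
    proof -
      have hh: "h i \<in> H" "h j \<in> H" "h i < h j" using h ij by (auto intro: emb_in emb_less)
      then have "{h i, h j} \<in> nsets H 2" by auto
      then have "?g {h i, h j} = t" using g by blast
      then have "b (c (h i) (h j)) = b k" using hh k by (simp add: min_def max_def)
      moreover have "c (h i) (h j) \<in> K" using c hh H' by auto
      ultimately show ?thesis using b k by (auto simp: bij_betw_def inj_on_def)
    qed
    then show "\<exists>h k. emb m {..<R} h \<and> (\<forall>i j. 1 \<le> i \<longrightarrow> i < j \<longrightarrow> j \<le> m \<longrightarrow> c (h i) (h j) = k)"
      using emb_mono[OF h H'(3)] by blast
  qed
qed

section \<open>Counting the traces of a bipartite structure\<close>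

text \<open>The vertices \<open>z j\<close> precede the vertices \<open>y k\<close>, and the pair \<open>z j\<close>, \<open>y k\<close> has colour \<open>al\<close>, \<open>de\<close>
  or \<open>be\<close> according to whether \<open>j < k\<close>, \<open>j = k\<close> or \<open>j > k\<close>; \<open>xi\<close> and \<open>et\<close> are the colours inside
  the two sides. So \<open>al = be\<close> is a matching or its complement, \<open>al \<noteq> be\<close> a half graph.\<close>
definition bip where
  "bip V e M up al be de xi et z y \<longleftrightarrow>
    (\<forall>j\<in>{1..M}. z j \<in> V \<and> y j \<in> V) \<and>
    (\<forall>j\<in>{1..M::nat}. \<forall>k\<in>{1..M}. z j < (y k :: nat) \<and>
       e (z j) (y k) = (if j < k then al else if j = k then de else be) \<and>
       (j < k \<longrightarrow> z j < z k \<and> e (z j) (z k) = xi \<and>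
         (if up then y j < y k \<and> e (y j) (y k) = et else y k < y j \<and> e (y k) (y j) = (et :: bool))))"

text \<open>\<open>f\<close> is a choice of indices realising an induced subgraph of order \<open>n\<close> in a structure \<open>bip\<close>:
  position \<open>i\<close> is \<open>z (f i)\<close> for \<open>i \<le> a\<close> and \<open>y (f i)\<close> for \<open>i > a\<close>. The graph obtained is \<open>lpat\<close>.\<close>
definition lev :: "nat \<Rightarrow> nat \<Rightarrow> bool \<Rightarrow> nat \<Rightarrow> (nat \<Rightarrow> nat) \<Rightarrow> bool" where
  "lev n M up a f \<longleftrightarrow> a \<le> n \<and> (\<forall>i\<in>{1..n}. f i \<in> {1..M}) \<and>
    (\<forall>i j. 1 \<le> i \<and> i < j \<and> j \<le> n \<longrightarrow>
      (j \<le> a \<longrightarrow> f i < f j) \<and> (a < i \<longrightarrow> (if up then f i < f j else f j < f i)))"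

definition lpat where
  "lpat n a f al be de xi et = {(i, j). 1 \<le> i \<and> i < j \<and> j \<le> n \<and>
     (if j \<le> a then xi else if a < i then et
      else if f i < f j then al else if f i = (f j :: nat) then de else be)}"

lemma lev_mono: "lev n M up a f \<Longrightarrow> M \<le> M' \<Longrightarrow> lev n M' up a f"
  by (fastforce simp: lev_def)

lemma bip_realize:
  assumes b: "bip V e M up al be de xi et z y" and l: "lev n M up a f"
  shows "\<exists>g. emb n V g \<and> pat n e g = lpat n a f al be de xi et"
proof -
  let ?g = "\<lambda>i. if i \<le> a then z (f i) else y (f i)"
  have f: "f i \<in> {1..M}" if "1 \<le> i" "i \<le> n" for i
    using l that by (auto simp: lev_def)
  have x: "f i < f j" if "1 \<le> i" "i < j" "j \<le> n" "j \<le> a" for i j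
    using l that by (auto simp: lev_def)
  have yy: "if up then f i < f j else f j < f i" if "1 \<le> i" "i < j" "j \<le> n" "a < i" for i j
    using l that unfolding lev_def by blast
  have bz: "z j < y k" "e (z j) (y k) = (if j < k then al else if j = k then de else be)"
    if "j \<in> {1..M}" "k \<in> {1..M}" for j k
    using b that unfolding bip_def by blast+
  have bx: "z j < z k" "e (z j) (z k) = xi" if "j \<in> {1..M}" "k \<in> {1..M}" "j < k" for j k
    using b that unfolding bip_def by blast+
  have by': "if up then y j < y k \<and> e (y j) (y k) = et else y k < y j \<and> e (y k) (y j) = et"
    if "j \<in> {1..M}" "k \<in> {1..M}" "j < k" for j k
    using b that unfolding bip_def by blast
  have yz: "y (f i) < y (f j) \<and> e (y (f i)) (y (f j)) = et" if "1 \<le> i" "i < j" "j \<le> n" "a < i" for i j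
    using yy[OF that] by'[of "f i" "f j"] by'[of "f j" "f i"] f[of i] f[of j] that
    by (cases up) auto
  have bV: "z j \<in> V \<and> y j \<in> V" if "j \<in> {1..M}" for j
    using b that unfolding bip_def by blast
  have "emb n V ?g"
  proof (rule embI)
    fix i j assume ij: "1 \<le> i" "i < j" "j \<le> n"
    then have "f i \<in> {1..M}" "f j \<in> {1..M}" using f[of i] f[of j] by auto
    then show "?g i < ?g j"
      using ij bz(1)[of "f i" "f j"] bx(1)[of "f i" "f j"] x[of i j] yz[of i j] by auto
  next
    fix i assume "1 \<le> i" "i \<le> n"
    then show "?g i \<in> V" using bV[OF f] by auto
  qed
  moreover have "(i, j) \<in> pat n e ?g \<longleftrightarrow> (i, j) \<in> lpat n a f al be de xi et" for i j
  proof (cases "1 \<le> i \<and> i < j \<and> j \<le> n")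
    case True
    then have ij: "1 \<le> i" "i < j" "j \<le> n" by auto
    then have "f i \<in> {1..M}" "f j \<in> {1..M}" using f[of i] f[of j] by auto
    then show ?thesis
      using ij bz(2)[of "f i" "f j"] bx(2)[of "f i" "f j"] x[of i j] yz[of i j]
      by (auto simp: pat_def lpat_def)
  qed (auto simp: pat_def lpat_def)
  ultimately show ?thesis by (intro exI[of _ ?g]) auto
qed

text \<open>Vertices to be matched get multiples of \<open>B\<close> as levels, all others a nonzero residue mod \<open>B\<close>
  whose parity \<open>t\<close> depends on the side, so that levels coincide only where intended.\<close>
lemma match_side:
  fixes n t :: nat
  defines "B \<equiv> 4 * n + 8"
  assumes S: "S \<subseteq> {1..n}" "U \<subseteq> S" and t: "t < 2"
  obtains f where "\<And>i j. i \<in> S \<Longrightarrow> j \<in> S \<Longrightarrow> i < j \<Longrightarrow> f i < f j"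
    "\<And>i. i \<in> S \<Longrightarrow> f i \<in> {1..B * (n + 1)}"
    "\<And>i. i \<in> S \<Longrightarrow> f i mod B = (if i \<in> U then 0 else 2 * i + t)"
    "f ` U = (\<lambda>r. r * B) ` {1..card U}"
proof -
  \<comment> \<open>\<open>?r i\<close> is the rank of \<open>i\<close> among the matched vertices.
    The matched vertex of rank \<open>r\<close> gets level exactly \<open>r * B\<close> whatever its
    position, so that equal ranks on the two sides meet; an unmatched vertex sits a little above the
    last matched one.\<close>
  let ?r = "\<lambda>i. card (U \<inter> {..i})"
  let ?f = "\<lambda>i. ?r i * B + (if i \<in> U then 0 else 2 * i + t)"
  have finU: "finite U" using S by (meson finite_atLeastAtMost finite_subset)
  have rmono: "?r i \<le> ?r j" if "i \<le> j" for i j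
    using that finU by (intro card_mono) auto
  have rstrict: "?r i < ?r j" if "i < j" "j \<in> U" for i j
  proof -
    have "insert j (U \<inter> {..i}) \<subseteq> U \<inter> {..j}" using that by auto
    from card_mono[OF _ this] show ?thesis using that finU by simp
  qed
  have Bpos: "0 < B" by (simp add: B_def)
  have small: "2 * i + t < B" "0 < i" if "i \<in> S" for i
    using that S t by (auto simp: B_def)
  have mono: "?f i < ?f j" if "i \<in> S" "j \<in> S" "i < j" for i j
  proof (cases "j \<in> U")
    case True
    have "?f i < (?r i + 1) * B" using small[OF \<open>i \<in> S\<close>] Bpos by auto
    also have "\<dots> \<le> ?r j * B" using rstrict[OF \<open>i < j\<close> True] by (intro mult_le_mono1) auto
    finally show ?thesis using True by simp
  next
    case False
    have "?r i * B \<le> ?r j * B" using rmono[of i j] that by (intro mult_le_mono1) auto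
    moreover have "(if i \<in> U then 0 else 2 * i + t) < 2 * j + t" using that small[of j] by auto
    ultimately show ?thesis unfolding if_not_P[OF False] by (rule add_le_less_mono)
  qed
  have fmod: "?f i mod B = (if i \<in> U then 0 else 2 * i + t)" if "i \<in> S" for i
    using small[OF that] by auto
  have fin: "?f i \<in> {1..B * (n + 1)}" if "i \<in> S" for i
  proof -
    have "?r i \<le> card {1..n}" using S by (intro card_mono) auto
    then have "?r i * B \<le> n * B" by (intro mult_le_mono1) auto
    moreover have "1 \<le> ?f i"
    proof (cases "i \<in> U")
      case True
      then have "0 < ?r i" using finU by (auto simp: card_gt_0_iff)
      then show ?thesis using True Bpos by simp
    next
      case False then show ?thesis using small[OF that] by auto
    qed
    moreover have "(if i \<in> U then 0 else 2 * i + t) \<le> B" using small[OF that] by auto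
    ultimately have "1 \<le> ?f i" "?f i \<le> n * B + B" by (blast, intro add_mono)
    then show ?thesis by (simp only: atLeastAtMost_iff) (simp add: algebra_simps)
  qed
  have "?f ` U \<subseteq> (\<lambda>r. r * B) ` {1..card U}"
  proof
    fix v assume "v \<in> ?f ` U"
    then obtain i where i: "i \<in> U" "v = ?r i * B" by auto
    have "0 < ?r i" using i finU by (auto simp: card_gt_0_iff)
    moreover have "?r i \<le> card U" using finU by (intro card_mono) auto
    ultimately show "v \<in> (\<lambda>r. r * B) ` {1..card U}" using i by auto
  qed
  moreover have "card (?f ` U) = card U"
    using mono S by (intro card_image linorder_inj_onI') (metis less_irrefl subsetD)
  moreover have "card ((\<lambda>r. r * B) ` {1..card U}) = card U"
    using Bpos by (subst card_image) (auto simp: inj_on_def)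
  ultimately have "?f ` U = (\<lambda>r. r * B) ` {1..card U}"
    by (intro card_subset_eq) auto
  from mono fin fmod this show ?thesis by (rule that)
qed

text \<open>Equal numbers of matched vertices on both sides suffice, since the \<open>r\<close>-th
  matched vertices of the two sides both have level \<open>r * (4 * n + 8)\<close>. Unmatched
  vertices have even residues on the left and odd ones on the right.\<close>

lemma lev_match:
  assumes a: "a \<le> n" and U: "U \<subseteq> {1..n}" "card (U \<inter> {1..a}) = card (U \<inter> {a+1..n})"
  obtains f where "lev n ((4 * n + 8) * (n + 1)) up a f"
    "{i \<in> {1..a}. \<exists>j\<in>{a+1..n}. f i = f j} = U \<inter> {1..a}"
    "{j \<in> {a+1..n}. \<exists>i\<in>{1..a}. f i = f j} = U \<inter> {a+1..n}"
proof -
  let ?B = "4 * n + 8"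
  obtain f1 where f1: "\<And>i j. i \<in> {1..a} \<Longrightarrow> j \<in> {1..a} \<Longrightarrow> i < j \<Longrightarrow> f1 i < f1 j"
    "\<And>i. i \<in> {1..a} \<Longrightarrow> f1 i \<in> {1..?B * (n + 1)}"
    "\<And>i. i \<in> {1..a} \<Longrightarrow> f1 i mod ?B = (if i \<in> U \<inter> {1..a} then 0 else 2 * i + 0)"
    "f1 ` (U \<inter> {1..a}) = (\<lambda>r. r * ?B) ` {1..card (U \<inter> {1..a})}"
  proof (rule match_side[of "{1..a}" n "U \<inter> {1..a}" 0])
    show "{1..a} \<subseteq> {1..n}" using a by auto
  qed auto
  \<comment> \<open>If \<open>up\<close> fails, levels must decrease along the right side, so this
    side is numbered from its end.\<close>
  define rho where "rho i = (if up then i else n + 1 - i)" for i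
  have rho: "rho ` {a+1..n} \<subseteq> {1..n}" "inj_on rho {a+1..n}"
    by (auto simp: rho_def inj_on_def)
  let ?S = "rho ` {a+1..n}" and ?U = "rho ` (U \<inter> {a+1..n})"
  have cU: "card ?U = card (U \<inter> {1..a})"
    using U(2) inj_on_subset[OF rho(2), of "U \<inter> {a+1..n}"] by (simp add: card_image)
  obtain f2 where f2: "\<And>i j. i \<in> ?S \<Longrightarrow> j \<in> ?S \<Longrightarrow> i < j \<Longrightarrow> f2 i < f2 j"
    "\<And>i. i \<in> ?S \<Longrightarrow> f2 i \<in> {1..?B * (n + 1)}"
    "\<And>i. i \<in> ?S \<Longrightarrow> f2 i mod ?B = (if i \<in> ?U then 0 else 2 * i + 1)"
    "f2 ` ?U = (\<lambda>r. r * ?B) ` {1..card ?U}"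
  proof (rule match_side[of ?S n ?U 1])
    show "?U \<subseteq> ?S" by blast
  qed (use rho in auto)
  define f where "f i = (if i \<le> a then f1 i else f2 (rho i))" for i
  have "lev n (?B * (n + 1)) up a f"
    unfolding lev_def
  proof (intro conjI ballI allI impI)
    fix i assume "i \<in> {1..n}"
    then show "f i \<in> {1..?B * (n + 1)}" using f1(2)[of i] f2(2)[of "rho i"] by (auto simp: f_def)
  next
    fix i j assume "1 \<le> i \<and> i < j \<and> j \<le> n" "j \<le> a"
    then show "f i < f j" using f1(1)[of i j] by (auto simp: f_def)
  next
    fix i j assume ij: "1 \<le> i \<and> i < j \<and> j \<le> n" "a < i"
    then have "i \<in> {a+1..n}" "j \<in> {a+1..n}" by auto
    then have "rho i \<in> ?S" "rho j \<in> ?S" by blast+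
    then show "if up then f i < f j else f j < f i"
      using ij f2(1)[of "rho i" "rho j"] f2(1)[of "rho j" "rho i"] by (auto simp: f_def rho_def)
  qed (use a in auto)
  have U12: "f1 ` (U \<inter> {1..a}) = f2 ` ?U" using f1(4) f2(4) cU by simp
  have eqU: "i \<in> U \<and> j \<in> U" if "i \<in> {1..a}" "j \<in> {a+1..n}" "f i = f j" for i j
  proof -
    have m: "f1 i mod ?B = f2 (rho j) mod ?B" using that by (simp add: f_def)
    have m1: "f1 i mod ?B = (if i \<in> U then 0 else 2 * i)" using f1(3)[OF that(1)] that(1) by simp
    have "rho j \<in> ?U \<longleftrightarrow> j \<in> U \<inter> {a+1..n}"
      using rho(2) that(2) by (auto simp: inj_on_def)
    then have m2: "f2 (rho j) mod ?B = (if j \<in> U then 0 else 2 * rho j + 1)"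
      using f2(3)[of "rho j"] that(2) by auto
    have "2 * i \<noteq> 2 * rho j + 1" by presburger
    then show ?thesis using m m1 m2 that(1) by (auto split: if_splits)
  qed
  have ex2: "\<exists>j\<in>U \<inter> {a+1..n}. f i = f j" if "i \<in> U \<inter> {1..a}" for i
  proof -
    have "f1 i \<in> f2 ` ?U" using U12 that by blast
    then show ?thesis using that by (auto simp: f_def)
  qed
  have ex1: "\<exists>i\<in>U \<inter> {1..a}. f i = f j" if "j \<in> U \<inter> {a+1..n}" for j
  proof -
    have "f2 (rho j) \<in> f1 ` (U \<inter> {1..a})" using U12 that by blast
    then show ?thesis using that by (force simp: f_def)
  qed
  show ?thesis
  proof (rule that[OF \<open>lev n (?B * (n + 1)) up a f\<close>])
    show "{i \<in> {1..a}. \<exists>j\<in>{a+1..n}. f i = f j} = U \<inter> {1..a}"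
      using eqU ex2 by blast
    show "{j \<in> {a+1..n}. \<exists>i\<in>{1..a}. f i = f j} = U \<inter> {a+1..n}"
      using eqU ex1 by blast
  qed
qed

text \<open>Each level in \<open>1, ..., n\<close> is used once: on the left if it lies in
  \<open>S\<close>, otherwise on the right. The levels below \<open>f i\<close> belong to the
  \<open>i - 1\<close> earlier left vertices and to some right vertices, so \<open>S\<close> is
  determined by how many right vertices lie below each left one.\<close>

lemma lev_half:
  assumes S: "S \<subseteq> {1..n}" and a: "a = card S"
  obtains f where "lev n n up a f" "f ` {1..a} = S" "f ` {a+1..n} = {1..n} - S"
    "\<And>i. i \<in> {1..a} \<Longrightarrow> f i = i + card {j \<in> {a+1..n}. f j < f i}"
proof -
  have fin: "finite S" using S by (meson finite_atLeastAtMost finite_subset)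
  have an: "a \<le> n" using card_mono[OF _ S] a by simp
  have cc: "card ({1..n} - S) = n - a" using card_Diff_subset[OF fin S] a by simp
  obtain s where s: "emb a S s" "s ` {1..a} = S" using emb_enum[OF fin] a by metis
  obtain c where c: "emb (n - a) ({1..n} - S) c" "c ` {1..n-a} = {1..n} - S"
    using emb_enum[of "{1..n} - S"] cc by auto
  define rho where "rho i = (if up then i - a else n + 1 - i)" for i
  have rho: "rho ` {a+1..n} = {1..n-a}"
  proof -
    have "v \<in> rho ` {a+1..n}" if "v \<in> {1..n-a}" for v
      using that by (intro image_eqI[of _ _ "if up then v + a else n + 1 - v"]) (auto simp: rho_def)
    then show ?thesis by (auto simp: rho_def)
  qed
  have rin: "1 \<le> rho i" "rho i \<le> n - a" if "i \<in> {a+1..n}" for i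
    using that by (auto simp: rho_def)
  define f where "f i = (if i \<le> a then s i else c (rho i))" for i
  have im1: "f ` {1..a} = S" unfolding s(2)[symmetric] by (auto simp: f_def)
  have "f ` {a+1..n} = c ` (rho ` {a+1..n})" by (auto simp: f_def image_image)
  then have im2: "f ` {a+1..n} = {1..n} - S" unfolding rho c(2) .
  have l: "lev n n up a f"
    unfolding lev_def
  proof (intro conjI ballI allI impI)
    fix i assume "i \<in> {1..n}"
    then have "i \<in> {1..a} \<or> i \<in> {a+1..n}" by auto
    then show "f i \<in> {1..n}" using im1 im2 S by blast
  next
    fix i j assume "1 \<le> i \<and> i < j \<and> j \<le> n" "j \<le> a"
    then show "f i < f j" using emb_less[OF s(1), of i j] by (auto simp: f_def)
  next
    fix i j assume ij: "1 \<le> i \<and> i < j \<and> j \<le> n" "a < i"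
    then have "i \<in> {a+1..n}" "j \<in> {a+1..n}" by auto
    then show "if up then f i < f j else f j < f i"
      using ij rin[of i] rin[of j] by (auto simp: f_def rho_def intro!: emb_less[OF c(1)])
  qed (use an in auto)
  have inj1: "inj_on f {1..a}" and inj2: "inj_on f {a+1..n}"
    using im1 im2 a cc an by (auto intro!: eq_card_imp_inj_on)
  have deg: "f i = i + card {j \<in> {a+1..n}. f j < f i}" if i: "i \<in> {1..a}" for i
  proof -
    have fi: "f i \<in> {1..n}" using l i an by (auto simp: lev_def)
    have less1: "f i' < f i \<longleftrightarrow> i' < i" if "i' \<in> {1..a}" for i'
      using that i an emb_less_iff[OF s(1), of i' i] by (auto simp: f_def)
    have "{1..<f i} = f ` {1..<i} \<union> f ` {j \<in> {a+1..n}. f j < f i}"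
    proof (intro set_eqI iffI)
      fix v assume v: "v \<in> {1..<f i}"
      then have "v \<in> f ` {1..a} \<or> v \<in> f ` {a+1..n}" using fi im1 im2 by auto
      then show "v \<in> f ` {1..<i} \<union> f ` {j \<in> {a+1..n}. f j < f i}"
      proof
        assume "v \<in> f ` {1..a}"
        then obtain i' where "i' \<in> {1..a}" "v = f i'" by blast
        then show ?thesis using v less1 by auto
      qed (use v in auto)
    next
      fix v assume "v \<in> f ` {1..<i} \<union> f ` {j \<in> {a+1..n}. f j < f i}"
      then show "v \<in> {1..<f i}"
      proof
        assume "v \<in> f ` {1..<i}"
        then obtain i' where i': "i' \<in> {1..<i}" "v = f i'" by blast
        then have "i' \<in> {1..a}" "i' \<in> {1..n}" using i an by auto
        then show ?thesis using i' less1[of i'] l by (auto simp: lev_def)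
      next
        assume "v \<in> f ` {j \<in> {a+1..n}. f j < f i}"
        then show ?thesis using l by (auto simp: lev_def)
      qed
    qed
    moreover have "f ` {1..<i} \<inter> f ` {j \<in> {a+1..n}. f j < f i} = {}"
    proof -
      have "f ` {1..<i} \<subseteq> S" using i unfolding im1[symmetric] by (intro image_mono) auto
      moreover have "f ` {j \<in> {a+1..n}. f j < f i} \<subseteq> {1..n} - S"
        unfolding im2[symmetric] by (intro image_mono) auto
      ultimately show ?thesis by blast
    qed
    ultimately have "card {1..<f i} = card (f ` {1..<i}) + card (f ` {j \<in> {a+1..n}. f j < f i})"
      by (simp add: card_Un_disjoint)
    also have "card (f ` {1..<i}) = i - 1"
      by (subst card_image, rule inj_on_subset[OF inj1]) (use i in auto)
    also have "card (f ` {j \<in> {a+1..n}. f j < f i}) = card {j \<in> {a+1..n}. f j < f i}"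
      by (rule card_image) (use inj2 in \<open>auto intro: inj_on_subset\<close>)
    finally show ?thesis using fi i by auto
  qed
  show ?thesis by (rule that[OF l im1 im2 deg])
qed

lemma lev_bounds: "lev n M up a f \<Longrightarrow> 1 \<le> i \<Longrightarrow> i \<le> n \<Longrightarrow> 1 \<le> f i \<and> f i \<le> M"
  by (simp add: lev_def)

lemma lev_le: "lev n M up a f \<Longrightarrow> a \<le> n"
  by (simp add: lev_def)

lemma lev_low: "lev n M up a f \<Longrightarrow> 1 \<le> i \<Longrightarrow> i < j \<Longrightarrow> j \<le> a \<Longrightarrow> f i < f j"
  by (auto simp: lev_def)

lemma Collect_initial:
  "(\<And>j. j \<in> {b..m} \<Longrightarrow> Q j \<longleftrightarrow> j \<le> c) \<Longrightarrow> c \<le> m \<Longrightarrow> {j \<in> {b..m}. Q j} = {b..c::nat}"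
  by auto

lemma lev_marker:
  assumes "lev m M up a f"
  shows "lev (m + 1) (M + 1) up (a + 1) (\<lambda>i. if i = 1 then 1 else f (i - 1) + 1)"
  unfolding lev_def
proof (intro conjI ballI allI impI)
  fix i assume "i \<in> {1..m+1}"
  then show "(if i = 1 then 1 else f (i - 1) + 1) \<in> {1..M + 1}"
    using lev_bounds[OF assms, of "i - 1"] by auto
next
  fix i j assume ij: "1 \<le> i \<and> i < j \<and> j \<le> m + 1" "j \<le> a + 1"
  have "1 \<le> f (j - 1)" using lev_bounds[OF assms, of "j - 1"] ij by auto
  then show "(if i = 1 then 1 else f (i - 1) + 1) < (if j = 1 then 1 else f (j - 1) + 1)"
    using lev_low[OF assms, of "i - 1" "j - 1"] ij by auto
next
  fix i j assume ij: "1 \<le> i \<and> i < j \<and> j \<le> m + 1" "a + 1 < i"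
  then have "1 \<le> i - 1 \<and> i - 1 < j - 1 \<and> j - 1 \<le> m \<and> a < i - 1" by auto
  then have "if up then f (i - 1) < f (j - 1) else f (j - 1) < f (i - 1)"
    using assms unfolding lev_def by blast
  then show "if up then (if i = 1 then 1 else f (i - 1) + 1) < (if j = 1 then 1 else f (j - 1) + 1)
    else (if j = 1 then 1 else f (j - 1) + 1) < (if i = 1 then 1 else f (i - 1) + 1)"
    using ij by auto
qed (use assms in \<open>auto simp: lev_def\<close>)

text \<open>Raising all levels by one frees \<open>1\<close> and \<open>M + 2\<close>. The last
  vertex takes the one that is extreme in the direction of \<open>up\<close>; no left vertex shares
  it, so the marker is never a matched partner.\<close>

lemma lev_marker_last:
  assumes "lev m M up a f"
  shows "lev (m + 1) (M + 2) up a (\<lambda>i. if i = m + 1 then if up then M + 2 else 1 else f i + 1)"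
  unfolding lev_def
proof (intro conjI ballI allI impI)
  fix i assume "i \<in> {1..m+1}"
  then show "(if i = m + 1 then if up then M + 2 else 1 else f i + 1) \<in> {1..M + 2}"
    using lev_bounds[OF assms, of i] by (cases "i = m + 1") auto
next
  fix i j assume ij: "1 \<le> i \<and> i < j \<and> j \<le> m + 1" "a < i"
  then have "1 \<le> f i" "f i \<le> M" using assms by (auto simp: lev_def)
  moreover have "if up then f i < f j else f j < f i" if "j \<le> m"
    using assms ij that unfolding lev_def by blast
  ultimately show "if up then (if i = m + 1 then if up then M + 2 else 1 else f i + 1) <
      (if j = m + 1 then if up then M + 2 else 1 else f j + 1)
    else (if j = m + 1 then if up then M + 2 else 1 else f j + 1) <
      (if i = m + 1 then if up then M + 2 else 1 else f i + 1)"
    using ij by (auto split: if_splits)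
qed (use assms in \<open>auto simp: lev_def\<close>)

text \<open>Sets \<open>S\<close> encode matchings between the two sides: the cut is \<open>card S\<close> and the matched vertices
  form the symmetric difference of \<open>S\<close> and \<open>{1..card S}\<close>.\<close>
lemma card_symdiff_initial:
  assumes S: "S \<subseteq> {1..m}" and a: "a = card S"
  defines "U \<equiv> (S - {1..a}) \<union> ({1..a} - S)"
  shows "a \<le> m" "U \<subseteq> {1..m}" "card (U \<inter> {1..a}) = card (U \<inter> {a+1..m})"
    "S = ({1..a} - (U \<inter> {1..a})) \<union> (U \<inter> {a+1..m})"
proof -
  have fin: "finite S" using S by (meson finite_atLeastAtMost finite_subset)
  show am: "a \<le> m" using card_mono[OF _ S] a by simp
  then show "U \<subseteq> {1..m}" using S by (auto simp: U_def)
  have "U \<inter> {1..a} = {1..a} - S" "U \<inter> {a+1..m} = S - {1..a}"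
    using S by (auto simp: U_def)
  moreover have "card ({1..a} - S) = card (S - {1..a})"
    using fin a by (simp add: card_Diff_subset_Int Int_commute)
  ultimately show "card (U \<inter> {1..a}) = card (U \<inter> {a+1..m})" by simp
  show "S = ({1..a} - (U \<inter> {1..a})) \<union> (U \<inter> {a+1..m})"
    using S am by (auto simp: U_def)
qed

text \<open>Inverse of the encoding by symmetric difference: \<open>al\<close> is the colour of the
  unmatched crossing pairs, and \<open>s\<close> is the number of vertices placed in front of the
  bipartite structure.\<close>

definition match_decode :: "bool \<Rightarrow> nat \<Rightarrow> nat \<Rightarrow> nat \<Rightarrow> (nat \<times> nat) set \<Rightarrow> nat set" where
  "match_decode al m s a p =
    ({1..a} - {i \<in> {1..a}. \<exists>j\<in>{a+1..m}. ((i + s, j + s) \<in> p) \<noteq> al}) \<union>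
    {j \<in> {a+1..m}. \<exists>i\<in>{1..a}. ((i + s, j + s) \<in> p) \<noteq> al}"

text \<open>Recovers the levels of the left side, hence \<open>S\<close>: the colour
  \<open>be\<close> marks the right vertices of smaller level, which are counted as in
  \<open>lev_half\<close>.\<close>

definition half_decode :: "bool \<Rightarrow> nat \<Rightarrow> nat \<Rightarrow> nat \<Rightarrow> (nat \<times> nat) set \<Rightarrow> nat set" where
  "half_decode be m s a p = (\<lambda>i. i + card {j \<in> {a+1..m}. ((i + s, j + s) \<in> p) = be}) ` {1..a}"

text \<open>The decoding is claimed for every pattern \<open>p\<close> and offset \<open>s\<close>
  with the right crossing pairs, so that it applies with a marker in front (\<open>s = 1\<close>)
  and without one (\<open>s = 0\<close>).\<close>

lemma lev_match_decode:
  assumes S: "S \<subseteq> {1..m}" and a: "a = card S"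
  shows "\<exists>f. lev m ((4 * m + 8) * (m + 1)) up a f \<and>
    (\<forall>p s. (\<forall>i\<in>{1..a}. \<forall>j\<in>{a+1..m}. ((i + s, j + s) \<in> p) \<noteq> al \<longleftrightarrow> f i = f j)
      \<longrightarrow> match_decode al m s a p = S)"
proof -
  define U where "U = (S - {1..a}) \<union> ({1..a} - S)"
  note U = card_symdiff_initial[OF S a, folded U_def]
  obtain f where f: "lev m ((4 * m + 8) * (m + 1)) up a f"
    "{i \<in> {1..a}. \<exists>j\<in>{a+1..m}. f i = f j} = U \<inter> {1..a}"
    "{j \<in> {a+1..m}. \<exists>i\<in>{1..a}. f i = f j} = U \<inter> {a+1..m}"
    by (rule lev_match[OF U(1-3)])
  show ?thesis
  proof (intro exI[of _ f] conjI f(1) allI impI)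
    fix p s
    assume "\<forall>i\<in>{1..a}. \<forall>j\<in>{a+1..m}. ((i + s, j + s) \<in> p) \<noteq> al \<longleftrightarrow> f i = f j"
    then have "{i \<in> {1..a}. \<exists>j\<in>{a+1..m}. ((i + s, j + s) \<in> p) \<noteq> al} = {i \<in> {1..a}. \<exists>j\<in>{a+1..m}. f i = f j}"
      "{j \<in> {a+1..m}. \<exists>i\<in>{1..a}. ((i + s, j + s) \<in> p) \<noteq> al} = {j \<in> {a+1..m}. \<exists>i\<in>{1..a}. f i = f j}"
      by (intro Collect_cong conj_cong bex_cong refl; simp)+
    note this[unfolded f(2,3)]
    then show "match_decode al m s a p = S"
      unfolding match_decode_def using U(4) by simp
  qed
qed

lemma lev_half_decode:
  assumes S: "S \<subseteq> {1..m}" and a: "a = card S"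
  shows "\<exists>f. lev m m up a f \<and> f ` {1..a} = S \<and> f ` {a+1..m} = {1..m} - S \<and>
    (\<forall>i\<in>{1..a}. \<forall>j\<in>{a+1..m}. f i \<noteq> f j) \<and>
    (\<forall>p s. (\<forall>i\<in>{1..a}. \<forall>j\<in>{a+1..m}. ((i + s, j + s) \<in> p) = be \<longleftrightarrow> f j < f i)
      \<longrightarrow> half_decode be m s a p = S)"
proof -
  obtain f where f: "lev m m up a f" "f ` {1..a} = S" "f ` {a+1..m} = {1..m} - S"
    "\<And>i. i \<in> {1..a} \<Longrightarrow> f i = i + card {j \<in> {a+1..m}. f j < f i}"
    using lev_half[OF S a, where up = up] by blast
  show ?thesis
  proof (intro exI[of _ f] conjI f(1-3) ballI allI impI)
    fix i j assume "i \<in> {1..a}" "j \<in> {a+1..m}"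
    then show "f i \<noteq> f j" using f(2,3) by blast
  next
    fix p s
    assume p: "\<forall>i\<in>{1..a}. \<forall>j\<in>{a+1..m}. ((i + s, j + s) \<in> p) = be \<longleftrightarrow> f j < f i"
    have "i + card {j \<in> {a+1..m}. ((i + s, j + s) \<in> p) = be} = f i" if i: "i \<in> {1..a}" for i
    proof -
      have "{j \<in> {a+1..m}. ((i + s, j + s) \<in> p) = be} = {j \<in> {a+1..m}. f j < f i}"
        using p i by blast
      then show ?thesis using f(4)[OF i] by simp
    qed
    then show "half_decode be m s a p = S"
      unfolding half_decode_def f(2)[symmetric] by (intro image_cong) auto
  qed
qed

text \<open>If \<open>xi \<noteq> al\<close>, a first vertex with the lowest level sees where the right side starts.\<close>
lemma count_bip_marker:
  assumes b: "bip V e M up al be de xi et z y" and xi: "xi \<noteq> al" and de: "al = be \<longrightarrow> de \<noteq> al"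
    and M: "(4 * m + 8) * (m + 1) < M"
  shows "2 ^ m \<le> card (subs (m + 1) V e)"
proof -
  let ?a = "\<lambda>p. card {j \<in> {2..m+1}. ((1, j) \<in> p) = xi}"
  let ?p = "\<lambda>a f. lpat (m + 1) (a + 1) (\<lambda>i. if i = 1 then 1 else f (i - 1) + 1) al be de xi et"
  have deca: "?a (?p a f) = a" if "lev m K up a f" for K a f
  proof -
    have "((1, j) \<in> ?p a f) = xi \<longleftrightarrow> j \<le> a + 1" if j: "j \<in> {2..m+1}" for j
    proof -
      have "1 \<le> f (j - 1)" using lev_bounds[OF \<open>lev m K up a f\<close>, of "j - 1"] j by auto
      then show ?thesis using xi j by (auto simp: lpat_def)
    qed
    then have "{j \<in> {2..m+1}. ((1, j) \<in> ?p a f) = xi} = {2..a+1}"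
      by (rule Collect_initial) (use lev_le[OF that] in simp_all)
    then show ?thesis by simp
  qed
  have real: "\<exists>g. emb (m + 1) V g \<and> pat (m + 1) e g = ?p a f"
    if "lev m K up a f" "K < M" for K a f
    by (rule bip_realize[OF b], rule lev_mono[OF lev_marker[OF that(1)]]) (use that(2) in simp)
  have dec: "((i + 1, j + 1) \<in> ?p a f) \<longleftrightarrow> (if f i < f j then al else if f i = f j then de else be)"
    if "i \<in> {1..a}" "j \<in> {a+1..m}" for i j a and f :: "nat \<Rightarrow> nat"
    using that by (auto simp: lpat_def)
  have "card (Pow {1..m}) \<le> card (subs (m + 1) V e)"
  proof (cases "al = be")
    case True
    show ?thesis
    proof (rule card_subs_ge_decode[where dec = "\<lambda>p. match_decode al m 1 (?a p) p"])
      fix S assume "S \<in> Pow {1..m}"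
      then have S: "S \<subseteq> {1..m}" by simp
      define a where "a = card S"
      obtain f where f: "lev m ((4 * m + 8) * (m + 1)) up a f"
        "\<And>p s. \<forall>i\<in>{1..a}. \<forall>j\<in>{a+1..m}. ((i + s, j + s) \<in> p) \<noteq> al \<longleftrightarrow> f i = f j
          \<Longrightarrow> match_decode al m s a p = S"
        using lev_match_decode[OF S a_def, of up al] by blast
      obtain g where g: "emb (m + 1) V g" "pat (m + 1) e g = ?p a f"
        using real[OF f(1) M] by blast
      have "match_decode al m 1 a (?p a f) = S"
      proof (intro f(2) ballI)
        fix i j assume ij: "i \<in> {1..a}" "j \<in> {a+1..m}"
        show "((i + 1, j + 1) \<in> ?p a f) \<noteq> al \<longleftrightarrow> f i = f j"
          unfolding dec[OF ij] using True de by auto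
      qed
      then show "\<exists>g. emb (m + 1) V g \<and> match_decode al m 1 (?a (pat (m + 1) e g)) (pat (m + 1) e g) = S"
        by (intro exI[of _ g] conjI g(1)) (simp only: g(2) deca[OF f(1)])
    qed
  next
    case False
    have mM: "m < M" by (rule le_less_trans[OF _ M]) simp
    show ?thesis
    proof (rule card_subs_ge_decode[where dec = "\<lambda>p. half_decode be m 1 (?a p) p"])
      fix S assume "S \<in> Pow {1..m}"
      then have S: "S \<subseteq> {1..m}" by simp
      define a where "a = card S"
      obtain f where f: "lev m m up a f" "f ` {1..a} = S" "f ` {a+1..m} = {1..m} - S"
        "\<forall>i\<in>{1..a}. \<forall>j\<in>{a+1..m}. f i \<noteq> f j"
        "\<forall>p s. (\<forall>i\<in>{1..a}. \<forall>j\<in>{a+1..m}. ((i + s, j + s) \<in> p) = be \<longleftrightarrow> f j < f i)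
          \<longrightarrow> half_decode be m s a p = S"
        using lev_half_decode[OF S a_def, of up be] by (elim exE conjE) (rule that; assumption)
      obtain g where g: "emb (m + 1) V g" "pat (m + 1) e g = ?p a f"
        using real[OF f(1) mM] by blast
      have "half_decode be m 1 a (?p a f) = S"
      proof (intro f(5)[rule_format] ballI)
        fix i j assume ij: "i \<in> {1..a}" "j \<in> {a+1..m}"
        have "f i \<noteq> f j" using f(4) ij by blast
        then show "((i + 1, j + 1) \<in> ?p a f) = be \<longleftrightarrow> f j < f i"
          unfolding dec[OF ij] using False by auto
      qed
      then show "\<exists>g. emb (m + 1) V g \<and> half_decode be m 1 (?a (pat (m + 1) e g)) (pat (m + 1) e g) = S"
        by (intro exI[of _ g] conjI g(1)) (simp only: g(2) deca[OF f(1)])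
    qed
  qed
  then show ?thesis by (simp add: card_Pow)
qed

text \<open>The last vertex sees the left side in colour \<open>al\<close> and the right side in
  colour \<open>et\<close>, which reveals the cut. Its extreme level protects it from the colour
  \<open>de\<close>.\<close>

lemma count_bip_marker_last:
  assumes b: "bip V e M up al al de xi et z y" and et: "et \<noteq> al" and de: "de \<noteq> al"
    and M: "(4 * m + 8) * (m + 1) + 2 \<le> M"
  shows "2 ^ m \<le> card (subs (m + 1) V e)"
proof -
  let ?a = "\<lambda>p. card {i \<in> {1..m}. ((i, m + 1) \<in> p) = al}"
  have "card (Pow {1..m}) \<le> card (subs (m + 1) V e)"
  proof (rule card_subs_ge_decode[where dec = "\<lambda>p. match_decode al m 0 (?a p) p"])
    fix S assume "S \<in> Pow {1..m}"
    then have S: "S \<subseteq> {1..m}" by simp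
    define a where "a = card S"
    define K where "K = (4 * m + 8) * (m + 1)"
    obtain f where f: "lev m K up a f"
      "\<And>p s. \<forall>i\<in>{1..a}. \<forall>j\<in>{a+1..m}. ((i + s, j + s) \<in> p) \<noteq> al \<longleftrightarrow> f i = f j
        \<Longrightarrow> match_decode al m s a p = S"
      using lev_match_decode[OF S a_def, of up al, folded K_def] by blast
    define h where "h i = (if i = m + 1 then if up then K + 2 else 1 else f i + 1)" for i
    define p where "p = lpat (m + 1) a h al al de xi et"
    have am: "a \<le> m" using lev_le[OF f(1)] .
    have "lev (m + 1) (K + 2) up a h"
      unfolding h_def by (rule lev_marker_last[OF f(1)])
    then have "lev (m + 1) M up a h" by (rule lev_mono) (use M K_def in simp)
    from bip_realize[OF b this] obtain g where g: "emb (m + 1) V g" "pat (m + 1) e g = p"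
      unfolding p_def by blast
    have "((i, m + 1) \<in> p) = al \<longleftrightarrow> i \<le> a" if i: "i \<in> {1..m}" for i
    proof -
      have "1 \<le> f i" "f i \<le> K" using lev_bounds[OF f(1), of i] i by auto
      then have "h i \<noteq> h (m + 1)" using i by (auto simp: h_def)
      then show ?thesis using i et am unfolding p_def lpat_def by auto
    qed
    then have "{i \<in> {1..m}. ((i, m + 1) \<in> p) = al} = {1..a}"
      by (rule Collect_initial) (use am in simp_all)
    then have deca: "?a p = a" by simp
    have "((i, j) \<in> p) \<noteq> al \<longleftrightarrow> f i = f j" if "i \<in> {1..a}" "j \<in> {a+1..m}" for i j
      using that de unfolding p_def lpat_def h_def by auto
    then have "match_decode al m 0 a p = S" by (intro f(2)) simp
    then show "\<exists>g. emb (m + 1) V g \<and> match_decode al m 0 (?a (pat (m + 1) e g)) (pat (m + 1) e g) = S"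
      by (intro exI[of _ g] conjI g(1)) (simp only: g(2) deca)
  qed
  then show ?thesis by (simp add: card_Pow)
qed

text \<open>All colours but \<open>de\<close> agree: the matched vertices may be any set of even size.\<close>
lemma count_bip_matching:
  assumes b: "bip V e M up al al de al al z y" and de: "de \<noteq> al"
    and M: "(4 * n + 8) * (n + 1) \<le> M" and n: "1 \<le> n"
  shows "2 ^ (n - 1) \<le> card (subs n V e)"
proof -
  let ?D = "\<lambda>p. {i \<in> {1..<n}. \<exists>j\<in>{1..n}. j < i \<and> ((j, i) \<in> p) \<noteq> al \<or> i < j \<and> ((i, j) \<in> p) \<noteq> al}"
  have "card (Pow {1..<n}) \<le> card (subs n V e)"
  proof (rule card_subs_ge_decode[where dec = ?D])
    fix S assume "S \<in> Pow {1..<n}"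
    then have S: "S \<subseteq> {1..<n}" by simp
    have finS: "finite S" using finite_subset[OF S] by simp
    \<comment> \<open>A matching covers an even number of vertices. The decoding ignores position
      \<open>n\<close>, which is therefore free to correct the parity of \<open>S\<close>.\<close>
    define U where "U = (if even (card S) then S else insert n S)"
    have nS: "n \<notin> S" using S n by auto
    have S': "1 \<le> i \<and> i < n" if "i \<in> S" for i using S that by auto
    have "S \<subseteq> {1..n}" using S by auto
    then have U: "U \<subseteq> {1..n}" "finite U" "U \<inter> {1..<n} = S"
      using S n finS unfolding U_def by (cases "even (card S)"; auto)+
    have "even (card U)" using nS finS unfolding U_def by (cases "even (card S)") simp_all
    then obtain k where k: "card U = k + k" by (metis evenE mult_2)
    obtain u where u: "emb (card U) U u" "u ` {1..card U} = U" using emb_enum[OF U(2)] .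
    \<comment> \<open>The cut comes right after the \<open>k\<close>-th of the \<open>2 * k\<close>
      elements of \<open>U\<close>, so that each side has \<open>k\<close> vertices to match. If
      \<open>U\<close> is empty, \<open>u\<close> has no values to offer and the cut is put at
      \<open>0\<close>.\<close>
    define a where "a = (if k = 0 then 0 else u k)"
    have an: "a \<le> n" using emb_in[OF u(1), of k] k U(1) by (auto simp: a_def)
    have "U \<inter> {1..a} = u ` {1..k}"
    proof (intro set_eqI iffI)
      fix v assume v: "v \<in> U \<inter> {1..a}"
      then obtain i where i: "i \<in> {1..card U}" "v = u i" using u(2) by blast
      with v have "k \<noteq> 0" "u i \<le> u k" by (auto simp: a_def split: if_splits)
      then have "i \<le> k" using emb_less[OF u(1), of k i] i by force
      then show "v \<in> u ` {1..k}" using i by auto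
    next
      fix v assume "v \<in> u ` {1..k}"
      then obtain i where i: "i \<in> {1..k}" "v = u i" by blast
      then have "u i \<le> u k" using emb_less[OF u(1), of i k] k by (cases "i = k") auto
      moreover have "u i \<in> U" using i k by (intro emb_in[OF u(1)]) auto
      ultimately show "v \<in> U \<inter> {1..a}" using i U(1) by (auto simp: a_def)
    qed
    moreover have "inj_on u {1..k}" using emb_inj_on[OF u(1)] k by (auto intro: inj_on_subset)
    ultimately have c1: "card (U \<inter> {1..a}) = k" by (simp add: card_image)
    have "U \<inter> {a+1..n} = U - U \<inter> {1..a}" using U(1) by auto
    then have c2: "card (U \<inter> {a+1..n}) = k"
      using card_Diff_subset[of "U \<inter> {1..a}" U] U(2) c1 k by simp
    obtain f where f: "lev n ((4 * n + 8) * (n + 1)) up a f"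
      "{i \<in> {1..a}. \<exists>j\<in>{a+1..n}. f i = f j} = U \<inter> {1..a}"
      "{j \<in> {a+1..n}. \<exists>i\<in>{1..a}. f i = f j} = U \<inter> {a+1..n}"
      by (rule lev_match[OF an U(1)]) (use c1 c2 in simp)
    define p where "p = lpat n a f al al de al al"
    from bip_realize[OF b lev_mono[OF f(1) M]] obtain g where g: "emb n V g" "pat n e g = p"
      unfolding p_def by blast
    have rel: "((i, j) \<in> p) \<noteq> al \<longleftrightarrow> i \<le> a \<and> a < j \<and> f i = f j" if "1 \<le> i" "i < j" "j \<le> n" for i j
      using that de unfolding p_def lpat_def by auto
    have "i \<in> ?D p" if "i \<in> S" for i
    proof (cases "i \<le> a")
      case True
      then have "i \<in> U \<inter> {1..a}" using S' U(3) that by auto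
      then obtain j where "j \<in> {a+1..n}" "f i = f j" unfolding f(2)[symmetric] by blast
      then show ?thesis using rel[of i j] True S'[OF that] by (intro CollectI conjI bexI[of _ j]) auto
    next
      case False
      then have "i \<in> U \<inter> {a+1..n}" using S' U(1,3) that by auto
      then obtain j where "j \<in> {1..a}" "f j = f i" unfolding f(3)[symmetric] by blast
      then show ?thesis using rel[of j i] False S'[OF that] by (intro CollectI conjI bexI[of _ j]) auto
    qed
    moreover have "i \<in> S" if iD: "i \<in> ?D p" for i
    proof -
      have "i \<in> U"
      proof -
        obtain j where j: "j \<in> {1..n}" "j < i \<and> ((j, i) \<in> p) \<noteq> al \<or> i < j \<and> ((i, j) \<in> p) \<noteq> al"
          using iD by blast
        from j(2) have "i \<in> U \<inter> {a+1..n} \<or> i \<in> U \<inter> {1..a}"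
        proof
          assume "j < i \<and> ((j, i) \<in> p) \<noteq> al"
          then have "i \<in> U \<inter> {a+1..n}" unfolding f(3)[symmetric] using rel[of j i] j(1) iD by auto
          then show ?thesis ..
        next
          assume "i < j \<and> ((i, j) \<in> p) \<noteq> al"
          then have "i \<in> U \<inter> {1..a}" unfolding f(2)[symmetric] using rel[of i j] j(1) iD by auto
          then show ?thesis ..
        qed
        then show ?thesis by blast
      qed
      moreover have "i \<in> {1..<n}" using iD by blast
      ultimately show ?thesis using U(3) by blast
    qed
    ultimately have "?D p = S" by blast
    then show "\<exists>f. emb n V f \<and> ?D (pat n e f) = S"
      by (intro exI[of _ g] conjI g(1)) (simp only: g(2))
  qed
  then show ?thesis by (simp add: card_Pow)
qed

text \<open>\<open>S\<close> can be decoded once the number of left vertices is known, so it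
  suffices to find a large family \<open>A\<close> of sets for which this number is visible. Fixing
  the side of one extreme level achieves this, at the price of halving the \<open>2 ^ n\<close>
  sets.\<close>

lemma count_bip_half:
  assumes b: "bip V e M up al be de al et z y" and be: "be \<noteq> al"
    and M: "n \<le> M" and n: "1 \<le> n"
  shows "2 ^ (n - 1) \<le> card (subs n V e)"
proof -
  have gen: "card A \<le> card (subs n V e)"
    if A: "\<And>S. S \<in> A \<Longrightarrow> S \<subseteq> {1..n}"
      and a: "\<And>S f. S \<in> A \<Longrightarrow> lev n n up (card S) f \<Longrightarrow> f ` {1..card S} = S \<Longrightarrow>
        f ` {card S+1..n} = {1..n} - S \<Longrightarrow> ra (lpat n (card S) f al be de al et) = card S"
    for A and ra :: "(nat \<times> nat) set \<Rightarrow> nat"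
  proof -
    show ?thesis
    proof (rule card_subs_ge_decode[where dec = "\<lambda>p. half_decode be n 0 (ra p) p"])
      fix S assume SA: "S \<in> A"
      define a where "a = card S"
      obtain f where f: "lev n n up a f" "f ` {1..a} = S" "f ` {a+1..n} = {1..n} - S"
        "\<forall>i\<in>{1..a}. \<forall>j\<in>{a+1..n}. f i \<noteq> f j"
        "\<forall>p s. (\<forall>i\<in>{1..a}. \<forall>j\<in>{a+1..n}. ((i + s, j + s) \<in> p) = be \<longleftrightarrow> f j < f i)
          \<longrightarrow> half_decode be n s a p = S"
        using lev_half_decode[OF A[OF SA] a_def, of up be]
        by (elim exE conjE) (rule that; assumption)
      define p where "p = lpat n a f al be de al et"
      have ra: "ra p = a" using that(2)[OF SA] f(1-3) unfolding p_def a_def by simp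
      obtain g where g: "emb n V g" "pat n e g = p"
        using bip_realize[OF b lev_mono[OF f(1) M]] unfolding p_def by blast
      have "half_decode be n 0 a p = S"
      proof (intro f(5)[rule_format] ballI)
        fix i j assume ij: "i \<in> {1..a}" "j \<in> {a+1..n}"
        then have "f i \<noteq> f j" using f(4) by blast
        then show "((i + 0, j + 0) \<in> p) = be \<longleftrightarrow> f j < f i"
          using ij be unfolding p_def lpat_def by auto
      qed
      then show "\<exists>g. emb n V g \<and> half_decode be n 0 (ra (pat n e g)) (pat n e g) = S"
        by (intro exI[of _ g] conjI g(1)) (simp only: g(2) ra)
    qed
  qed
  show ?thesis
  proof (cases "et = al")
    case True
    \<comment> \<open>Level \<open>1\<close> is kept on the right, so every left vertex has a later
      vertex in colour \<open>be\<close>, whereas no right vertex has a later one in a colour other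
      than \<open>al\<close>.\<close>
    have "card (Pow {2..n}) \<le> card (subs n V e)"
    proof (rule gen[where ra = "\<lambda>p. card {i \<in> {1..n}. \<exists>j\<in>{1..n}. i < j \<and> ((i, j) \<in> p) \<noteq> al}"])
      fix S f assume S: "S \<in> Pow {2..n}" and l: "lev n n up (card S) f"
        and f: "f ` {1..card S} = S" "f ` {card S+1..n} = {1..n} - S"
      define a where "a = card S"
      have "a \<le> n" using l by (simp add: lev_def a_def)
      have "1 \<in> f ` {a+1..n}" using f(2) S n by (auto simp: a_def)
      then obtain j0 where j0: "j0 \<in> {a+1..n}" "f j0 = 1" by auto
      have big: "1 < f i" if "i \<in> {1..a}" for i
      proof -
        have "f i \<in> S" using f(1) that by (auto simp: a_def)
        then show ?thesis using S by auto
      qed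
      have "{i \<in> {1..n}. \<exists>j\<in>{1..n}. i < j \<and> ((i, j) \<in> lpat n a f al be de al et) \<noteq> al} = {1..a}"
      proof (intro set_eqI iffI)
        fix i assume "i \<in> {i \<in> {1..n}. \<exists>j\<in>{1..n}. i < j \<and> ((i, j) \<in> lpat n a f al be de al et) \<noteq> al}"
        then show "i \<in> {1..a}" using True by (auto simp: lpat_def split: if_splits)
      next
        fix i assume i: "i \<in> {1..a}"
        then have "((i, j0) \<in> lpat n a f al be de al et) \<noteq> al"
          using big[OF i] j0 be by (auto simp: lpat_def)
        then show "i \<in> {i \<in> {1..n}. \<exists>j\<in>{1..n}. i < j \<and> ((i, j) \<in> lpat n a f al be de al et) \<noteq> al}"
          using i j0 \<open>a \<le> n\<close> by (intro CollectI conjI bexI[of _ j0]) auto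
      qed
      then show "card {i \<in> {1..n}. \<exists>j\<in>{1..n}. i < j \<and> ((i, j) \<in> lpat n (card S) f al be de al et) \<noteq> al} = card S"
        by (simp add: a_def)
    qed auto
    then show ?thesis by (simp add: card_Pow)
  next
    case False
    \<comment> \<open>Level \<open>n\<close> is kept on the left, so every right vertex has an
      earlier one in colour \<open>be\<close>, whereas a left vertex sees all earlier ones in colour
      \<open>al\<close>.\<close>
    have "card (insert n ` Pow {1..<n}) \<le> card (subs n V e)"
    proof (rule gen[where ra = "\<lambda>p. card {j \<in> {1..n}. \<forall>i\<in>{1..n}. i < j \<longrightarrow> ((i, j) \<in> p) = al}"])
      fix S f assume S: "S \<in> insert n ` Pow {1..<n}" and l: "lev n n up (card S) f"
        and f: "f ` {1..card S} = S" "f ` {card S+1..n} = {1..n} - S"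
      define a where "a = card S"
      have "a \<le> n" using l by (simp add: lev_def a_def)
      have "n \<in> f ` {1..a}" using f(1) S by (auto simp: a_def)
      then obtain i0 where i0: "i0 \<in> {1..a}" "f i0 = n" by auto
      have small: "f j < n" if "j \<in> {a+1..n}" for j
      proof -
        have "f j \<in> {1..n} - S" using f(2) that by (auto simp: a_def)
        then show ?thesis using S by (cases "f j = n") auto
      qed
      have "{j \<in> {1..n}. \<forall>i\<in>{1..n}. i < j \<longrightarrow> ((i, j) \<in> lpat n a f al be de al et) = al} = {1..a}"
      proof (intro set_eqI iffI)
        fix j assume j: "j \<in> {j \<in> {1..n}. \<forall>i\<in>{1..n}. i < j \<longrightarrow> ((i, j) \<in> lpat n a f al be de al et) = al}"
        show "j \<in> {1..a}"
        proof (rule ccontr)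
          assume "j \<notin> {1..a}"
          then have j': "j \<in> {a+1..n}" using j by auto
          then have "((i0, j) \<in> lpat n a f al be de al et) \<noteq> al"
            using small[OF j'] i0 be by (auto simp: lpat_def)
          then show False using j i0 j' \<open>a \<le> n\<close> by auto
        qed
      next
        fix j assume "j \<in> {1..a}"
        then show "j \<in> {j \<in> {1..n}. \<forall>i\<in>{1..n}. i < j \<longrightarrow> ((i, j) \<in> lpat n a f al be de al et) = al}"
          using \<open>a \<le> n\<close> by (auto simp: lpat_def)
      qed
      then show "card {j \<in> {1..n}. \<forall>i\<in>{1..n}. i < j \<longrightarrow> ((i, j) \<in> lpat n (card S) f al be de al et) = al} = card S"
        by (simp add: a_def)
    qed (use n in auto)
    moreover have "inj_on (insert n) (Pow {1..<n})"
    proof (rule inj_onI)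
      fix A B assume AB: "A \<in> Pow {1..<n}" "B \<in> Pow {1..<n}" "insert n A = insert n B"
      then have "n \<notin> A" "n \<notin> B" using n by auto
      then show "A = B" using AB(3) by (metis insert_ident)
    qed
    ultimately show ?thesis by (simp add: card_image card_Pow)
  qed
qed

text \<open>The cases ask what can betray the position of the cut: a first vertex if
  \<open>xi\<close> differs from \<open>al\<close>, the half graph itself, or a last vertex if
  \<open>et\<close> differs from \<open>al\<close>. If nothing does, the cut is not decoded at all.
  The summand 2 makes room for the levels of a marker.\<close>

lemma count_bip:
  assumes b: "bip V e M up al be de xi et z y" and de: "al = be \<longrightarrow> de \<noteq> al"
    and M: "(4 * n + 8) * (n + 1) + 2 \<le> M" and n: "1 \<le> n"
  shows "2 ^ (n - 1) \<le> card (subs n V e)"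
proof -
  obtain m where m: "n = m + 1" using n by (metis le_add_diff_inverse2)
  have "(4 * m + 8) * (m + 1) \<le> (4 * n + 8) * (n + 1)" unfolding m by (intro mult_le_mono) auto
  then have Mm: "(4 * m + 8) * (m + 1) + 2 \<le> M" using M by linarith
  consider "xi \<noteq> al" | "xi = al" "be \<noteq> al" | "xi = al" "be = al" "et \<noteq> al" | "xi = al" "be = al" "et = al"
    by blast
  then show ?thesis
  proof cases
    case 1
    then show ?thesis using count_bip_marker[OF b 1 de] Mm m by simp
  next
    case 2
    have "n \<le> (4 * n + 8) * (n + 1)" by simp
    then show ?thesis using 2 b n M by (intro count_bip_half[of V e M up al be de et z y]) auto
  next
    case 3
    then show ?thesis using count_bip_marker_last[of V e M up al de xi et z y m] b de Mm m by simp
  next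
    case 4
    then show ?thesis using b de M n by (intro count_bip_matching[of V e M up al de z y]) auto
  qed
qed

section \<open>Ramsey arguments\<close>

text \<open>After a Ramsey step, either one column separates many of the pairs of rows, and choosing
  a row from each pair gives \<open>2 ^ (n - 1)\<close> neighbourhoods of that column; or each
  column separates only its own pair, and one row from each pair yields a structure
  \<open>bip\<close>.\<close>

lemma rows_differ_bound:
  assumes n: "1 \<le> n"
  shows "\<exists>T::nat. \<forall>V e x x' y.
    (\<forall>j<T. x j \<in> V \<and> x' j \<in> V \<and> y j \<in> V \<and> e (x j) (y j) \<noteq> e (x' j) (y j)) \<longrightarrow>
    (\<forall>j k. j < k \<longrightarrow> k < T \<longrightarrow> x j < x k \<and> x j < x' k \<and> x' j < x k \<and> x' j < x' k) \<longrightarrow>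
    (\<forall>j<T. \<forall>k<T. x j < y k \<and> x' j < y k) \<longrightarrow> 2 ^ (n - 1) \<le> card (subs n V e)"
proof -
  define M where "M = (4 * n + 8) * (n + 1) + 2"
  obtain R2 where R2: "\<And>c :: nat \<Rightarrow> nat \<Rightarrow> bool \<times> bool.
      \<exists>h k. emb M {..<R2} h \<and> (\<forall>i j. 1 \<le> i \<longrightarrow> i < j \<longrightarrow> j \<le> M \<longrightarrow> c (h i) (h j) = k)"
    using ramsey_pairs[of "UNIV :: (bool \<times> bool) set" M] by auto
  \<comment> \<open>Room for \<open>n - 1\<close> pairs with a common column and for the second
    Ramsey step.\<close>
  define m where "m = R2 + n + 2"
  obtain R1 where R1: "\<And>c :: nat \<Rightarrow> nat \<Rightarrow> bool \<times> bool \<times> bool \<times> bool \<times> bool \<times> bool.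
      \<exists>h k. emb m {..<R1} h \<and> (\<forall>i j. 1 \<le> i \<longrightarrow> i < j \<longrightarrow> j \<le> m \<longrightarrow> c (h i) (h j) = k)"
    using ramsey_pairs[of "UNIV :: (bool \<times> bool \<times> bool \<times> bool \<times> bool \<times> bool) set" m] by auto
  show ?thesis
  proof (intro exI[of _ R1] allI impI)
    fix V and e :: "nat \<Rightarrow> nat \<Rightarrow> bool" and x x' y :: "nat \<Rightarrow> nat"
    assume V: "\<forall>j<R1. x j \<in> V \<and> x' j \<in> V \<and> y j \<in> V \<and> e (x j) (y j) \<noteq> e (x' j) (y j)"
      and ord: "\<forall>j k. j < k \<longrightarrow> k < R1 \<longrightarrow> x j < x k \<and> x j < x' k \<and> x' j < x k \<and> x' j < x' k"
      and xy: "\<forall>j<R1. \<forall>k<R1. x j < y k \<and> x' j < y k"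
    define c where "c j k = (y j < y k, y k < y j, e (x j) (y k), e (x' j) (y k), e (x k) (y j), e (x' k) (y j))" for j k
    obtain h col where h: "emb m {..<R1} h"
      and col: "\<And>i j. 1 \<le> i \<Longrightarrow> i < j \<Longrightarrow> j \<le> m \<Longrightarrow> c (h i) (h j) = col"
      using R1[of c] by blast
    obtain p q a1 a2 b1 b2 where "col = (p, q, a1, a2, b1, b2)" by (cases col)
    with col have C: "y (h i) < y (h j) \<longleftrightarrow> p" "y (h j) < y (h i) \<longleftrightarrow> q"
      "e (x (h i)) (y (h j)) = a1" "e (x' (h i)) (y (h j)) = a2"
      "e (x (h j)) (y (h i)) = b1" "e (x' (h j)) (y (h i)) = b2"
      if "1 \<le> i" "i < j" "j \<le> m" for i j
      using that by (auto simp: c_def)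
    have hR: "h i < R1" if "1 \<le> i" "i \<le> m" for i using emb_in[OF h that] by simp
    have V': "x (h i) \<in> V" "x' (h i) \<in> V" "y (h i) \<in> V" "e (x (h i)) (y (h i)) \<noteq> e (x' (h i)) (y (h i))"
      if "1 \<le> i" "i \<le> m" for i using V hR[OF that] by blast+
    have xy': "x (h i) < y (h j) \<and> x' (h i) < y (h j)" if "1 \<le> i" "i \<le> m" "1 \<le> j" "j \<le> m" for i j
      using xy hR that by blast
    have ord': "x (h i) < x (h j) \<and> x (h i) < x' (h j) \<and> x' (h i) < x (h j) \<and> x' (h i) < x' (h j)"
      if "1 \<le> i" "i < j" "j \<le> m" for i j
    proof -
      have "h i < h j" "h j < R1" using emb_less[OF h that] hR[of j] that by auto
      then show ?thesis using ord by blast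
    qed
    have nm: "n < m" by (simp add: m_def)
    consider "\<not> p \<and> \<not> q" | "a1 \<noteq> a2" | "b1 \<noteq> b2" | "p \<or> q" "a1 = a2" "b1 = b2" by blast
    then show "2 ^ (n - 1) \<le> card (subs n V e)"
    proof cases
      case 1
      have y1: "y (h j) = y (h 1)" if "1 \<le> j" "j < n" for j
      proof (cases "j = 1")
        case False
        then show ?thesis using C(1,2)[of 1 j] 1 that nm by auto
      qed simp
      show ?thesis
      proof (rule pair_choice_right[OF n])
        fix j assume j: "1 \<le> j" "j < n"
        show "e (x (h j)) (y (h 1)) \<noteq> e (x' (h j)) (y (h 1))"
          using V'(4)[of j] j nm unfolding y1[OF j] by simp
      qed (use V' xy' ord' nm in auto)
    next
      case 2
      show ?thesis
        by (rule pair_choice_right[OF n, of "y (h m)" V "\<lambda>j. x (h j)" "\<lambda>j. x' (h j)"])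
          (use V' xy' ord' nm C(3,4) 2 in auto)
    next
      case 3
      show ?thesis
        by (rule pair_choice_right[OF n, of "y (h 1)" V "\<lambda>j. x (h (j + 1))" "\<lambda>j. x' (h (j + 1))"])
          (use V' xy' ord' nm C(5,6)[of 1] 3 in auto)
    next
      case 4
      \<comment> \<open>Of two rows that differ in their own column, one has there the colour
        opposite to \<open>a1\<close>. Choosing it makes \<open>de\<close> equal to
        \<open>\<not> a1\<close>, as \<open>count_bip\<close> requires when
        \<open>al = be\<close>.\<close>
      define z where "z j = (if e (x (h j)) (y (h j)) \<noteq> a1 then x (h j) else x' (h j))" for j
      have zz: "z i < z j" if "1 \<le> i" "i < j" "j \<le> m" for i j
        using ord'[OF that] by (auto simp: z_def)
      have zy: "z i < y (h j)" if "1 \<le> i" "i \<le> m" "1 \<le> j" "j \<le> m" for i j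
        using xy'[OF that] by (auto simp: z_def)
      have zV: "z i \<in> V" if "1 \<le> i" "i \<le> m" for i using V' that by (auto simp: z_def)
      have rel: "e (z i) (y (h j)) = (if i < j then a1 else if i = j then \<not> a1 else b1)"
        if "1 \<le> i" "i \<le> m" "1 \<le> j" "j \<le> m" for i j
        using C(3,4)[of i j] C(5,6)[of j i] 4 that V'(4)[of i] by (cases i j rule: linorder_cases) (auto simp: z_def)
      have yup: "if p then y (h i) < y (h j) else y (h j) < y (h i)" if "1 \<le> i" "i < j" "j \<le> m" for i j
        using C(1,2)[OF that] 4(1) by auto
      \<comment> \<open>The second Ramsey step fixes the colours inside the two sides. Its indices
        start at \<open>0\<close> and those of \<open>h\<close> at \<open>1\<close>, hence the
        shift.\<close>
      define c' where "c' j k = (e (z (j + 1)) (z (k + 1)),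
          if p then e (y (h (j + 1))) (y (h (k + 1))) else e (y (h (k + 1))) (y (h (j + 1))))" for j k
      obtain g xi et where g: "emb M {..<R2} g"
        and g': "\<And>i j. 1 \<le> i \<Longrightarrow> i < j \<Longrightarrow> j \<le> M \<Longrightarrow> c' (g i) (g j) = (xi, et)"
        using R2[of c'] by (metis surj_pair)
      have gm: "1 \<le> g i + 1 \<and> g i + 1 \<le> m" if "i \<in> {1..M}" for i
        using emb_in[OF g, of i] that by (auto simp: m_def)
      have "bip V e M p a1 b1 (\<not> a1) xi et (\<lambda>j. z (g j + 1)) (\<lambda>j. y (h (g j + 1)))"
        unfolding bip_def
      proof (intro conjI ballI impI)
        fix j assume j: "j \<in> {1..M}"
        show "z (g j + 1) \<in> V" "y (h (g j + 1)) \<in> V" using gm[OF j] zV V'(3) by blast+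
      next
        fix j k assume jk: "j \<in> {1..M}" "k \<in> {1..M}"
        show "z (g j + 1) < y (h (g k + 1))" using gm jk zy by blast
        have "g j < g k \<longleftrightarrow> j < k" "g j = g k \<longleftrightarrow> j = k"
          using emb_less_iff[OF g] jk by (metis atLeastAtMost_iff less_irrefl linorder_neqE_nat)+
        then show "e (z (g j + 1)) (y (h (g k + 1))) = (if j < k then a1 else if j = k then \<not> a1 else b1)"
          using gm[OF jk(1)] gm[OF jk(2)] rel by simp
        assume lt: "j < k"
        then have glt: "1 \<le> g j + 1" "g j + 1 < g k + 1" "g k + 1 \<le> m"
          using gm[OF jk(1)] gm[OF jk(2)] emb_less[OF g, of j k] jk by auto
        have cc: "c' (g j) (g k) = (xi, et)" using g' jk lt by simp
        show "z (g j + 1) < z (g k + 1)" by (rule zz[OF glt])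
        show "e (z (g j + 1)) (z (g k + 1)) = xi" using cc by (simp add: c'_def)
        show "if p then y (h (g j + 1)) < y (h (g k + 1)) \<and> e (y (h (g j + 1))) (y (h (g k + 1))) = et
          else y (h (g k + 1)) < y (h (g j + 1)) \<and> e (y (h (g k + 1))) (y (h (g j + 1))) = et"
          using cc yup[OF glt] unfolding c'_def by (cases p) auto
      qed
      then show ?thesis by (rule count_bip) (use n in \<open>auto simp: M_def\<close>)
    qed
  qed
qed

text \<open>The colour of two blocks records all adjacencies between them. If the common matrix
  \<open>D\<close> had two different rows or columns, then choosing one of two vertices in many
  blocks, as seen from a single vertex of another block, would give \<open>2 ^ (n - 1)\<close>
  subgraphs. Hence \<open>D\<close> is constant.\<close>

lemma ramsey_blocks:
  assumes n: "1 \<le> n" and fin: "finite (Q :: 'i set)" "finite (Ts :: 't set)"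
  shows "\<exists>R. \<forall>V e d t. (\<forall>a<R. \<forall>i\<in>Q. d a i \<in> V) \<longrightarrow> (\<forall>a<R. t a \<in> Ts) \<longrightarrow>
    (\<forall>a b. a < b \<longrightarrow> b < R \<longrightarrow> (\<forall>i\<in>Q. \<forall>j\<in>Q. d a i < d b j)) \<longrightarrow> card (subs n V e) < 2 ^ (n - 1) \<longrightarrow>
    (\<exists>h ga ty. emb m {..<R} h \<and> (\<forall>a. 1 \<le> a \<longrightarrow> a \<le> m \<longrightarrow> t (h a) = ty) \<and>
      (\<forall>a b. 1 \<le> a \<longrightarrow> a < b \<longrightarrow> b \<le> m \<longrightarrow> (\<forall>i\<in>Q. \<forall>j\<in>Q. e (d (h a) i) (d (h b) j) = ga)))"
proof -
  \<comment> \<open>\<open>n - 1\<close> blocks offer a choice and one more contains the vertex that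
    sees it. The type of a block is recorded only in pairs that it begins, so block \<open>m\<close>
    needs a successor.\<close>
  define m' where "m' = m + n + 1"
  have "finite (Pow (Q \<times> Q) \<times> Ts)" using fin by simp
  from ramsey_pairs[OF this, of m'] obtain R where R: "\<And>c :: nat \<Rightarrow> nat \<Rightarrow> ('i \<times> 'i) set \<times> 't.
      (\<forall>i j. i < j \<longrightarrow> j < R \<longrightarrow> c i j \<in> Pow (Q \<times> Q) \<times> Ts) \<Longrightarrow>
      \<exists>h k. emb m' {..<R} h \<and> (\<forall>i j. 1 \<le> i \<longrightarrow> i < j \<longrightarrow> j \<le> m' \<longrightarrow> c (h i) (h j) = k)" by blast
  show ?thesis
  proof (rule exI[of _ R], intro allI impI)
    fix V e and d :: "nat \<Rightarrow> 'i \<Rightarrow> nat" and t :: "nat \<Rightarrow> 't"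
    assume dV: "\<forall>a<R. \<forall>i\<in>Q. d a i \<in> V" and t: "\<forall>a<R. t a \<in> Ts"
      and dd: "\<forall>a b. a < b \<longrightarrow> b < R \<longrightarrow> (\<forall>i\<in>Q. \<forall>j\<in>Q. d a i < d b j)"
      and few: "card (subs n V e) < 2 ^ (n - 1)"
    define c where "c a b = ({ij \<in> Q \<times> Q. e (d a (fst ij)) (d b (snd ij))}, t a)" for a b
    have "\<forall>i j. i < j \<longrightarrow> j < R \<longrightarrow> c i j \<in> Pow (Q \<times> Q) \<times> Ts" using t by (auto simp: c_def)
    from R[OF this] obtain h col where h: "emb m' {..<R} h"
      and col: "\<And>i j. 1 \<le> i \<Longrightarrow> i < j \<Longrightarrow> j \<le> m' \<Longrightarrow> c (h i) (h j) = col" by blast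
    obtain D ty where Dty: "col = (D, ty)" by (cases col)
    have hR: "h a < R" if "1 \<le> a" "a \<le> m'" for a using emb_in[OF h that] by simp
    have ty: "t (h a) = ty" if "1 \<le> a" "a \<le> m" for a
      using col[of a "a + 1"] that Dty by (auto simp: c_def m'_def)
    have D: "e (d (h a) i) (d (h b) j) \<longleftrightarrow> (i, j) \<in> D" if "1 \<le> a" "a < b" "b \<le> m'" "i \<in> Q" "j \<in> Q" for a b i j
    proof -
      have "D = {ij \<in> Q \<times> Q. e (d (h a) (fst ij)) (d (h b) (snd ij))}"
        using col[OF that(1-3)] Dty by (simp add: c_def)
      then show ?thesis using that by auto
    qed
    have V': "d (h a) i \<in> V" if "1 \<le> a" "a \<le> m'" "i \<in> Q" for a i
      using dV hR that by blast
    have lt: "d (h a) i < d (h b) j" if "1 \<le> a" "a < b" "b \<le> m'" "i \<in> Q" "j \<in> Q" for a b i j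
      using dd emb_less[OF h that(1-3)] hR[of b] that by auto
    have rows: "(i, j) \<in> D \<longleftrightarrow> (i', j) \<in> D" if Q: "i \<in> Q" "i' \<in> Q" "j \<in> Q" for i i' j
    proof (rule ccontr)
      assume ne: "\<not> ?thesis"
      have "2 ^ (n - 1) \<le> card (subs n V e)"
        by (rule pair_choice_right[OF n, of "d (h m') j" V "\<lambda>a. d (h a) i" "\<lambda>a. d (h a) i'"])
          (use V' lt D ne Q in \<open>auto simp: m'_def\<close>)
      then show False using few by simp
    qed
    have cols: "(i, j) \<in> D \<longleftrightarrow> (i, j') \<in> D" if Q: "i \<in> Q" "j \<in> Q" "j' \<in> Q" for i j j'
    proof (rule ccontr)
      assume ne: "\<not> ?thesis"
      have "2 ^ (n - 1) \<le> card (subs n V e)"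
        by (rule pair_choice_left[OF n, of "d (h 1) i" V "\<lambda>a. d (h (a + 1)) j" "\<lambda>a. d (h (a + 1)) j'"])
          (use V' lt D ne Q in \<open>auto simp: m'_def\<close>)
      then show False using few by simp
    qed
    have "\<exists>ga. \<forall>i\<in>Q. \<forall>j\<in>Q. (i, j) \<in> D \<longleftrightarrow> ga"
    proof (cases "Q = {}")
      case False
      then obtain i0 where "i0 \<in> Q" by blast
      then show ?thesis using rows cols by (intro exI[of _ "(i0, i0) \<in> D"]) blast
    qed simp
    then obtain ga where ga: "\<And>i j. i \<in> Q \<Longrightarrow> j \<in> Q \<Longrightarrow> (i, j) \<in> D \<longleftrightarrow> ga" by blast
    have "emb m {..<R} h" by (rule embI) (use emb_less[OF h] hR in \<open>auto simp: m'_def\<close>)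
    then show "\<exists>h ga ty. emb m {..<R} h \<and> (\<forall>a. 1 \<le> a \<longrightarrow> a \<le> m \<longrightarrow> t (h a) = ty) \<and>
      (\<forall>a b. 1 \<le> a \<longrightarrow> a < b \<longrightarrow> b \<le> m \<longrightarrow> (\<forall>i\<in>Q. \<forall>j\<in>Q. e (d (h a) i) (d (h b) j) = ga))"
      using ty D ga by (intro exI[of _ h] exI[of _ ga] exI[of _ ty]) (auto simp: m'_def)
  qed
qed

section \<open>Counting sums of indecomposable graphs\<close>

text \<open>Being no sum of two nonempty graphs. This is weaker than connectedness:
  \<open>Q1\<close> and \<open>Q2\<close> are indecomposable.\<close>

definition indec :: "ograph \<Rightarrow> bool" where
  "indec G \<longleftrightarrow> 1 \<le> fst G \<and> (\<forall>c. 1 \<le> c \<and> c < fst G \<longrightarrow> (\<exists>i j. (i, j) \<in> snd G \<and> i \<le> c \<and> c < j))"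

text \<open>The host is a relation, read on increasing pairs only, so that the complement can be a
  host too.\<close>

definition occ :: "(nat \<Rightarrow> nat \<Rightarrow> bool) \<Rightarrow> nat set \<Rightarrow> ograph \<Rightarrow> bool" where
  "occ e W A \<longleftrightarrow> (\<exists>f. emb (fst A) W f \<and> snd A = pat (fst A) e f)"

inductive_set sums :: "ograph set \<Rightarrow> ograph set" for S where
  sums_empty: "(0, {}) \<in> sums S"
| sums_plus: "B \<in> S \<Longrightarrow> G \<in> sums S \<Longrightarrow> og_plus B G \<in> sums S"

lemma occ_ord_graph: "occ e W A \<Longrightarrow> ord_graph A"
  by (auto simp: occ_def ord_graph_def pat_def)

lemma ord_graphD: "ord_graph A \<Longrightarrow> (i, j) \<in> snd A \<Longrightarrow> 1 \<le> i \<and> i < j \<and> j \<le> fst A"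
  by (auto simp: ord_graph_def)

lemma ord_graph_plus: "ord_graph A \<Longrightarrow> ord_graph B \<Longrightarrow> ord_graph (og_plus A B)"
  by (fastforce simp: ord_graph_def og_plus_def)

lemma fst_plus [simp]: "fst (og_plus A B) = fst A + fst B"
  by (simp add: og_plus_def)

lemma snd_plus_iff:
  "(i, j) \<in> snd (og_plus A B) \<longleftrightarrow> (i, j) \<in> snd A \<or> (fst A \<le> i \<and> fst A \<le> j \<and> (i - fst A, j - fst A) \<in> snd B)"
proof -
  have "(i, j) \<in> (\<lambda>(i, j). (i + fst A, j + fst A)) ` snd B \<longleftrightarrow>
    fst A \<le> i \<and> fst A \<le> j \<and> (i - fst A, j - fst A) \<in> snd B"
    by (force intro: image_eqI[of _ _ "(i - fst A, j - fst A)"])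
  then show ?thesis by (simp add: og_plus_def)
qed

lemma finite_ord_graphs: "finite {G. ord_graph G \<and> fst G \<le> n}"
proof (rule finite_subset)
  show "{G. ord_graph G \<and> fst G \<le> n} \<subseteq> {..n} \<times> Pow ({..n} \<times> {..n})"
    by (auto simp: ord_graph_def)
qed simp

lemma sums_ord_graph: "G \<in> sums S \<Longrightarrow> (\<And>B. B \<in> S \<Longrightarrow> ord_graph B) \<Longrightarrow> ord_graph G"
  by (induction rule: sums.induct) (auto simp: ord_graph_plus, simp add: ord_graph_def)

text \<open>Otherwise \<open>B'\<close> has an edge over the cut behind \<open>B\<close>, where a
  sum with first summand \<open>B\<close> has none.\<close>

lemma indec_plus_fst_le:
  assumes "ord_graph B" "ord_graph B'" "ord_graph G" "indec B" "indec B'"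
    and eq: "og_plus B G = og_plus B' G'"
  shows "fst B' \<le> fst B"
proof (rule ccontr)
  assume lt: "\<not> ?thesis"
  then have "1 \<le> fst B \<and> fst B < fst B'" using assms(4) by (auto simp: indec_def)
  then obtain i j where ij: "(i, j) \<in> snd B'" "i \<le> fst B" "fst B < j"
    using assms(5) unfolding indec_def by blast
  have "(i, j) \<in> snd (og_plus B G)" unfolding eq using ij by (simp add: snd_plus_iff)
  then show False
    using ij ord_graphD[OF assms(1)] ord_graphD[OF assms(3)] by (fastforce simp: snd_plus_iff)
qed

text \<open>Comparing orders in both directions determines the length of the first summand, and
  restriction gives the rest. Sums thus behave like words over the alphabet of their
  summands.\<close>

lemma indec_plus_inj:
  assumes "ord_graph B" "ord_graph B'" "ord_graph G" "ord_graph G'" "indec B" "indec B'"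
    and eq: "og_plus B G = og_plus B' G'"
  shows "B = B' \<and> G = G'"
proof -
  have f: "fst B = fst B'"
    using indec_plus_fst_le[of B B' G G'] indec_plus_fst_le[of B' B G' G] assms by force
  have "fst (og_plus B G) = fst (og_plus B' G')" using eq by simp
  then have g: "fst G = fst G'" using f by simp
  have split: "(i, j) \<in> snd C \<longleftrightarrow> (i, j) \<in> snd (og_plus C D) \<and> j \<le> fst C"
    "(i, j) \<in> snd D \<longleftrightarrow> 1 \<le> i \<and> (i + fst C, j + fst C) \<in> snd (og_plus C D)"
    if "ord_graph C" "ord_graph D" for C D i j
    using ord_graphD[OF that(1)] ord_graphD[OF that(2)] by (fastforce simp: snd_plus_iff)+
  have "snd B = snd B'" using split(1)[of B G] split(1)[of B' G'] assms f by auto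
  moreover have "snd G = snd G'" using split(2)[of B G] split(2)[of B' G'] assms f by auto
  ultimately show ?thesis using f g by (simp add: prod_eq_iff)
qed

text \<open>Sums with different first summands are different, so their numbers satisfy the recursion
  for words whose letters have lengths.\<close>

lemma card_sums_ge:
  fixes S :: "ograph set"
  assumes fin: "finite S" and S: "\<And>B. B \<in> S \<Longrightarrow> ord_graph B \<and> indec B"
  shows "(\<Sum>B\<in>{B \<in> S. fst B \<le> n}. card {G \<in> sums S. fst G = n - fst B}) \<le> card {G \<in> sums S. fst G = n}"
proof -
  have finT: "finite {G \<in> sums S. fst G = k}" for k
    by (rule finite_subset[OF _ finite_ord_graphs[of k]]) (use S in \<open>auto intro: sums_ord_graph\<close>)
  have og: "ord_graph G" if "G \<in> sums S" for G using sums_ord_graph[OF that] S by blast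
  have inj: "inj_on (og_plus B) {G \<in> sums S. fst G = k}" if "B \<in> S" for B k
    using indec_plus_inj[of B B] S[OF that] og by (intro inj_onI) blast
  have "(\<Sum>B\<in>{B \<in> S. fst B \<le> n}. card {G \<in> sums S. fst G = n - fst B})
      = (\<Sum>B\<in>{B \<in> S. fst B \<le> n}. card (og_plus B ` {G \<in> sums S. fst G = n - fst B}))"
    using inj by (intro sum.cong) (auto simp: card_image)
  also have "\<dots> = card (\<Union>B\<in>{B \<in> S. fst B \<le> n}. og_plus B ` {G \<in> sums S. fst G = n - fst B})"
  proof (rule card_UN_disjoint[symmetric])
    show "\<forall>B\<in>{B \<in> S. fst B \<le> n}. \<forall>B'\<in>{B \<in> S. fst B \<le> n}. B \<noteq> B' \<longrightarrow>
        og_plus B ` {G \<in> sums S. fst G = n - fst B} \<inter> og_plus B' ` {G \<in> sums S. fst G = n - fst B'} = {}"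
    proof (intro ballI impI, rule ccontr)
      fix B B'
      assume B: "B \<in> {B \<in> S. fst B \<le> n}" "B' \<in> {B \<in> S. fst B \<le> n}" "B \<noteq> B'"
        and "og_plus B ` {G \<in> sums S. fst G = n - fst B} \<inter> og_plus B' ` {G \<in> sums S. fst G = n - fst B'} \<noteq> {}"
      then obtain X where X: "X \<in> og_plus B ` {G \<in> sums S. fst G = n - fst B}"
        "X \<in> og_plus B' ` {G \<in> sums S. fst G = n - fst B'}" by blast
      from X(1) obtain G where G: "G \<in> sums S" "X = og_plus B G" by blast
      from X(2) obtain G' where G': "G' \<in> sums S" "X = og_plus B' G'" by blast
      have BS: "B \<in> S" "B' \<in> S" using B(1,2) by simp_all
      have "og_plus B G = og_plus B' G'" using G(2) G'(2) by simp
      from indec_plus_inj[OF _ _ _ _ _ _ this] have "B = B'"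
        using S[OF BS(1)] S[OF BS(2)] og[OF G(1)] og[OF G'(1)] by simp
      then show False using B(3) by simp
    qed
  qed (use fin finT in auto)
  also have "\<dots> \<le> card {G \<in> sums S. fst G = n}"
    by (rule card_mono[OF finT]) (auto intro: sums_plus)
  finally show ?thesis .
qed

lemma card_sums_0: "1 \<le> card {G \<in> sums S. fst G = 0}" if "\<And>B. B \<in> S \<Longrightarrow> ord_graph B"
proof -
  have "finite {G \<in> sums S. fst G = 0}"
    by (rule finite_subset[OF _ finite_ord_graphs[of 0]]) (use that in \<open>auto intro: sums_ord_graph\<close>)
  moreover have "(0, {}) \<in> {G \<in> sums S. fst G = 0}" by (simp add: sums_empty)
  ultimately have "0 < card {G \<in> sums S. fst G = 0}" by (subst card_gt_0_iff) blast
  then show ?thesis by simp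
qed

lemma sized_le:
  assumes "\<And>i. 1 \<le> i \<Longrightarrow> i \<le> k \<Longrightarrow> ord_graph (G i) \<and> indec (G i) \<and> fst (G i) = i"
  shows "G ` {1..min n k} = {B \<in> G ` {1..k}. fst B \<le> n}"
  using assms by auto

text \<open>One summand of each order up to \<open>k\<close> gives a sum for each composition of
  \<open>n\<close> into parts of size at most \<open>k\<close>, hence the recursion of
  \<open>F\<close>.\<close>

lemma card_sums_ge_F:
  assumes G: "\<And>i. 1 \<le> i \<Longrightarrow> i \<le> k \<Longrightarrow> ord_graph (G i) \<and> indec (G i) \<and> fst (G i) = i"
  shows "F n k \<le> card {H \<in> sums (G ` {1..k}). fst H = n}"
proof (induction n rule: less_induct)
  case (less n)
  let ?S = "G ` {1..k}"
  have S: "ord_graph B \<and> indec B" if "B \<in> ?S" for B using that G by auto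
  show ?case
  proof (cases "n = 0")
    case True then show ?thesis using card_sums_0[of ?S] S by (simp add: F_0)
  next
    case False
    have "F n k = (\<Sum>i\<in>{1..min n k}. F (n - i) k)" using False by (intro F_rec) simp
    also have "\<dots> \<le> (\<Sum>i\<in>{1..min n k}. card {H \<in> sums ?S. fst H = n - i})"
      using False by (intro sum_mono less) auto
    also have "\<dots> = (\<Sum>B\<in>G ` {1..min n k}. card {H \<in> sums ?S. fst H = n - fst B})"
    proof (subst sum.reindex)
      show "inj_on G {1..min n k}"
        by (rule inj_on_inverseI[of _ fst]) (use G in auto)
    qed (use G in auto)
    also have "G ` {1..min n k} = {B \<in> ?S. fst B \<le> n}" by (rule sized_le[OF G])
    also have "(\<Sum>B\<in>\<dots>. card {H \<in> sums ?S. fst H = n - fst B}) \<le> card {H \<in> sums ?S. fst H = n}"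
      by (rule card_sums_ge) (use S in auto)
    finally show ?thesis .
  qed
qed

text \<open>The second graph of order \<open>s\<close> doubles the last term of the recursion, and
  \<open>x = 2\<close> solves \<open>x ^ s = x ^ (s - 1) + ... + x + 2\<close>. For
  \<open>n < s\<close> the recursion is that of all compositions.\<close>

lemma card_sums_ge_pow2:
  assumes G: "\<And>i. 1 \<le> i \<Longrightarrow> i \<le> s \<Longrightarrow> ord_graph (G i) \<and> indec (G i) \<and> fst (G i) = i"
    and s: "1 \<le> s" and B: "ord_graph B" "indec B" "fst B = s" "B \<noteq> G s" and n: "1 \<le> n"
  shows "2 ^ (n - 1) \<le> card {H \<in> sums (insert B (G ` {1..s})). fst H = n}"
  using n
proof (induction n rule: less_induct)
  case (less n)
  let ?S = "insert B (G ` {1..s})"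
  let ?c = "\<lambda>n. card {H \<in> sums ?S. fst H = n}"
  have S: "ord_graph A \<and> indec A" if "A \<in> ?S" for A using that G B by auto
  have c0: "1 \<le> ?c 0" using card_sums_0[of ?S] S by blast
  have BG: "B \<notin> G ` {1..s}" using B G by auto
  have inj: "inj_on G {1..s}" by (rule inj_on_inverseI[of _ fst]) (use G in auto)
  have rec: "(\<Sum>A\<in>{A \<in> ?S. fst A \<le> n}. ?c (n - fst A)) \<le> ?c n"
    by (rule card_sums_ge) (use S in auto)
  have Gsum: "(\<Sum>A\<in>G ` {1..t}. ?c (n - fst A)) = (\<Sum>i\<in>{1..t}. ?c (n - i))" if "t \<le> s" for t
    using that G inj_on_subset[OF inj, of "{1..t}"] by (subst sum.reindex) auto
  have pw: "(\<Sum>i\<in>{1..t}. 2 ^ (n - i)) + 2 ^ (n - t) = (2::nat) ^ n" if "t \<le> n" for t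
    using that
  proof (induction t)
    case (Suc t)
    have "(2::nat) ^ (n - t) = 2 * 2 ^ (n - Suc t)"
      using Suc.prems by (metis Suc_diff_Suc Suc_le_eq power_Suc)
    then show ?case using Suc by simp
  qed simp
  show ?case
  proof (cases "n < s")
    case True
    have "{A \<in> ?S. fst A \<le> n} = {A \<in> G ` {1..s}. fst A \<le> n}" using B(3) True by auto
    also have "\<dots> = G ` {1..n}" using sized_le[OF G, of s n] True by (simp add: min_def)
    finally have "{A \<in> ?S. fst A \<le> n} = G ` {1..n}" .
    then have le: "(\<Sum>i\<in>{1..n}. ?c (n - i)) \<le> ?c n" using rec Gsum[of n] True by simp
    have "2 * 2 ^ (n - 1) = (\<Sum>i\<in>{1..n}. 2 ^ (n - i)) + (1::nat)"
      using pw[of n] less.prems by (metis diff_self_eq_0 le_refl power_0 power_eq_if not_one_le_zero)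
    also have "\<dots> = (\<Sum>i\<in>{1..n-1}. 2 ^ (n - i)) + 2"
      using less.prems by (cases n) auto
    also have "(\<Sum>i\<in>{1..n-1}. 2 ^ (n - i)) \<le> (\<Sum>i\<in>{1..n-1}. 2 * ?c (n - i))"
    proof (rule sum_mono)
      fix i assume i: "i \<in> {1..n-1}"
      then have "2 ^ (n - i - 1) \<le> ?c (n - i)" by (intro less.IH) auto
      moreover have "n - i = Suc (n - i - 1)" using i by auto
      then have "(2::nat) ^ (n - i) = 2 * 2 ^ (n - i - 1)" by (metis power_Suc)
      ultimately show "2 ^ (n - i) \<le> 2 * ?c (n - i)" by linarith
    qed
    also have "(\<Sum>i\<in>{1..n-1}. 2 * ?c (n - i)) + 2 \<le> (\<Sum>i\<in>{1..n}. 2 * ?c (n - i))"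
      using less.prems c0 by (cases n) auto
    also have "\<dots> = 2 * (\<Sum>i\<in>{1..n}. ?c (n - i))" by (simp add: sum_distrib_left)
    finally have "2 ^ (n - 1) \<le> (\<Sum>i\<in>{1..n}. ?c (n - i))" by (simp only: mult_le_cancel1 zero_less_numeral simp_thms)
    then show ?thesis using le by (rule order_trans)
  next
    case False
    have "{A \<in> ?S. fst A \<le> n} = ?S" using G B(3) False by auto
    then have le: "?c (n - s) + (\<Sum>i\<in>{1..s}. ?c (n - i)) \<le> ?c n"
      using rec Gsum[of s] BG B by simp
    have lower: "2 ^ (n - i) \<le> 2 * ?c (n - i)" if "1 \<le> i" "i < n" for i
    proof -
      have "2 ^ (n - i - 1) \<le> ?c (n - i)" using that by (intro less.IH) auto
      moreover have "n - i = Suc (n - i - 1)" using that by auto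
      then have "(2::nat) ^ (n - i) = 2 * 2 ^ (n - i - 1)" by (metis power_Suc)
      ultimately show ?thesis by linarith
    qed
    \<comment> \<open>Doubling both sides avoids the exponent \<open>n - i - 1\<close>, which does
      not exist for \<open>i = n\<close>.\<close>
    have lower': "2 ^ (n - i) \<le> 2 * ?c (n - i)" if "1 \<le> i" "i \<le> n" for i
      using lower[of i] that c0 by (cases "i = n") auto
    have "2 * 2 ^ (n - 1) = (\<Sum>i\<in>{1..s}. 2 ^ (n - i)) + (2::nat) ^ (n - s)"
      using pw[of s] False less.prems by (metis leI not_one_le_zero power_eq_if)
    also have "\<dots> \<le> (\<Sum>i\<in>{1..s}. 2 * ?c (n - i)) + 2 * ?c (n - s)"
      using False s by (intro add_mono sum_mono lower') auto
    also have "\<dots> = 2 * (?c (n - s) + (\<Sum>i\<in>{1..s}. ?c (n - i)))" by (simp add: sum_distrib_left)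
    finally have "2 ^ (n - 1) \<le> ?c (n - s) + (\<Sum>i\<in>{1..s}. ?c (n - i))" by (simp only: mult_le_cancel1 zero_less_numeral simp_thms)
    then show ?thesis using le by (rule order_trans)
  qed
qed

text \<open>Each summand is placed in a window of its own. Summands are nonempty, so
  \<open>fst G\<close> windows behind the first \<open>k\<close> are enough.\<close>

lemma sums_realize:
  assumes "G \<in> sums S"
    and S: "\<And>a B. 1 \<le> a \<Longrightarrow> a \<le> m \<Longrightarrow> B \<in> S \<Longrightarrow> occ e (W a) B"
    and S1: "\<And>B. B \<in> S \<Longrightarrow> 1 \<le> fst B"
    and W: "\<And>a b u v. 1 \<le> a \<Longrightarrow> a < b \<Longrightarrow> b \<le> m \<Longrightarrow> u \<in> W a \<Longrightarrow> v \<in> W b \<Longrightarrow> u < v \<and> \<not> e u v"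
    and "k + fst G \<le> m"
  shows "occ e (\<Union>a\<in>{k+1..m}. W a) G"
  using assms(1,5)
proof (induction arbitrary: k rule: sums.induct)
  case sums_empty
  show ?case unfolding occ_def by (intro exI[of _ id] conjI embI) (auto simp: pat_def)
next
  case (sums_plus B G)
  let ?s = "fst B"
  have s: "1 \<le> ?s" using S1 sums_plus.hyps by blast
  then have k: "k + 1 + fst G \<le> m" using sums_plus.prems by simp
  have "occ e (W (k + 1)) B" by (rule S) (use k sums_plus.hyps in auto)
  then obtain f where f: "emb ?s (W (k + 1)) f" "snd B = pat ?s e f"
    unfolding occ_def by blast
  have "k + 1 + 1 = k + 2" by simp
  from sums_plus.IH[OF k, unfolded this]
  obtain g where g: "emb (fst G) (\<Union>a\<in>{k+2..m}. W a) g" "snd G = pat (fst G) e g"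
    unfolding occ_def by blast
  let ?h = "\<lambda>i. if i \<le> ?s then f i else g (i - ?s)"
  have sep: "f i < g j \<and> \<not> e (f i) (g j)" if ij: "1 \<le> i" "i \<le> ?s" "1 \<le> j" "j \<le> fst G" for i j
  proof -
    obtain b where "b \<in> {k+2..m}" "g j \<in> W b" using emb_in[OF g(1), of j] ij by auto
    then show ?thesis using W[of "k + 1" b "f i" "g j"] emb_in[OF f(1), of i] ij by auto
  qed
  have "emb (?s + fst G) (\<Union>a\<in>{k+1..m}. W a) ?h"
  proof (rule embI)
    fix i j assume "1 \<le> i" "i < j" "j \<le> ?s + fst G"
    then show "?h i < ?h j"
      using sep[of i "j - ?s"] emb_less[OF f(1), of i j] emb_less[OF g(1), of "i - ?s" "j - ?s"] by auto
  next
    fix i assume i: "1 \<le> i" "i \<le> ?s + fst G"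
    show "?h i \<in> (\<Union>a\<in>{k+1..m}. W a)"
    proof (cases "i \<le> ?s")
      case True
      then show ?thesis using emb_in[OF f(1), of i] i k by auto
    next
      case False
      then have "g (i - ?s) \<in> (\<Union>a\<in>{k+2..m}. W a)" using emb_in[OF g(1), of "i - ?s"] i by auto
      then show ?thesis using False by auto
    qed
  qed
  moreover have "(i, j) \<in> snd (og_plus B G) \<longleftrightarrow> (i, j) \<in> pat (?s + fst G) e ?h" for i j
  proof -
    have mB: "(i, j) \<in> snd B \<longleftrightarrow> 1 \<le> i \<and> i < j \<and> j \<le> ?s \<and> e (f i) (f j)" for i j
      unfolding f(2) pat_def by simp
    have mG: "(i, j) \<in> snd G \<longleftrightarrow> 1 \<le> i \<and> i < j \<and> j \<le> fst G \<and> e (g i) (g j)" for i j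
      unfolding g(2) pat_def by simp
    have mh: "(i, j) \<in> pat (?s + fst G) e ?h \<longleftrightarrow> 1 \<le> i \<and> i < j \<and> j \<le> ?s + fst G \<and> e (?h i) (?h j)"
      unfolding pat_def by simp
    consider "j \<le> ?s" | "i \<le> ?s" "?s < j" | "?s < i" "?s < j" by linarith
    then show ?thesis
    proof cases
      case 1 then show ?thesis unfolding snd_plus_iff mB mG mh by auto
    next
      case 2 then show ?thesis using sep[of i "j - ?s"] unfolding snd_plus_iff mB mG mh by auto
    next
      case 3 then show ?thesis unfolding snd_plus_iff mB mG mh by auto
    qed
  qed
  ultimately show ?case unfolding occ_def by (intro exI[of _ ?h]) auto
qed

lemma card_sums_le_subs:
  assumes S: "\<And>a B. 1 \<le> a \<Longrightarrow> a \<le> n \<Longrightarrow> B \<in> S \<Longrightarrow> occ e (W a) B"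
    and S1: "\<And>B. B \<in> S \<Longrightarrow> 1 \<le> fst B"
    and W: "\<And>a b u v. 1 \<le> a \<Longrightarrow> a < b \<Longrightarrow> b \<le> n \<Longrightarrow> u \<in> W a \<Longrightarrow> v \<in> W b \<Longrightarrow> u < v \<and> \<not> e u v"
    and V: "\<And>a. 1 \<le> a \<Longrightarrow> a \<le> n \<Longrightarrow> W a \<subseteq> V"
  shows "card {G \<in> sums S. fst G = n} \<le> card (subs n V e)"
proof (rule card_subs_ge[of snd])
  show "inj_on snd {G \<in> sums S. fst G = n}" by (auto simp: inj_on_def)
  fix G assume "G \<in> {G \<in> sums S. fst G = n}"
  then have "occ e (\<Union>a\<in>{0+1..n}. W a) G" by (intro sums_realize[OF _ S S1 W]) auto
  moreover have "(\<Union>a\<in>{0+1..n}. W a) \<subseteq> V" using V by (intro UN_least) auto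
  ultimately show "snd G \<in> subs n V e"
    using \<open>G \<in> _\<close> by (auto simp: occ_def subs_def dest: emb_mono)
qed

text \<open>\<open>indec\<close> for a vertex set inside its host, without relabelling, so that
  vertices can be added one by one.\<close>

definition indset :: "(nat \<Rightarrow> nat \<Rightarrow> bool) \<Rightarrow> nat set \<Rightarrow> bool" where
  "indset e U \<longleftrightarrow> (\<forall>c. (\<exists>u\<in>U. u \<le> c) \<longrightarrow> (\<exists>v\<in>U. c < v) \<longrightarrow> (\<exists>u\<in>U. \<exists>v\<in>U. u \<le> c \<and> c < v \<and> e u v))"

text \<open>\<open>U'\<close> grows one vertex at a time: a gap inside \<open>U'\<close> can be filled by any vertex, and if there is
  none then \<open>U'\<close> is an initial segment of \<open>U\<close>, so an edge leaves it to the right. Keeping the minimum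
  is essential, as otherwise all crossing edges might jump over \<open>U'\<close>.\<close>
lemma indset_grow:
  assumes U: "finite U" "indset e U" and i: "1 \<le> i" "i \<le> card U"
  shows "\<exists>U'\<subseteq>U. card U' = i \<and> indset e U' \<and> Min U \<in> U'"
  using i
proof (induction i rule: nat_induct_at_least)
  case base
  then have "Min U \<in> U" using U(1) by (intro Min_in) auto
  then show ?case by (intro exI[of _ "{Min U}"]) (auto simp: indset_def)
next
  case (Suc i)
  then obtain U' where U': "U' \<subseteq> U" "card U' = i" "indset e U'" "Min U \<in> U'" by auto
  have finU': "finite U'" using U'(1) U(1) by (rule finite_subset)
  have ind: "\<exists>u\<in>U'. \<exists>v\<in>U'. u \<le> c \<and> c < v \<and> e u v" if "u \<in> U'" "u \<le> c" "v \<in> U'" "c < v" for c u v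
    using U'(3) that unfolding indset_def by blast
  have ext: ?case if v: "v \<in> U - U'" "indset e (insert v U')" for v
    using v U' finU' by (intro exI[of _ "insert v U'"]) auto
  show ?case
  proof (cases "\<exists>v\<in>U - U'. v < Max U'")
    case True
    then obtain v where v: "v \<in> U - U'" "v < Max U'" by blast
    have "Max U' \<in> U'" using finU' U'(4) by (intro Max_in) auto
    have "Min U \<le> v" using v U(1) by simp
    have "indset e (insert v U')"
      unfolding indset_def
    proof (intro allI impI)
      fix c assume lo: "\<exists>u\<in>insert v U'. u \<le> c" and hi: "\<exists>w\<in>insert v U'. c < w"
      obtain x where x: "x \<in> insert v U'" "x \<le> c" using lo by blast
      then have "x \<in> U" using v(1) U'(1) by blast
      then have c1: "Min U \<le> c" using Min_le[OF U(1), of x] x(2) by simp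
      obtain w where w: "w \<in> insert v U'" "c < w" using hi by blast
      then have "w \<le> Max U'" using v(2) Max_ge[OF finU', of w] by auto
      then have c2: "c < Max U'" using w(2) by simp
      from ind[OF U'(4) c1 \<open>Max U' \<in> U'\<close> c2]
      show "\<exists>u\<in>insert v U'. \<exists>w\<in>insert v U'. u \<le> c \<and> c < w \<and> e u w" by blast
    qed
    then show ?thesis by (rule ext[OF v(1)])
  next
    case False
    have Mx: "Max U' \<in> U'" using finU' U'(4) by (intro Max_in) auto
    have "U' \<noteq> U" using U'(2) Suc.prems by auto
    then obtain w where w: "w \<in> U - U'" using U'(1) by blast
    have gt: "Max U' < v" if "v \<in> U - U'" for v
      using False that Mx by (metis DiffD2 linorder_neqE_nat[of v "Max U'"])
    obtain u v where uv: "u \<in> U" "v \<in> U" "u \<le> Max U'" "Max U' < v" "e u v"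
    proof -
      have "\<exists>u\<in>U. u \<le> Max U'" "\<exists>v\<in>U. Max U' < v" using w gt[OF w] Mx U'(1) by blast+
      then show ?thesis using U(2) that unfolding indset_def by blast
    qed
    have "u \<in> U'" using gt[of u] uv(1,3) by (meson DiffI not_less)
    have "v \<notin> U'" using uv(4) Max_ge[OF finU', of v] by auto
    have "indset e (insert v U')"
      unfolding indset_def
    proof (intro allI impI)
      fix c assume lo: "\<exists>u\<in>insert v U'. u \<le> c" and hi: "\<exists>w\<in>insert v U'. c < w"
      have le: "x \<le> Max U'" if "x \<in> U'" for x using that finU' by simp
      show "\<exists>u\<in>insert v U'. \<exists>w\<in>insert v U'. u \<le> c \<and> c < w \<and> e u w"
      proof (cases "c < Max U'")
        case True
        then have "\<exists>u\<in>U'. u \<le> c" using lo uv(4) by auto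
        then show ?thesis using ind Mx True by blast
      next
        case False
        obtain w where w: "w \<in> insert v U'" "c < w" using hi by blast
        then have "w \<notin> U'" using le[of w] False by auto
        then have "c < v" using w by simp
        then show ?thesis using \<open>u \<in> U'\<close> uv False by (intro bexI[of _ u] bexI[of _ v]) auto
      qed
    qed
    then show ?thesis using uv(2) \<open>v \<notin> U'\<close> by (intro ext[of v]) auto
  qed
qed

lemma indec_pat_iff:
  assumes f: "emb n V f" and n: "1 \<le> n"
  shows "indec (n, pat n e f) \<longleftrightarrow> indset e (f ` {1..n})"
proof
  assume ind: "indec (n, pat n e f)"
  show "indset e (f ` {1..n})"
    unfolding indset_def
  proof (intro allI impI)
    fix c assume "\<exists>u\<in>f ` {1..n}. u \<le> c" "\<exists>v\<in>f ` {1..n}. c < v"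
    then obtain i0 j0 where ij0: "i0 \<in> {1..n}" "f i0 \<le> c" "j0 \<in> {1..n}" "c < f j0" by blast
    \<comment> \<open>The cut at vertex \<open>c\<close> corresponds to the cut of positions behind
      \<open>k\<close>, the last position whose image is at most \<open>c\<close>.\<close>
    define k where "k = Max {i \<in> {1..n}. f i \<le> c}"
    have "k \<in> {i \<in> {1..n}. f i \<le> c}" unfolding k_def using ij0 by (intro Max_in) auto
    then have k: "1 \<le> k" "k \<le> n" "f k \<le> c" by auto
    have above: "c < f i" if "k < i" "i \<le> n" for i
    proof (rule ccontr)
      assume "\<not> c < f i"
      then have "i \<le> k" unfolding k_def using that k by (intro Max_ge) auto
      then show False using that by simp
    qed
    have "k < n"
    proof (rule ccontr)
      assume "\<not> k < n"
      then have "k = n" using k by simp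
      then have "f j0 \<le> f k" using emb_less[OF f, of j0 n] ij0 by (cases "j0 = n") auto
      then show False using ij0 k by simp
    qed
    then obtain i j where ij: "(i, j) \<in> pat n e f" "i \<le> k" "k < j"
      using ind k unfolding indec_def by auto
    then have ij': "1 \<le> i" "j \<le> n" "e (f i) (f j)" by (auto simp: pat_def)
    have "f i \<le> f k" using emb_less[OF f, of i k] ij ij' k by (cases "i = k") auto
    then show "\<exists>u\<in>f ` {1..n}. \<exists>v\<in>f ` {1..n}. u \<le> c \<and> c < v \<and> e u v"
      using ij ij' k above[of j] by (intro bexI[of _ "f i"] bexI[of _ "f j"]) auto
  qed
next
  assume ind: "indset e (f ` {1..n})"
  have "\<exists>i j. (i, j) \<in> pat n e f \<and> i \<le> c \<and> c < j" if c: "1 \<le> c" "c < n" for c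
  proof -
    have "\<exists>u\<in>f ` {1..n}. u \<le> f c" using c by (intro bexI[of _ "f c"]) auto
    moreover have "\<exists>v\<in>f ` {1..n}. f c < v" using c emb_less[OF f, of c n] by (intro bexI[of _ "f n"]) auto
    ultimately obtain u v where "u \<in> f ` {1..n}" "v \<in> f ` {1..n}" "u \<le> f c" "f c < v" "e u v"
      using ind unfolding indset_def by blast
    then obtain i j where ij: "i \<in> {1..n}" "j \<in> {1..n}" "f i \<le> f c" "f c < f j" "e (f i) (f j)" by blast
    then have "i \<le> c" using emb_less_iff[OF f, of c i] c by (meson atLeastAtMost_iff less_imp_le not_less order.trans)
    moreover have "c < j" using emb_less_iff[OF f, of c j] c ij by auto
    ultimately show ?thesis using ij by (intro exI[of _ i] exI[of _ j]) (auto simp: pat_def)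
  qed
  then show "indec (n, pat n e f)" using n by (auto simp: indec_def)
qed

lemma occ_trans:
  assumes "occ e W A" and h: "emb i {1..fst A} h" and B: "B = (i, pat i (\<lambda>x y. (x, y) \<in> snd A) h)"
  shows "occ e W B"
proof -
  obtain f where f: "emb (fst A) W f" "snd A = pat (fst A) e f" using assms(1) by (auto simp: occ_def)
  have "(x, y) \<in> pat i (\<lambda>x y. (x, y) \<in> snd A) h \<longleftrightarrow> (x, y) \<in> pat i e (\<lambda>j. f (h j))" for x y
    using emb_in[OF h, of x] emb_in[OF h, of y] emb_less[OF h, of x y] unfolding f(2) by (auto simp: pat_def)
  then have "snd B = pat i e (\<lambda>j. f (h j))" unfolding B by auto
  then show ?thesis unfolding occ_def using emb_comp[OF h f(1)] B by auto
qed

text \<open>\<open>indset_grow\<close> is applied to \<open>A\<close> as its own host. The graphs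
  \<open>G i\<close> therefore depend on \<open>A\<close> only, and the same family is found in
  every window in which \<open>A\<close> occurs.\<close>

lemma indec_chain:
  assumes A: "ord_graph A" "indec A"
  obtains G where "G (fst A) = A"
    "\<And>i. 1 \<le> i \<Longrightarrow> i \<le> fst A \<Longrightarrow> ord_graph (G i) \<and> indec (G i) \<and> fst (G i) = i"
    "\<And>i e W. 1 \<le> i \<Longrightarrow> i \<le> fst A \<Longrightarrow> occ e W A \<Longrightarrow> occ e W (G i)"
proof -
  define eA where "eA x y \<longleftrightarrow> (x, y) \<in> snd A" for x y
  let ?s = "fst A"
  have s: "1 \<le> ?s" using A by (simp add: indec_def)
  have id: "emb ?s {1..?s} id" by (rule embI) auto
  have "snd A = pat ?s eA id" using A(1) by (auto simp: pat_def eA_def ord_graph_def)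
  then have "A = (?s, pat ?s eA id)" by (simp add: prod_eq_iff)
  then have "indset eA {1..?s}" using indec_pat_iff[OF id s, of eA] A(2) by simp
  then have ind: "indset eA {1..?s}" .
  have "\<exists>h. emb i {1..?s} h \<and> indset eA (h ` {1..i})" if "1 \<le> i" "i \<le> ?s" for i
  proof -
    have "i \<le> card {1..?s}" using that by simp
    from indset_grow[OF _ ind that(1) this] obtain U where U: "U \<subseteq> {1..?s}" "card U = i" "indset eA U"
      by auto
    obtain h where "emb (card U) U h" "h ` {1..card U} = U"
      using emb_enum[OF finite_subset[OF U(1) finite_atLeastAtMost]] .
    then show ?thesis using U emb_mono[of i U h "{1..?s}"] by (intro exI[of _ h]) simp
  qed
  then have "\<forall>i. \<exists>h. 1 \<le> i \<longrightarrow> i \<le> ?s \<longrightarrow> emb i {1..?s} h \<and> indset eA (h ` {1..i})" by blast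
  from choice[OF this] obtain h where
    h: "\<And>i. 1 \<le> i \<Longrightarrow> i \<le> ?s \<Longrightarrow> emb i {1..?s} (h i) \<and> indset eA (h i ` {1..i})" by blast
  define G where "G i = (if i = ?s then A else (i, pat i eA (h i)))" for i
  show ?thesis
  proof (rule that)
    show "G ?s = A" by (simp add: G_def)
    fix i assume i: "1 \<le> i" "i \<le> ?s"
    have "ord_graph (i, pat i eA (h i))" by (auto simp: ord_graph_def pat_def)
    moreover have "indec (i, pat i eA (h i))" using indec_pat_iff[of i _ "h i" eA] h[OF i] i by blast
    ultimately show "ord_graph (G i) \<and> indec (G i) \<and> fst (G i) = i" using A by (auto simp: G_def)
    fix e W assume o: "occ e W A"
    have "occ e W (i, pat i eA (h i))"
      by (rule occ_trans[OF o, of _ "h i"]) (use h[OF i] in \<open>auto simp: eA_def pat_def\<close>)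
    then show "occ e W (G i)" using o by (auto simp: G_def)
  qed
qed

text \<open>The summands are the graphs of the chain below \<open>A\<close>. If \<open>A\<close> has
  order \<open>l + 1\<close>, they cover all parts that \<open>F\<close> allows; if not,
  \<open>B\<close> serves as a second graph of the top order.\<close>

lemma many_occ_ge_F:
  assumes A: "ord_graph A" "indec A" and B: "ord_graph B" "indec B" "fst A = fst B"
    and l: "fst A = l + 1 \<or> A \<noteq> B" and n: "1 \<le> n"
    and o: "\<And>a. 1 \<le> a \<Longrightarrow> a \<le> n \<Longrightarrow> W a \<subseteq> V \<and> occ e (W a) A \<and> occ e (W a) B"
    and W: "\<And>a b u v. 1 \<le> a \<Longrightarrow> a < b \<Longrightarrow> b \<le> n \<Longrightarrow> u \<in> W a \<Longrightarrow> v \<in> W b \<Longrightarrow> u < v \<and> \<not> e u v"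
  shows "F n (l + 1) \<le> card (subs n V e)"
proof -
  obtain G where G: "G (fst A) = A"
    "\<And>i. 1 \<le> i \<Longrightarrow> i \<le> fst A \<Longrightarrow> ord_graph (G i) \<and> indec (G i) \<and> fst (G i) = i"
    "\<And>i e W. 1 \<le> i \<Longrightarrow> i \<le> fst A \<Longrightarrow> occ e W A \<Longrightarrow> occ e W (G i)"
    using indec_chain[OF A] by blast
  have s: "1 \<le> fst A" using A by (simp add: indec_def)
  from l show ?thesis
  proof
    assume l: "fst A = l + 1"
    have "F n (l + 1) \<le> card {H \<in> sums (G ` {1..l + 1}). fst H = n}"
      by (rule card_sums_ge_F) (use G(2) l in auto)
    also have "\<dots> \<le> card (subs n V e)"
    proof (rule card_sums_le_subs)
      show "occ e (W a) H" if "1 \<le> a" "a \<le> n" "H \<in> G ` {1..l + 1}" for a H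
        using G(3) o[OF that(1,2)] that(3) l by auto
      show "1 \<le> fst H" if "H \<in> G ` {1..l + 1}" for H using that G(2) l by auto
    qed (use W o in auto)
    finally show ?thesis .
  next
    assume "A \<noteq> B"
    have "F n (l + 1) \<le> 2 ^ (n - 1)" using n by (intro F_le) simp
    also have "\<dots> \<le> card {H \<in> sums (insert B (G ` {1..fst A})). fst H = n}"
      by (rule card_sums_ge_pow2) (use G B s n \<open>A \<noteq> B\<close> in auto)
    also have "\<dots> \<le> card (subs n V e)"
    proof (rule card_sums_le_subs)
      show "occ e (W a) H" if "1 \<le> a" "a \<le> n" "H \<in> insert B (G ` {1..fst A})" for a H
        using G(3) o[OF that(1,2)] that(3) by auto
      show "1 \<le> fst H" if "H \<in> insert B (G ` {1..fst A})" for H using that G(2) s B(3) by auto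
    qed (use W o in auto)
    finally show ?thesis .
  qed
qed

text \<open>Both reasons for badness are expressed with two graphs, \<open>A = B\<close> being
  allowed at order \<open>l + 1\<close>, so that one argument serves both. Orders are bounded to
  leave finitely many types for Ramsey's theorem.\<close>

definition bad :: "nat \<Rightarrow> (nat \<Rightarrow> nat \<Rightarrow> bool) \<Rightarrow> nat set \<Rightarrow> bool" where
  "bad l e W \<longleftrightarrow> (\<exists>A B. indec A \<and> indec B \<and> fst A = fst B \<and> fst A \<le> l + 1 \<and> (fst A = l + 1 \<or> A \<noteq> B) \<and>
     occ e W A \<and> occ e W B)"

text \<open>Makes the embedding total with values in \<open>W\<close>: \<open>ramsey_blocks\<close>
  wants a vertex for every index, also for those beyond the order of \<open>A\<close>.\<close>

lemma occ_total:
  assumes "occ e W A" "1 \<le> fst A"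
  obtains f where "\<And>i. f i \<in> W" "emb (fst A) W f" "snd A = pat (fst A) e f"
proof -
  obtain f where f: "emb (fst A) W f" "snd A = pat (fst A) e f" using assms(1) by (auto simp: occ_def)
  let ?f = "\<lambda>i. if 1 \<le> i \<and> i \<le> fst A then f i else f 1"
  show ?thesis
  proof (rule that)
    show "?f i \<in> W" for i using emb_in[OF f(1)] assms(2) by auto
    show "emb (fst A) W ?f" by (rule embI) (use emb_less[OF f(1)] emb_in[OF f(1)] in auto)
    show "snd A = pat (fst A) e ?f" unfolding f(2) by (auto simp: pat_def)
  qed
qed

definition bad_wit where
  "bad_wit l e W A B f g \<longleftrightarrow> indec A \<and> indec B \<and> fst A = fst B \<and> fst A \<le> l + 1 \<and> (fst A = l + 1 \<or> A \<noteq> B) \<and>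
    (\<forall>i. f i \<in> W) \<and> (\<forall>i. g i \<in> W) \<and> emb (fst A) W f \<and> emb (fst B) W g \<and>
    snd A = pat (fst A) e f \<and> snd B = pat (fst B) e g"

lemma bad_imp_wit:
  assumes "bad l e W"
  shows "\<exists>A B f g. bad_wit l e W A B f g"
proof -
  obtain A B where AB: "indec A" "indec B" "fst A = fst B" "fst A \<le> l + 1" "fst A = l + 1 \<or> A \<noteq> B"
    "occ e W A" "occ e W B" using assms unfolding bad_def by blast
  have A1: "1 \<le> fst A" and B1: "1 \<le> fst B" using AB by (auto simp: indec_def)
  obtain f where f: "\<And>i. f i \<in> W" "emb (fst A) W f" "snd A = pat (fst A) e f"
    by (rule occ_total[OF AB(6) A1]) blast
  obtain g where g: "\<And>i. g i \<in> W" "emb (fst B) W g" "snd B = pat (fst B) e g"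
    by (rule occ_total[OF AB(7) B1]) blast
  have "bad_wit l e W A B f g" unfolding bad_wit_def by (intro conjI allI AB(1-5) f g)
  then show ?thesis by blast
qed

text \<open>From each interval only the vertices of four witnesses are kept: two graphs found in
  \<open>e\<close> and two in the complement. After the Ramsey step all intervals show the same four
  graphs, and all pairs between them have one colour \<open>ga\<close>. If these are non-edges, the
  first two graphs yield sums in \<open>e\<close>; otherwise the last two yield sums in the
  complement.\<close>

lemma many_bad_ge_F:
  assumes n: "1 \<le> n"
  shows "\<exists>R::nat. \<forall>V e W. (\<forall>a<R. W a \<subseteq> V \<and> bad l e (W a) \<and> bad l (\<lambda>u v. \<not> e u v) (W a)) \<longrightarrow>
    (\<forall>a b. a < b \<longrightarrow> b < R \<longrightarrow> (\<forall>u\<in>W a. \<forall>v\<in>W b. u < v)) \<longrightarrow> F n (l + 1) \<le> card (subs n V e)"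
proof -
  let ?Q = "{..<4::nat} \<times> {1..l+1}"
  let ?T = "{G. ord_graph G \<and> fst G \<le> l + 1}"
  have "finite ?Q" "finite (?T \<times> ?T \<times> ?T \<times> ?T)" by (simp_all add: finite_ord_graphs)
  from ramsey_blocks[OF n this, of n] obtain R where R:
    "\<forall>V e d t. (\<forall>a<R. \<forall>i\<in>?Q. d a i \<in> V) \<longrightarrow> (\<forall>a<R. t a \<in> ?T \<times> ?T \<times> ?T \<times> ?T) \<longrightarrow>
    (\<forall>a b. a < b \<longrightarrow> b < R \<longrightarrow> (\<forall>i\<in>?Q. \<forall>j\<in>?Q. d a i < d b j)) \<longrightarrow> card (subs n V e) < 2 ^ (n - 1) \<longrightarrow>
    (\<exists>h ga ty. emb n {..<R} h \<and> (\<forall>a. 1 \<le> a \<longrightarrow> a \<le> n \<longrightarrow> t (h a) = ty) \<and>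
      (\<forall>a b. 1 \<le> a \<longrightarrow> a < b \<longrightarrow> b \<le> n \<longrightarrow> (\<forall>i\<in>?Q. \<forall>j\<in>?Q. e (d (h a) i) (d (h b) j) = ga)))"
    by (elim exE) (rule that)
  show ?thesis
  proof (rule exI[of _ R], intro allI impI, rule ccontr)
    fix V e W
    assume b: "\<forall>a<R. W a \<subseteq> V \<and> bad l e (W a) \<and> bad l (\<lambda>u v. \<not> e u v) (W a)"
      and ord: "\<forall>a b. a < b \<longrightarrow> b < R \<longrightarrow> (\<forall>u\<in>W a. \<forall>v\<in>W b. u < v)"
      and "\<not> F n (l + 1) \<le> card (subs n V e)"
    then have few: "card (subs n V e) < F n (l + 1)" by simp
    have few2: "card (subs n V e) < 2 ^ (n - 1)"
      by (rule less_le_trans[OF few F_le]) (use n in simp)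
    have "\<forall>a. a < R \<longrightarrow> (\<exists>A B f g. bad_wit l e (W a) A B f g)" using bad_imp_wit b by blast
    then obtain A B f g where w1': "\<And>a. a < R \<Longrightarrow> bad_wit l e (W a) (A a) (B a) (f a) (g a)" by metis
    have "\<forall>a. a < R \<longrightarrow> (\<exists>A B f g. bad_wit l (\<lambda>u v. \<not> e u v) (W a) A B f g)" using bad_imp_wit b by blast
    then obtain A' B' f' g' where
      w2': "\<And>a. a < R \<Longrightarrow> bad_wit l (\<lambda>u v. \<not> e u v) (W a) (A' a) (B' a) (f' a) (g' a)" by metis
    note w1 = w1'[unfolded bad_wit_def] and w2 = w2'[unfolded bad_wit_def]
    define t where "t a = (A a, B a, A' a, B' a)" for a
    define d where "d a p = (if fst p = 0 then f a (snd p) else if fst p = 1 then g a (snd p)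
      else if fst p = 2 then f' a (snd p) else g' a (snd p))" for a and p :: "nat \<times> nat"
    have og: "ord_graph H" if "snd H = pat (fst H) e f" for H e f
      using that by (auto simp: ord_graph_def pat_def)
    have dW: "d a p \<in> W a" if "a < R" for a p
    proof -
      have "f a i \<in> W a \<and> g a i \<in> W a \<and> f' a i \<in> W a \<and> g' a i \<in> W a" for i
        using w1[OF that] w2[OF that] by blast
      then show ?thesis by (simp add: d_def)
    qed
    have D1: "\<forall>a<R. \<forall>i\<in>?Q. d a i \<in> V"
    proof (intro allI impI ballI)
      fix a i assume "a < R"
      then have "d a i \<in> W a" "W a \<subseteq> V" using dW b by auto
      then show "d a i \<in> V" by (rule rev_subsetD)
    qed
    have D2: "\<forall>a<R. t a \<in> ?T \<times> ?T \<times> ?T \<times> ?T"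
    proof (intro allI impI)
      fix a assume a: "a < R"
      have "A a \<in> ?T" "B a \<in> ?T" using w1[OF a] og[of "A a"] og[of "B a"] by simp_all
      moreover have "A' a \<in> ?T" "B' a \<in> ?T" using w2[OF a] og[of "A' a"] og[of "B' a"] by simp_all
      ultimately show "t a \<in> ?T \<times> ?T \<times> ?T \<times> ?T" unfolding t_def by (intro SigmaI)
    qed
    have D3: "\<forall>a b. a < b \<longrightarrow> b < R \<longrightarrow> (\<forall>i\<in>?Q. \<forall>j\<in>?Q. d a i < d b j)"
    proof (intro allI impI ballI)
      fix a b i j assume ab: "a < b" "b < R"
      have "d a i \<in> W a" "d b j \<in> W b" by (rule dW, use ab in simp)+
      then show "d a i < d b j" using ord ab by blast
    qed
    from R[THEN spec, of V, THEN spec, of e, THEN spec, of d, THEN spec, of t, THEN mp, THEN mp, THEN mp, THEN mp, OF D1 D2 D3 few2]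
    obtain h ga ty where h: "emb n {..<R} h" and ty0: "\<forall>a. 1 \<le> a \<longrightarrow> a \<le> n \<longrightarrow> t (h a) = ty"
      and ga0: "\<forall>a b. 1 \<le> a \<longrightarrow> a < b \<longrightarrow> b \<le> n \<longrightarrow> (\<forall>i\<in>?Q. \<forall>j\<in>?Q. e (d (h a) i) (d (h b) j) = ga)"
      by (elim exE conjE) (rule that; assumption)
    have ty: "t (h a) = ty" if "1 \<le> a" "a \<le> n" for a using ty0 that by simp
    have ga: "e (d (h a) i) (d (h b) j) = ga" if "1 \<le> a" "a < b" "b \<le> n" "i \<in> ?Q" "j \<in> ?Q" for a b i j
      by (rule ga0[THEN spec, THEN spec, THEN mp, THEN mp, THEN mp, THEN bspec, THEN bspec, OF that])
    have hR: "h a < R" if "1 \<le> a" "a \<le> n" for a using emb_in[OF h that] by simp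
    obtain A0 B0 A0' B0' where "ty = (A0, B0, A0', B0')" by (cases ty)
    then have ty': "A (h a) = A0" "B (h a) = B0" "A' (h a) = A0'" "B' (h a) = B0'" if "1 \<le> a" "a \<le> n" for a
      using ty[OF that] by (simp_all add: t_def)
    \<comment> \<open>Only the vertices listed in \<open>d\<close> are known to be joined uniformly,
      so they replace the intervals as windows.\<close>
    let ?W = "\<lambda>a. d (h a) ` ?Q"
    have WV: "?W a \<subseteq> V" if "1 \<le> a" "a \<le> n" for a
      by (intro image_subsetI) (rule D1[THEN spec, THEN mp, THEN bspec, OF hR[OF that]])
    have Wlt: "u < v" if "1 \<le> a" "a < b" "b \<le> n" "u \<in> ?W a" "v \<in> ?W b" for a b u v
    proof -
      have "u \<in> W (h a)" "v \<in> W (h b)" using that dW hR[of a] hR[of b] by auto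
      moreover have "h a < h b" "h b < R" using emb_less[OF h that(1-3)] hR[of b] that by auto
      ultimately show ?thesis using ord by blast
    qed
    have Wga: "e u v = ga" if "1 \<le> a" "a < b" "b \<le> n" "u \<in> ?W a" "v \<in> ?W b" for a b u v
      using ga[OF that(1-3)] that(4,5) by blast
    have occW: "occ e'' (?W a) H"
      if "emb (fst H) (W (h a)) fa" "snd H = pat (fst H) e'' fa" "fst H \<le> l + 1" "q < 4" "\<And>i. fa i = d (h a) (q, i)"
      for a H fa q and e'' :: "nat \<Rightarrow> nat \<Rightarrow> bool"
    proof -
      have "emb (fst H) (?W a) fa"
      proof (rule embI)
        fix i assume "1 \<le> i" "i \<le> fst H"
        then show "fa i \<in> ?W a" using that(3-5) by (intro image_eqI[of _ _ "(q, i)"]) auto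
      qed (use emb_less[OF that(1)] in auto)
      then show ?thesis using that(2) by (auto simp: occ_def)
    qed
    have one: "1 \<le> (1::nat)" by simp
    have "F n (l + 1) \<le> card (subs n V e)"
    proof (cases ga)
      case False
      have P: "indec A0" "indec B0" "fst A0 = fst B0" "fst A0 \<le> l + 1" "fst A0 = l + 1 \<or> A0 \<noteq> B0"
        "emb (fst A0) (W (h a)) (f (h a))" "emb (fst B0) (W (h a)) (g (h a))"
        "snd A0 = pat (fst A0) (e) (f (h a))" "snd B0 = pat (fst B0) (e) (g (h a))"
        if "1 \<le> a" "a \<le> n" for a
        using w1[OF hR[OF that]] unfolding ty'[OF that] by blast+
      have o: "?W a \<subseteq> V \<and> occ (e) (?W a) A0 \<and> occ (e) (?W a) B0" if a: "1 \<le> a" "a \<le> n" for a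
      proof (intro conjI WV[OF a])
        show "occ (e) (?W a) A0"
          by (rule occW[of _ _ "f (h a)" _ 0]) (use P[OF a] in \<open>simp_all add: d_def\<close>)
        show "occ (e) (?W a) B0"
          by (rule occW[of _ _ "g (h a)" _ 1]) (use P[OF a] in \<open>simp_all add: d_def\<close>)
      qed
      have sep: "u < v \<and> \<not> (e) u v" if "1 \<le> a" "a < b" "b \<le> n" "u \<in> ?W a" "v \<in> ?W b" for a b u v
        using Wlt[OF that] Wga[OF that] False by simp
      have og': "ord_graph A0" "ord_graph B0" using P[OF one n] og[of A0] og[of B0] by blast+
      show ?thesis
        by (rule many_occ_ge_F[OF og'(1) P(1)[OF one n] og'(2) P(2,3,5)[OF one n] n o sep])
    next
      case True
      have P: "indec A0'" "indec B0'" "fst A0' = fst B0'" "fst A0' \<le> l + 1" "fst A0' = l + 1 \<or> A0' \<noteq> B0'"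
        "emb (fst A0') (W (h a)) (f' (h a))" "emb (fst B0') (W (h a)) (g' (h a))"
        "snd A0' = pat (fst A0') (\<lambda>u v. \<not> e u v) (f' (h a))" "snd B0' = pat (fst B0') (\<lambda>u v. \<not> e u v) (g' (h a))"
        if "1 \<le> a" "a \<le> n" for a
        using w2[OF hR[OF that]] unfolding ty'[OF that] by blast+
      have o: "?W a \<subseteq> V \<and> occ (\<lambda>u v. \<not> e u v) (?W a) A0' \<and> occ (\<lambda>u v. \<not> e u v) (?W a) B0'" if a: "1 \<le> a" "a \<le> n" for a
      proof (intro conjI WV[OF a])
        show "occ (\<lambda>u v. \<not> e u v) (?W a) A0'"
          by (rule occW[of _ _ "f' (h a)" _ 2]) (use P[OF a] in \<open>simp_all add: d_def\<close>)
        show "occ (\<lambda>u v. \<not> e u v) (?W a) B0'"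
          by (rule occW[of _ _ "g' (h a)" _ 3]) (use P[OF a] in \<open>simp_all add: d_def\<close>)
      qed
      have sep: "u < v \<and> \<not> (\<lambda>u v. \<not> e u v) u v" if "1 \<le> a" "a < b" "b \<le> n" "u \<in> ?W a" "v \<in> ?W b" for a b u v
        using Wlt[OF that] Wga[OF that] True by simp
      have og': "ord_graph A0'" "ord_graph B0'" using P[OF one n] og[of A0'] og[of B0'] by blast+
      have "F n (l + 1) \<le> card (subs n V (\<lambda>u v. \<not> e u v))"
        by (rule many_occ_ge_F[OF og'(1) P(1)[OF one n] og'(2) P(2,3,5)[OF one n] n o sep])
      then show ?thesis by (simp add: card_subs_compl)
    qed
    then show False using few by simp
  qed
qed

section \<open>Indecomposable graphs with a unique pattern in each size\<close>

text \<open>If no edge jumps over a vertex, the graph is a monotone path. Otherwise every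
  indecomposable triple has an edge as its outer pair and the same inner pairs, described by
  \<open>p\<close> and \<open>q\<close>. If both hold the graph is complete; if exactly one holds it
  is a star centred at an end. If neither holds, the edges form a matching, and uniqueness in order
  4 leaves the single edge from \<open>1\<close> to \<open>m\<close> and two matchings on four
  vertices.\<close>

lemma classify_small_indec:
  fixes E :: "nat \<Rightarrow> nat \<Rightarrow> bool"
  assumes rng: "\<And>i j. E i j \<Longrightarrow> 1 \<le> i \<and> i < j \<and> j \<le> m"
    and cut: "\<And>c. 1 \<le> c \<Longrightarrow> c < m \<Longrightarrow> \<exists>i j. E i j \<and> i \<le> c \<and> c < j"
    and m: "3 \<le> m"
    and U3: "\<And>a b c a' b' c'. 1 \<le> a \<Longrightarrow> a < b \<Longrightarrow> b < c \<Longrightarrow> c \<le> m \<Longrightarrow> 1 \<le> a' \<Longrightarrow> a' < b' \<Longrightarrow> b' < c' \<Longrightarrow> c' \<le> m \<Longrightarrow>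
      E a c \<or> E a b \<and> E b c \<Longrightarrow> E a' c' \<or> E a' b' \<and> E b' c' \<Longrightarrow>
      E a b = E a' b' \<and> E a c = E a' c' \<and> E b c = E b' c'"
    and U4: "\<And>a b c d a' b' c' d'. 1 \<le> a \<Longrightarrow> a < b \<Longrightarrow> b < c \<Longrightarrow> c < d \<Longrightarrow> d \<le> m \<Longrightarrow>
      1 \<le> a' \<Longrightarrow> a' < b' \<Longrightarrow> b' < c' \<Longrightarrow> c' < d' \<Longrightarrow> d' \<le> m \<Longrightarrow>
      E a d \<or> E a c \<and> E b d \<Longrightarrow> E a' d' \<or> E a' c' \<and> E b' d' \<Longrightarrow>
      E a d = E a' d' \<and> E b c = E b' c'"
  shows "(\<forall>i j. E i j \<longleftrightarrow> 1 \<le> i \<and> i < j \<and> j \<le> m) \<or>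
    (\<forall>i j. E i j \<longleftrightarrow> i = 1 \<and> j = m) \<or>
    (\<forall>i j. E i j \<longleftrightarrow> i = 1 \<and> 2 \<le> j \<and> j \<le> m) \<or>
    (\<forall>i j. E i j \<longleftrightarrow> j = m \<and> 1 \<le> i \<and> i < m) \<or>
    (\<forall>i j. E i j \<longleftrightarrow> 1 \<le> i \<and> j = i + 1 \<and> j \<le> m) \<or>
    (m = 4 \<and> (\<forall>i j. E i j \<longleftrightarrow> i = 1 \<and> j = 3 \<or> i = 2 \<and> j = 4)) \<or>
    (m = 4 \<and> (\<forall>i j. E i j \<longleftrightarrow> i = 1 \<and> j = 4 \<or> i = 2 \<and> j = 3))"
proof (cases "\<exists>i j. E i j \<and> j \<noteq> i + 1")
  case False
  have "E i (i + 1)" if "1 \<le> i" "i < m" for i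
  proof -
    obtain a b where ab: "E a b" "a \<le> i" "i < b" using cut \<open>1 \<le> i\<close> \<open>i < m\<close> by blast
    then have "b = a + 1" using False by blast
    then have "a = i" using ab by simp
    then show ?thesis using ab(1) unfolding \<open>b = a + 1\<close> by simp
  qed
  then have "E i j \<longleftrightarrow> 1 \<le> i \<and> j = i + 1 \<and> j \<le> m" for i j
    using False rng[of i j] by auto
  then show ?thesis by blast
next
  case True
  then obtain a0 c0 where a0c0: "E a0 c0" "c0 \<noteq> a0 + 1" by blast
  then have r0: "1 \<le> a0" "a0 < a0 + 1" "a0 + 1 < c0" "c0 \<le> m" using rng[of a0 c0] by auto
  \<comment> \<open>\<open>a0\<close>, \<open>a0 + 1\<close>, \<open>c0\<close> is an indecomposable
    triple; by uniqueness it stands for all of them.\<close>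
  define p where "p = E a0 (a0 + 1)"
  define q where "q = E (a0 + 1) c0"
  have tri: "E a b = p \<and> E a c \<and> E b c = q"
    if "1 \<le> a" "a < b" "b < c" "c \<le> m" "E a c \<or> E a b \<and> E b c" for a b c
    using U3[OF that(1-4) r0 that(5)] a0c0(1) unfolding p_def q_def by simp
  have span: "E a b = p \<and> E b c = q" if "E a c" "a < b" "b < c" for a b c
    using tri[of a b c] rng[OF that(1)] that by simp
  have path: "E a c \<and> p \<and> q" if "E a b" "E b c" for a b c
    using tri[of a b c] rng[OF that(1)] rng[OF that(2)] that by simp
  define c where "c = Max {j. E 1 j}"
  have fin: "finite {j. E 1 j}" by (rule finite_subset[of _ "{..m}"]) (use rng in auto)
  have "\<exists>j. E 1 j"
  proof -
    obtain i j where "E i j" "i \<le> 1" "1 < j" using cut[of 1] m by auto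
    then have "i = 1" using rng[of i j] by simp
    then show ?thesis using \<open>E i j\<close> by blast
  qed
  then have "c \<in> {j. E 1 j}" unfolding c_def using fin by (intro Max_in) auto
  then have c: "E 1 c" by simp
  have cmax: "j \<le> c" if "E 1 j" for j unfolding c_def using fin that by (intro Max_ge) auto
  have c1: "1 < c" "c \<le> m" using rng[OF c] by auto
  have cross: "\<exists>d f. E d f \<and> 1 < d \<and> d \<le> c \<and> c < f" if cm: "c < m"
  proof -
    obtain d f where df: "E d f" "d \<le> c" "c < f" using cut[of c] cm c1 by auto
    have "d \<noteq> 1" using df cmax by force
    then show ?thesis using df rng[OF df(1)] by (intro exI[of _ d] exI[of _ f]) auto
  qed
  consider "p" | "\<not> p" "q" | "\<not> p" "\<not> q" by blast
  then show ?thesis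
  proof cases
    case 1
    \<comment> \<open>An edge over the cut behind \<open>c\<close> would start at a neighbour of
      \<open>1\<close>, and \<open>path\<close> would then give \<open>1\<close> a neighbour beyond
      \<open>c\<close>.\<close>
    have "c = m"
    proof (rule ccontr)
      assume "c \<noteq> m"
      then obtain d f where df: "E d f" "1 < d" "d \<le> c" "c < f" using cross c1 by auto
      have "E 1 d" using span[OF c, of d] df c 1 by (cases "d = c") auto
      then have "E 1 f" using path df by blast
      then show False using cmax df by force
    qed
    have E1: "E 1 j" if "1 < j" "j \<le> m" for j
      using span[OF c, of j] c \<open>c = m\<close> that 1 by (cases "j = m") auto
    show ?thesis
    proof (cases q)
      case True
      have "E i j" if "1 \<le> i" "i < j" "j \<le> m" for i j
      proof (cases "i = 1")
        case False
        then show ?thesis using span[OF E1[of j], of i] that True by simp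
      qed (use E1 that in simp)
      then have "\<forall>i j. E i j \<longleftrightarrow> 1 \<le> i \<and> i < j \<and> j \<le> m" using rng by blast
      then show ?thesis by blast
    next
      case False
      have "i = 1" if "E i j" for i j
      proof (rule ccontr)
        assume "i \<noteq> 1"
        then have "E 1 i" using E1 rng[OF that] by simp
        then show False using path that False by blast
      qed
      then have "\<forall>i j. E i j \<longleftrightarrow> i = 1 \<and> 2 \<le> j \<and> j \<le> m" using E1 rng by force
      then show ?thesis by blast
    qed
  next
    case 2
    have nopath: "\<not> (E a b \<and> E b d)" for a b d using path 2 by blast
    define b where "b = Min {i. E i m}"
    have finb: "finite {i. E i m}" by (rule finite_subset[of _ "{..m}"]) (use rng in force)+
    have "\<exists>i. E i m"
    proof -
      have "1 \<le> m - 1" "m - 1 < m" using m by auto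
      from cut[OF this] obtain i j where "E i j" "m - 1 < j" by blast
      then have "j = m" using rng[of i j] by fastforce
      then show ?thesis using \<open>E i j\<close> by blast
    qed
    then have "b \<in> {i. E i m}" unfolding b_def using finb by (intro Min_in) auto
    then have b: "E b m" by simp
    have bmin: "b \<le> i" if "E i m" for i unfolding b_def using finb that by (intro Min_le) auto
    \<comment> \<open>Mirrored argument with the first neighbour \<open>b\<close> of
      \<open>m\<close>. An edge over the cut before \<open>b\<close> ends at a neighbour of
      \<open>m\<close>, against \<open>nopath\<close>.\<close>
    have "b = 1"
    proof (rule ccontr)
      assume "b \<noteq> 1"
      then have "1 \<le> b - 1" "b - 1 < m" using rng[OF b] by auto
      then obtain d f where df: "E d f" "d \<le> b - 1" "b - 1 < f" using cut by blast
      have "f \<noteq> m"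
      proof
        assume "f = m"
        then have "b \<le> d" using bmin df by blast
        then show False using df \<open>1 \<le> b - 1\<close> by linarith
      qed
      then have "b \<le> f" "f < m" using df rng[OF df(1)] by auto
      then have "E f m" using span[OF b, of f] b 2 by (cases "f = b") auto
      then show False using nopath df by blast
    qed
    have Em: "E i m" if "1 \<le> i" "i < m" for i
      using span[OF b, of i] b \<open>b = 1\<close> that 2 by (cases "i = 1") auto
    have "j = m" if "E i j" for i j
    proof (rule ccontr)
      assume "j \<noteq> m"
      then have "E j m" using Em[of j] rng[OF that] by simp
      then show False using nopath that by blast
    qed
    then have "\<forall>i j. E i j \<longleftrightarrow> j = m \<and> 1 \<le> i \<and> i < m" using Em rng by blast
    then show ?thesis by blast
  next
    case 3
    have nopath: "\<not> (E a b \<and> E b d)" for a b d using path 3 by blast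
    have right_unique: "b = b'" if "E a b" "E a b'" for a b b'
      using span[OF that(1), of b'] span[OF that(2), of b] that 3 rng[OF that(1)] rng[OF that(2)]
      by (cases b b' rule: linorder_cases) auto
    have left_unique: "a = a'" if "E a b" "E a' b" for a a' b
      using span[OF that(1), of a'] span[OF that(2), of a] that 3 rng[OF that(1)] rng[OF that(2)]
      by (cases a a' rule: linorder_cases) auto
    show ?thesis
    proof (cases "c = m")
      case True
      then have E1m: "E 1 m" using c by simp
      show ?thesis
      proof (cases "\<exists>d f. E d f \<and> (d, f) \<noteq> (1, m)")
        case False
        then have "\<forall>i j. E i j \<longleftrightarrow> i = 1 \<and> j = m" using E1m by blast
        then show ?thesis by blast
      next
        case True
        then obtain d f where df: "E d f" "(d, f) \<noteq> (1, m)" by blast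
        have "d \<noteq> 1" "f \<noteq> m" using df right_unique[OF E1m] left_unique[OF E1m] by blast+
        then have r: "1 < d" "d < f" "f < m" using rng[OF df(1)] by auto
        \<comment> \<open>With an edge nested inside the pair \<open>1\<close>, \<open>m\<close>,
          uniqueness in order 4 makes every two inner vertices adjacent. In a matching there can be
          only two of them.\<close>
        have only: "x = d \<or> x = f" if x: "1 < x" "x < m" for x
        proof (rule ccontr)
          assume ne: "\<not> ?thesis"
          show False
          proof (cases "x < d")
            case True
            have "E x d" using U4[of 1 d f m 1 x d m] E1m df(1) r True x by simp
            then show False using nopath df(1) by blast
          next
            case False
            then have "d < x" using ne by simp
            then have "E d x" using U4[of 1 d f m 1 d x m] E1m df(1) r x by simp
            then show False using right_unique[OF df(1)] ne by blast
          qed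
        qed
        have d2: "d = 2" using only[of 2] only[of "d - 1"] r by (cases "d = 2") auto
        have f3: "f = 3" using only[of 3] r d2 by (cases "f = 3") auto
        have m4: "m = 4" using only[of 4] r d2 f3 by (cases "m = 4") auto
        have "E i j \<longleftrightarrow> i = 1 \<and> j = 4 \<or> i = 2 \<and> j = 3" for i j
        proof
          assume ij: "E i j"
          then have "i \<in> {1, 2, 3}" using rng[OF ij] m4 by auto
          moreover have "i \<noteq> 3" using nopath[of 2 3 j] df(1) d2 f3 ij by blast
          ultimately show "i = 1 \<and> j = 4 \<or> i = 2 \<and> j = 3"
            using right_unique[OF E1m] right_unique[OF df(1)] d2 f3 m4 ij by auto
        qed (use E1m df(1) d2 f3 m4 in auto)
        then show ?thesis using m4 by blast
      qed
    next
      case False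
      then obtain d f where df: "E d f" "1 < d" "d \<le> c" "c < f" using cross c1 by auto
      have "d \<noteq> c" using nopath[of 1 c f] c df by blast
      then have r: "1 < d" "d < c" "c < f" "f \<le> m" using df rng[OF df(1)] by auto
      have n1f: "\<not> E 1 f" using cmax[of f] df by auto
      \<comment> \<open>The crossing edges from \<open>1\<close> to \<open>c\<close> and from
        \<open>d\<close> to \<open>f\<close> give an indecomposable 4-set whose outer pair is no
        edge, so no edge at all jumps over two vertices. This squeezes \<open>d\<close>,
        \<open>c\<close>, \<open>f\<close> to \<open>2\<close>, \<open>3\<close>,
        \<open>4\<close>.\<close>
      have no4: "\<not> E x w" if "1 \<le> x" "x < y" "y < z" "z < w" "w \<le> m" for x y z w
        using U4[of 1 d c f x y z w] r c df(1) n1f that by auto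
      have d2: "d = 2" using no4[of 1 2 d c] r c by (cases "d = 2") auto
      have c3: "c = 3" using no4[of 1 d 3 c] r c d2 by (cases "c = 3") auto
      have f4: "f = 4" using no4[of d c 4 f] r df(1) d2 c3 by (cases "f = 4") auto
      have E13: "E 1 3" and E24: "E 2 4" using c df d2 c3 f4 by auto
      have only: "i = 1 \<and> j = 3 \<or> i = 2 \<and> j = 4" if "E i j" "i \<le> 4" for i j
      proof -
        have "i \<in> {1, 2, 3, 4}" using rng[OF that(1)] that(2) by auto
        moreover have "i \<noteq> 3" using nopath[of 1 3 j] E13 that by blast
        moreover have "i \<noteq> 4" using nopath[of 2 4 j] E24 that by blast
        ultimately show ?thesis using right_unique[OF E13] right_unique[OF E24] that by auto
      qed
      have m4: "m = 4"
      proof (rule ccontr)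
        assume "m \<noteq> 4"
        then obtain i j where ij: "E i j" "i \<le> 4" "4 < j" using cut[of 4] r f4 by auto
        then show False using only by force
      qed
      have "\<forall>i j. E i j \<longleftrightarrow> i = 1 \<and> j = 3 \<or> i = 2 \<and> j = 4"
      proof (intro allI iffI)
        fix i j assume ij: "E i j"
        then show "i = 1 \<and> j = 3 \<or> i = 2 \<and> j = 4" using only[OF ij] rng[OF ij] m4 by simp
      qed (use E13 E24 in auto)
      then show ?thesis using m4 by blast
    qed
  qed
qed

section \<open>Indecomposable graphs in an interval that is not bad\<close>

lemma not_bad_unique:
  assumes "\<not> bad l e W" "indec A" "indec B" "occ e W A" "occ e W B" "fst A = fst B" "fst A \<le> l"
  shows "A = B"
proof (rule ccontr)
  assume "A \<noteq> B"
  then have "bad l e W"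
    unfolding bad_def by (intro exI[of _ A] exI[of _ B] conjI assms) (use assms in simp_all)
  then show False using assms by blast
qed

text \<open>A larger indecomposable graph has one of order \<open>l + 1\<close> in its chain, and
  that one alone makes \<open>W\<close> bad.\<close>

lemma not_bad_size:
  assumes nb: "\<not> bad l e W" and A: "indec A" "occ e W A"
  shows "fst A \<le> l"
proof (rule ccontr)
  assume "\<not> ?thesis"
  then have l: "1 \<le> l + 1" "l + 1 \<le> fst A" by auto
  obtain G where "\<And>i. 1 \<le> i \<Longrightarrow> i \<le> fst A \<Longrightarrow> ord_graph (G i) \<and> indec (G i) \<and> fst (G i) = i"
    "\<And>i e W. 1 \<le> i \<Longrightarrow> i \<le> fst A \<Longrightarrow> occ e W A \<Longrightarrow> occ e W (G i)"
    by (rule indec_chain[OF occ_ord_graph[OF A(2)] A(1)]) blast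
  then have G: "indec (G (l + 1))" "fst (G (l + 1)) = l + 1" "occ e W (G (l + 1))"
    using l A(2) by simp_all
  have "bad l e W"
    unfolding bad_def by (intro exI[of _ "G (l + 1)"] conjI G) (use G in simp_all)
  then show False using nb by blast
qed

lemma adj_iff: "ord_graph A \<Longrightarrow> adj A i j \<longleftrightarrow> (i, j) \<in> snd A \<or> (j, i) \<in> snd A"
  unfolding adj_def by (cases i j rule: linorder_cases) (auto dest: ord_graphD)

lemma occ_imp_ind_sub:
  assumes B: "ord_graph B" and o: "occ (\<lambda>x y. (x, y) \<in> snd B) {1..fst B} A"
  shows "ind_sub A B"
proof -
  obtain f where f: "emb (fst A) {1..fst B} f" "snd A = pat (fst A) (\<lambda>x y. (x, y) \<in> snd B) f"
    using o by (auto simp: occ_def)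
  have "adj A i j \<longleftrightarrow> adj B (f i) (f j)" if "i \<in> {1..fst A}" "j \<in> {1..fst A}" for i j
  proof -
    have "(i, j) \<in> snd A \<longleftrightarrow> (f i, f j) \<in> snd B" if "i \<in> {1..fst A}" "j \<in> {1..fst A}" for i j
      using that ord_graphD[OF B, of "f i" "f j"] emb_less_iff[OF f(1), of i j]
      unfolding f(2) pat_def by auto
    then show ?thesis using that unfolding adj_iff[OF B] adj_iff[OF occ_ord_graph[OF o]] by simp
  qed
  then show ?thesis
    unfolding ind_sub_def using f(1) by (intro exI[of _ f]) (simp add: emb_def)
qed

lemma occ_self: "ord_graph B \<Longrightarrow> occ (\<lambda>x y. (x, y) \<in> snd B) {1..fst B} B"
  unfolding occ_def
  by (intro exI[of _ id] conjI embI) (auto simp: pat_def dest: ord_graphD)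

text \<open>The chain below \<open>B\<close> contains an indecomposable graph of the same order as
  \<open>A\<close>, which by uniqueness is \<open>A\<close>.\<close>

lemma not_bad_comparable:
  assumes nb: "\<not> bad l e W" and A: "indec A" "occ e W A" and B: "indec B" "occ e W B" and le: "fst A \<le> fst B"
  shows "ind_sub A B"
proof -
  have s: "1 \<le> fst A" using A(1) by (simp add: indec_def)
  have ogB: "ord_graph B" using occ_ord_graph[OF B(2)] .
  obtain G where G: "\<And>i. 1 \<le> i \<Longrightarrow> i \<le> fst B \<Longrightarrow> ord_graph (G i) \<and> indec (G i) \<and> fst (G i) = i"
    "\<And>i e W. 1 \<le> i \<Longrightarrow> i \<le> fst B \<Longrightarrow> occ e W B \<Longrightarrow> occ e W (G i)"
    by (rule indec_chain[OF ogB B(1)]) blast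
  have "A = G (fst A)"
    using G(1)[OF s le] G(2)[OF s le B(2)]
    by (intro not_bad_unique[OF nb A(1) _ A(2)]) (auto intro: not_bad_size[OF nb A])
  moreover have "ind_sub (G (fst A)) B"
    by (rule occ_imp_ind_sub[OF ogB G(2)[OF s le occ_self[OF ogB]]])
  ultimately show ?thesis by simp
qed

text \<open>Induced subgraphs of \<open>A\<close> occur in \<open>W\<close> as well and have order
  at most \<open>l\<close>, so the triples and 4-sets of \<open>A\<close> inherit uniqueness from
  \<open>not_bad_unique\<close>, as \<open>classify_small_indec\<close> requires.\<close>

lemma not_bad_in_Jset:
  assumes nb: "\<not> bad l e W" and A: "indec A" "occ e W A"
  shows "A \<in> Jset l"
proof -
  define m where "m = fst A"
  define E where "E i j \<longleftrightarrow> (i, j) \<in> snd A" for i j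
  have og: "ord_graph A" using occ_ord_graph[OF A(2)] .
  have ml: "m \<le> l" using not_bad_size[OF nb A] by (simp add: m_def)
  have m1: "1 \<le> m" using A(1) by (simp add: m_def indec_def)
  have rng: "1 \<le> i \<and> i < j \<and> j \<le> m" if "E i j" for i j
    using ord_graphD[OF og] that by (simp add: E_def m_def)
  have cut: "\<exists>i j. E i j \<and> i \<le> c \<and> c < j" if "1 \<le> c" "c < m" for c
    using A(1) that unfolding indec_def E_def m_def by blast
  have J: "A \<in> Jset l" if "A = J1 m \<or> A = J2 m \<or> A = J3 m \<or> A = J4 m \<or> A = Lg m \<or> m = 4 \<and> (A = Q1 \<or> A = Q2)"
    using that ml m1 unfolding Jset_def by auto
  have Aeq: "A = (m, {(i, j). E i j})" by (auto simp: m_def E_def prod_eq_iff)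
  have same: "pat k E h = pat k E h'"
    if k: "1 \<le> k" "k \<le> m" and h: "emb k {1..m} h" "emb k {1..m} h'"
      and i: "indec (k, pat k E h)" "indec (k, pat k E h')" for k h h'
  proof -
    have "occ e W (k, pat k E g)" if "emb k {1..m} g" for g
      by (rule occ_trans[OF A(2)]) (use that in \<open>auto simp: m_def E_def pat_def\<close>)
    then have "(k, pat k E h) = (k, pat k E h')"
      by (intro not_bad_unique[OF nb i]) (use k ml h in auto)
    then show ?thesis by simp
  qed
  consider "m = 1" | "m = 2" | "3 \<le> m" using m1 by linarith
  then show ?thesis
  proof cases
    case 1
    then have "\<not> E i j" for i j using rng[of i j] by auto
    then have "A = J1 m" unfolding Aeq J1_def using 1 by auto
    then show ?thesis using J by blast
  next
    case 2
    obtain i j where "E i j" using cut[of 1] 2 by auto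
    then have "E 1 2" using rng[of i j] 2 by (cases "i = 1 \<and> j = 2") auto
    then have "E i j \<longleftrightarrow> 1 \<le> i \<and> i < j \<and> j \<le> m" for i j
      using rng[of i j] 2 by (cases "i = 1 \<and> j = 2") auto
    then have "A = J1 m" unfolding Aeq J1_def by auto
    then show ?thesis using J by blast
  next
    case 3
    define t3 where "t3 a b c i = (if i = 1 then a else if i = 2 then b else c)" for a b c i :: nat
    define t4 where "t4 a b c d i = (if i = 1 then a else if i = 2 then b else if i = 3 then c else d)"
      for a b c d i :: nat
    have e3: "emb 3 {1..m} (t3 a b c)" if "1 \<le> a" "a < b" "b < c" "c \<le> m" for a b c
      using that by (intro embI) (auto simp: t3_def)
    have e4: "emb 4 {1..m} (t4 a b c d)" if "1 \<le> a" "a < b" "b < c" "c < d" "d \<le> m" for a b c d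
      using that by (intro embI) (auto simp: t4_def)
    have p3: "(1, 2) \<in> pat 3 E (t3 a b c) \<longleftrightarrow> E a b" "(1, 3) \<in> pat 3 E (t3 a b c) \<longleftrightarrow> E a c"
      "(2, 3) \<in> pat 3 E (t3 a b c) \<longleftrightarrow> E b c" for a b c by (auto simp: pat_def t3_def)
    have p4: "(1, 3) \<in> pat 4 E (t4 a b c d) \<longleftrightarrow> E a c" "(1, 4) \<in> pat 4 E (t4 a b c d) \<longleftrightarrow> E a d"
      "(2, 3) \<in> pat 4 E (t4 a b c d) \<longleftrightarrow> E b c" "(2, 4) \<in> pat 4 E (t4 a b c d) \<longleftrightarrow> E b d" for a b c d
      by (auto simp: pat_def t4_def)
    have i3: "indec (3, pat 3 E (t3 a b c))" if "E a c \<or> E a b \<and> E b c" for a b c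
    proof -
      have "\<exists>i j. (i, j) \<in> pat 3 E (t3 a b c) \<and> i \<le> k \<and> k < j" if k: "1 \<le> k" "k < 3" for k
      proof (cases "E a c")
        case True
        then show ?thesis using p3(2)[of a b c] k by (intro exI[of _ 1] exI[of _ 3]) auto
      next
        case False
        then have "E a b" "E b c" using \<open>E a c \<or> E a b \<and> E b c\<close> by auto
        then have e: "(1, 2) \<in> pat 3 E (t3 a b c)" "(2, 3) \<in> pat 3 E (t3 a b c)"
          using p3(1,3)[of a b c] by blast+
        show ?thesis
        proof (cases "k = 1")
          case True
          then show ?thesis using e(1) by (intro exI[of _ 1] exI[of _ 2]) simp
        next
          case False
          then show ?thesis using e(2) k by (intro exI[of _ 2] exI[of _ 3]) simp
        qed
      qed
      then show ?thesis by (auto simp: indec_def)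
    qed
    have i4: "indec (4, pat 4 E (t4 a b c d))" if "E a d \<or> E a c \<and> E b d" for a b c d
    proof -
      have "\<exists>i j. (i, j) \<in> pat 4 E (t4 a b c d) \<and> i \<le> k \<and> k < j" if k: "1 \<le> k" "k < 4" for k
      proof (cases "E a d")
        case True
        then show ?thesis using p4(2)[of a b c d] k by (intro exI[of _ 1] exI[of _ 4]) auto
      next
        case False
        then have "E a c" "E b d" using \<open>E a d \<or> E a c \<and> E b d\<close> by auto
        then show ?thesis
          using p4(1,4)[of a b c d] k
          by (intro exI[of _ "if k < 3 then 1 else 2"] exI[of _ "if k < 3 then 3 else 4"]) auto
      qed
      then show ?thesis by (auto simp: indec_def)
    qed
    have U3: "E a b = E a' b' \<and> E a c = E a' c' \<and> E b c = E b' c'"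
      if "1 \<le> a" "a < b" "b < c" "c \<le> m" "1 \<le> a'" "a' < b'" "b' < c'" "c' \<le> m"
        "E a c \<or> E a b \<and> E b c" "E a' c' \<or> E a' b' \<and> E b' c'" for a b c a' b' c'
    proof -
      have "pat 3 E (t3 a b c) = pat 3 E (t3 a' b' c')"
        by (rule same[OF _ 3 e3[OF that(1-4)] e3[OF that(5-8)] i3[OF that(9)] i3[OF that(10)]]) simp
      then show ?thesis using p3[of a b c] p3[of a' b' c'] by simp
    qed
    have U4: "E a d = E a' d' \<and> E b c = E b' c'"
      if "1 \<le> a" "a < b" "b < c" "c < d" "d \<le> m" "1 \<le> a'" "a' < b'" "b' < c'" "c' < d'" "d' \<le> m"
        "E a d \<or> E a c \<and> E b d" "E a' d' \<or> E a' c' \<and> E b' d'" for a b c d a' b' c' d'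
    proof -
      have "4 \<le> m" using that by linarith
      then have "pat 4 E (t4 a b c d) = pat 4 E (t4 a' b' c' d')"
        by (intro same[OF _ _ e4[OF that(1-5)] e4[OF that(6-10)] i4[OF that(11)] i4[OF that(12)]]) simp_all
      then show ?thesis using p4[of a b c d] p4[of a' b' c' d'] by simp
    qed
    have "(\<forall>i j. E i j \<longleftrightarrow> 1 \<le> i \<and> i < j \<and> j \<le> m) \<or>
    (\<forall>i j. E i j \<longleftrightarrow> i = 1 \<and> j = m) \<or>
    (\<forall>i j. E i j \<longleftrightarrow> i = 1 \<and> 2 \<le> j \<and> j \<le> m) \<or>
    (\<forall>i j. E i j \<longleftrightarrow> j = m \<and> 1 \<le> i \<and> i < m) \<or>
    (\<forall>i j. E i j \<longleftrightarrow> 1 \<le> i \<and> j = i + 1 \<and> j \<le> m) \<or>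
    (m = 4 \<and> (\<forall>i j. E i j \<longleftrightarrow> i = 1 \<and> j = 3 \<or> i = 2 \<and> j = 4)) \<or>
    (m = 4 \<and> (\<forall>i j. E i j \<longleftrightarrow> i = 1 \<and> j = 4 \<or> i = 2 \<and> j = 3))"
      by (rule classify_small_indec; (erule rng | rule 3 | rule cut; assumption | rule U3; assumption | rule U4; assumption))
    then show ?thesis
    proof (elim disjE)
      assume "\<forall>i j. E i j \<longleftrightarrow> 1 \<le> i \<and> i < j \<and> j \<le> m"
      then have "A = J1 m" unfolding Aeq J1_def by auto
      then show ?thesis using J by blast
    next
      assume "\<forall>i j. E i j \<longleftrightarrow> i = 1 \<and> j = m"
      then have "A = J2 m" unfolding Aeq J2_def using 3 by auto
      then show ?thesis using J by blast
    next
      assume "\<forall>i j. E i j \<longleftrightarrow> i = 1 \<and> 2 \<le> j \<and> j \<le> m"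
      then have "A = J3 m" unfolding Aeq J3_def by auto
      then show ?thesis using J by blast
    next
      assume "\<forall>i j. E i j \<longleftrightarrow> j = m \<and> 1 \<le> i \<and> i < m"
      then have "A = J4 m" unfolding Aeq J4_def by auto
      then show ?thesis using J by blast
    next
      assume "\<forall>i j. E i j \<longleftrightarrow> 1 \<le> i \<and> j = i + 1 \<and> j \<le> m"
      then have "A = Lg m" unfolding Aeq Lg_def by auto
      then show ?thesis using J by blast
    next
      assume "m = 4 \<and> (\<forall>i j. E i j \<longleftrightarrow> i = 1 \<and> j = 3 \<or> i = 2 \<and> j = 4)"
      then have "m = 4 \<and> A = Q1" unfolding Aeq Q1_def by auto
      then show ?thesis using J by blast
    next
      assume "m = 4 \<and> (\<forall>i j. E i j \<longleftrightarrow> i = 1 \<and> j = 4 \<or> i = 2 \<and> j = 3)"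
      then have "m = 4 \<and> A = Q2" unfolding Aeq Q2_def by auto
      then show ?thesis using J by blast
    qed
  qed
qed

section \<open>Bounding the number of homogeneous blocks\<close>

text \<open>A change at \<open>i\<close> gives two rows \<open>i\<close> and \<open>i + 1\<close>
  separated by some column. Neighbouring changes may share a row, so every other one is dropped;
  this is the factor in \<open>2 * T\<close>.\<close>

lemma card_row_changes_bounded:
  assumes n: "1 \<le> n"
  shows "\<exists>T. \<forall>e N c. c \<le> N \<longrightarrow> card (subs n {1..N} e) < 2 ^ (n - 1) \<longrightarrow>
    card {i. 1 \<le> i \<and> i < c \<and> (\<exists>y. c < y \<and> y \<le> N \<and> e i y \<noteq> e (i + 1) y)} \<le> T"
proof -
  obtain T :: nat where T: "\<forall>V e x x' y.
    (\<forall>j<T. x j \<in> V \<and> x' j \<in> V \<and> y j \<in> V \<and> e (x j) (y j) \<noteq> e (x' j) (y j)) \<longrightarrow>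
    (\<forall>j k. j < k \<longrightarrow> k < T \<longrightarrow> x j < x k \<and> x j < x' k \<and> x' j < x k \<and> x' j < x' k) \<longrightarrow>
    (\<forall>j<T. \<forall>k<T. x j < y k \<and> x' j < y k) \<longrightarrow> 2 ^ (n - 1) \<le> card (subs n V e)"
    using rows_differ_bound[OF n] by (elim exE) (rule that)
  show ?thesis
  proof (rule exI[of _ "2 * T"], intro allI impI, rule ccontr)
    fix e :: "nat \<Rightarrow> nat \<Rightarrow> bool" and N c :: nat
    define S where "S = {i. 1 \<le> i \<and> i < c \<and> (\<exists>y. c < y \<and> y \<le> N \<and> e i y \<noteq> e (i + 1) y)}"
    assume cN: "c \<le> N" and few: "card (subs n {1..N} e) < 2 ^ (n - 1)"
      and "\<not> card S \<le> 2 * T"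
    then have S: "2 * T < card S" by simp
    have fin: "finite S" by (rule finite_subset[of _ "{..c}"]) (auto simp: S_def)
    obtain s where s: "emb (card S) S s" "s ` {1..card S} = S" by (rule emb_enum[OF fin])
    have sS: "s (2 * j + 1) \<in> S" if "j < T" for j using emb_in[OF s(1)] S that by simp
    have "\<forall>j. \<exists>y. j < T \<longrightarrow> c < y \<and> y \<le> N \<and> e (s (2 * j + 1)) y \<noteq> e (s (2 * j + 1) + 1) y"
      using sS unfolding S_def by blast
    from choice[OF this] obtain y where
      y: "\<And>j. j < T \<Longrightarrow> c < y j \<and> y j \<le> N \<and> e (s (2 * j + 1)) (y j) \<noteq> e (s (2 * j + 1) + 1) (y j)" by blast
    have s1: "1 \<le> s (2 * j + 1) \<and> s (2 * j + 1) < c" if "j < T" for j using sS[OF that] by (simp add: S_def)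
    have gap: "s (2 * j + 1) + 1 < s (2 * k + 1)" if "j < k" "k < T" for j k
    proof -
      have "s (2 * j + 1) < s (2 * j + 2)" "s (2 * j + 2) < s (2 * k + 1)"
        using S that by (auto intro!: emb_less[OF s(1)])
      then show ?thesis by simp
    qed
    have "2 ^ (n - 1) \<le> card (subs n {1..N} e)"
    proof (rule T[THEN spec, of "{1..N}", THEN spec, of e, THEN spec, of "\<lambda>j. s (2 * j + 1)",
          THEN spec, of "\<lambda>j. s (2 * j + 1) + 1", THEN spec, of y, THEN mp, THEN mp, THEN mp])
      show "\<forall>j<T. s (2 * j + 1) \<in> {1..N} \<and> s (2 * j + 1) + 1 \<in> {1..N} \<and> y j \<in> {1..N} \<and>
          e (s (2 * j + 1)) (y j) \<noteq> e (s (2 * j + 1) + 1) (y j)"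
        using s1 y cN by fastforce
      show "\<forall>j k. j < k \<longrightarrow> k < T \<longrightarrow> s (2 * j + 1) < s (2 * k + 1) \<and> s (2 * j + 1) < s (2 * k + 1) + 1 \<and>
          s (2 * j + 1) + 1 < s (2 * k + 1) \<and> s (2 * j + 1) + 1 < s (2 * k + 1) + 1"
        using gap by fastforce
      show "\<forall>j<T. \<forall>k<T. s (2 * j + 1) < y k \<and> s (2 * j + 1) + 1 < y k"
        using s1 y by fastforce
    qed
    then show False using few by simp
  qed
qed

text \<open>These are row changes of the reflected graph, in which the cut \<open>c\<close> becomes
  \<open>N - c\<close>.\<close>

lemma card_col_changes_bounded:
  assumes n: "1 \<le> n"
  shows "\<exists>T. \<forall>e N c. c \<le> N \<longrightarrow> card (subs n {1..N} e) < 2 ^ (n - 1) \<longrightarrow>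
    card {i. c < i \<and> i < N \<and> (\<exists>y. 1 \<le> y \<and> y \<le> c \<and> e y i \<noteq> e y (i + 1))} \<le> T"
proof -
  obtain T where T: "\<forall>e N c. c \<le> N \<longrightarrow> card (subs n {1..N} e) < 2 ^ (n - 1) \<longrightarrow>
    card {i. 1 \<le> i \<and> i < c \<and> (\<exists>y. c < y \<and> y \<le> N \<and> e i y \<noteq> e (i + 1) y)} \<le> T"
    using card_row_changes_bounded[OF n] by (elim exE) (rule that)
  show ?thesis
  proof (rule exI[of _ T], intro allI impI)
    fix e :: "nat \<Rightarrow> nat \<Rightarrow> bool" and N c :: nat
    assume cN: "c \<le> N" and few: "card (subs n {1..N} e) < 2 ^ (n - 1)"
    define e' where "e' i j = e (N + 1 - j) (N + 1 - i)" for i j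
    have img: "(\<lambda>i. N + 1 - i) ` {1..N} = {1..N}"
    proof -
      have "v \<in> (\<lambda>i. N + 1 - i) ` {1..N}" if "v \<in> {1..N}" for v
        using that by (intro image_eqI[of _ _ "N + 1 - v"]) auto
      then show ?thesis by auto
    qed
    have "card (subs n {1..N} e') \<le> card (subs n {1..N} e)"
      using card_subs_rev[of "{1..N}" "N + 1" n e] unfolding img e'_def[symmetric] by auto
    then have few': "card (subs n {1..N} e') < 2 ^ (n - 1)" using few by simp
    define S where "S = {i. c < i \<and> i < N \<and> (\<exists>y. 1 \<le> y \<and> y \<le> c \<and> e y i \<noteq> e y (i + 1))}"
    define S' where "S' = {i. 1 \<le> i \<and> i < N - c \<and> (\<exists>y. N - c < y \<and> y \<le> N \<and> e' i y \<noteq> e' (i + 1) y)}"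
    have "(\<lambda>i. N - i) ` S \<subseteq> S'"
    proof (rule image_subsetI)
      fix i assume "i \<in> S"
      then obtain y where i: "c < i" "i < N" and y: "1 \<le> y" "y \<le> c" "e y i \<noteq> e y (i + 1)" by (auto simp: S_def)
      have "e' (N - i) (N + 1 - y) \<noteq> e' (N - i + 1) (N + 1 - y)"
        using i y cN by (auto simp: e'_def Suc_diff_le)
      then show "N - i \<in> S'"
        using i y cN unfolding S'_def by (intro CollectI conjI exI[of _ "N + 1 - y"]) auto
    qed
    moreover have "finite S'" by (rule finite_subset[of _ "{..N}"]) (auto simp: S'_def)
    moreover have "inj_on (\<lambda>i. N - i) S" by (rule inj_onI) (auto simp: S_def)
    ultimately have "card S \<le> card S'" by (metis card_inj_on_le)
    also have "\<dots> \<le> T" unfolding S'_def using T few' by simp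
    finally show "card {i. c < i \<and> i < N \<and> (\<exists>y. 1 \<le> y \<and> y \<le> c \<and> e y i \<noteq> e y (i + 1))} \<le> T"
      by (simp add: S_def)
  qed
qed

section \<open>Twins and homogeneous blocks\<close>

lemma adj_commute: "adj G x y \<longleftrightarrow> adj G y x"
  by (auto simp: adj_def min.commute max.commute)

lemma twins_sym: "twins G x y \<Longrightarrow> twins G y x"
  by (auto simp: twins_def)

lemma twins_refl: "twins G x x"
  by (simp add: twins_def)

text \<open>\<open>twins\<close> ignores the two vertices themselves, so the critical vertex is
  \<open>y\<close>: its adjacencies to \<open>x\<close> and to \<open>z\<close> are both compared
  with that of \<open>x\<close> and \<open>z\<close>.\<close>

lemma twins_trans:
  assumes r: "x \<in> {1..fst G}" "y \<in> {1..fst G}" "z \<in> {1..fst G}" and xy: "twins G x y" and yz: "twins G y z"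
  shows "twins G x z"
proof (cases "x = y \<or> y = z \<or> x = z")
  case True then show ?thesis using xy yz by (auto simp: twins_def)
next
  case False
  have irr: "\<not> adj G w w" for w by (simp add: adj_def)
  have A: "adj G x w \<longleftrightarrow> adj G y w" if "w \<in> {1..fst G}" "w \<noteq> x" "w \<noteq> y" for w
    using xy that unfolding twins_def nbhd_def by blast
  have B: "adj G y w \<longleftrightarrow> adj G z w" if "w \<in> {1..fst G}" "w \<noteq> y" "w \<noteq> z" for w
    using yz that unfolding twins_def nbhd_def by blast
  have "adj G x w \<longleftrightarrow> adj G z w" if "w \<in> {1..fst G}" "w \<noteq> x" "w \<noteq> z" for w
  proof (cases "w = y")
    case True
    have "adj G x y \<longleftrightarrow> adj G z x" using B[OF r(1)] False by (simp add: adj_commute)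
    also have "\<dots> \<longleftrightarrow> adj G z y" using A[OF r(3)] False by (simp add: adj_commute)
    finally show ?thesis using True by simp
  next
    case False
    then show ?thesis using A B that by blast
  qed
  then show ?thesis unfolding twins_def nbhd_def using irr by blast
qed

lemma homog_setD:
  assumes "homog_set G B"
  shows "B \<noteq> {}" "B \<subseteq> {1..fst G}" "x \<in> B \<Longrightarrow> z \<in> B \<Longrightarrow> x \<le> y \<Longrightarrow> y \<le> z \<Longrightarrow> y \<in> B"
    "x \<in> B \<Longrightarrow> y \<in> B \<Longrightarrow> twins G x y"
  using assms unfolding homog_set_def by blast+

lemma homog_set_finite: "homog_set G B \<Longrightarrow> finite B"
  by (rule finite_subset[OF homog_setD(2)]) simp_all

text \<open>A block is determined by its last vertex, since two blocks with a common vertex have a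
  homogeneous union. Unless the graph ends there, this vertex is no twin of its successor, which
  could otherwise be added.\<close>

lemma num_blocks_le:
  "num_blocks G \<le> card {i. 1 \<le> i \<and> i < fst G \<and> \<not> twins G i (i + 1)} + 1"
proof -
  let ?D = "{i. 1 \<le> i \<and> i < fst G \<and> \<not> twins G i (i + 1)}"
  have finD: "finite ?D" by (rule finite_subset[of _ "{..fst G}"]) auto
  have blockD: "homog_set G B" "\<And>B'. homog_set G B' \<Longrightarrow> B \<subseteq> B' \<Longrightarrow> B' = B" if "homog_block G B" for B
    using that unfolding homog_block_def by blast+
  have MaxB: "Max B \<in> B" "Max B \<in> {1..fst G}" "\<And>x. x \<in> B \<Longrightarrow> x \<le> Max B" if "homog_set G B" for B
  proof -
    show m: "Max B \<in> B" using homog_setD(1)[OF that] homog_set_finite[OF that] by simp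
    then show "Max B \<in> {1..fst G}" using homog_setD(2)[OF that] by blast
    show "x \<le> Max B" if "x \<in> B" for x using that homog_set_finite[OF \<open>homog_set G B\<close>] by simp
  qed
  have "Max B \<in> insert (fst G) ?D" if B: "homog_block G B" for B
  proof (rule ccontr)
    let ?b = "Max B"
    note H = blockD(1)[OF B]
    assume "?b \<notin> insert (fst G) ?D"
    then have b: "?b < fst G" "twins G ?b (?b + 1)" using MaxB(2)[OF H] by auto
    have tw: "twins G x (?b + 1)" if "x \<in> B" for x
      using twins_trans[of x G ?b "?b + 1"] homog_setD(2)[OF H] homog_setD(4)[OF H that MaxB(1)[OF H]]
        MaxB(2)[OF H] b that by auto
    have "homog_set G (insert (?b + 1) B)"
      unfolding homog_set_def
    proof (intro conjI ballI allI impI)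
      show "insert (?b + 1) B \<subseteq> {1..fst G}" using homog_setD(2)[OF H] b by auto
      fix x z y assume x: "x \<in> insert (?b + 1) B" and z: "z \<in> insert (?b + 1) B" and y: "x \<le> y \<and> y \<le> z"
      show "y \<in> insert (?b + 1) B"
      proof (cases "y \<le> ?b")
        case True
        then have "x \<in> B" using x y by auto
        then show ?thesis using homog_setD(3)[OF H _ MaxB(1)[OF H], of x y] y True by blast
      next
        case False
        have "z \<le> ?b + 1" using z MaxB(3)[OF H, of z] by auto
        then show ?thesis using y False by simp
      qed
    next
      fix x y assume "x \<in> insert (?b + 1) B" "y \<in> insert (?b + 1) B"
      then show "twins G x y" by (metis insertE tw homog_setD(4)[OF H] twins_sym twins_refl)
    qed auto
    from blockD(2)[OF B this] have "?b + 1 \<in> B" by blast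
    then show False using MaxB(3)[OF H] by fastforce
  qed
  then have "Max ` {B. homog_block G B} \<subseteq> insert (fst G) ?D" by blast
  moreover have "inj_on Max {B. homog_block G B}"
  proof (rule inj_onI)
    fix B B' assume BB: "B \<in> {B. homog_block G B}" "B' \<in> {B. homog_block G B}" and eq: "Max B = Max B'"
    then have B: "homog_block G B" and B': "homog_block G B'" by simp_all
    note H = blockD(1)[OF B] and H' = blockD(1)[OF B']
    let ?b = "Max B"
    have bB: "?b \<in> B" "?b \<in> B'" using MaxB(1)[OF H] MaxB(1)[OF H'] eq by auto
    have le: "x \<le> ?b" if "x \<in> B \<union> B'" for x using MaxB(3)[OF H, of x] MaxB(3)[OF H', of x] eq that by auto
    have tw: "twins G x ?b" if "x \<in> B \<union> B'" for x
      using homog_setD(4)[OF H _ bB(1), of x] homog_setD(4)[OF H' _ bB(2), of x] that by blast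
    have sub: "B \<union> B' \<subseteq> {1..fst G}" using homog_setD(2)[OF H] homog_setD(2)[OF H'] by blast
    have "homog_set G (B \<union> B')"
      unfolding homog_set_def
    proof (intro conjI ballI allI impI sub)
      show "B \<union> B' \<noteq> {}" using bB by blast
      fix x z y assume "x \<in> B \<union> B'" "z \<in> B \<union> B'" "x \<le> y \<and> y \<le> z"
      then show "y \<in> B \<union> B'"
        using homog_setD(3)[OF H _ bB(1), of x y] homog_setD(3)[OF H' _ bB(2), of x y] le[of z] by auto
    next
      fix x y assume xy: "x \<in> B \<union> B'" "y \<in> B \<union> B'"
      have "x \<in> {1..fst G}" "y \<in> {1..fst G}" "?b \<in> {1..fst G}" using sub xy bB by blast+
      then show "twins G x y" using twins_trans[of x G ?b y] tw[OF xy(1)] twins_sym[OF tw[OF xy(2)]] by blast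
    qed
    then have "B \<union> B' = B" "B \<union> B' = B'" using blockD(2)[OF B] blockD(2)[OF B'] by blast+
    then show "B = B'" by simp
  qed
  ultimately have "card {B. homog_block G B} \<le> card (insert (fst G) ?D)"
    by (intro card_inj_on_le) (use finD in auto)
  also have "\<dots> \<le> card ?D + 1" using finD by (simp add: card_insert_if)
  finally show ?thesis by (simp add: num_blocks_def)
qed

text \<open>The graph induced on \<open>s + 1, ..., s + m\<close>, relabelled to start at
  \<open>1\<close>; \<open>e\<close> is read on increasing pairs only.\<close>

definition gr :: "(nat \<Rightarrow> nat \<Rightarrow> bool) \<Rightarrow> nat \<Rightarrow> nat \<Rightarrow> ograph" where
  "gr e s m = (m, pat m e (\<lambda>i. s + i))"

lemma og_sum_Cons: "og_sum (B # Bs) = og_plus B (og_sum Bs)"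
  by (simp add: og_sum_def)

lemma og_sum_Nil: "og_sum [] = (0, {})"
  by (simp add: og_sum_def)

lemma gr_cong:
  "(\<And>x y. s < x \<Longrightarrow> x < y \<Longrightarrow> y \<le> s + m \<Longrightarrow> e x y = e' x y) \<Longrightarrow> gr e s m = gr e' s m"
  by (auto simp: gr_def pat_def)

lemma gr_plus:
  assumes c: "c \<le> m" and no: "\<And>x y. s < x \<Longrightarrow> x \<le> s + c \<Longrightarrow> s + c < y \<Longrightarrow> y \<le> s + m \<Longrightarrow> \<not> e x y"
  shows "gr e s m = og_plus (gr e s c) (gr e (s + c) (m - c))"
proof -
  have "(i, j) \<in> snd (gr e s m) \<longleftrightarrow> (i, j) \<in> snd (og_plus (gr e s c) (gr e (s + c) (m - c)))" for i j
  proof -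
    have mem: "(i, j) \<in> snd (gr e s m) \<longleftrightarrow> 1 \<le> i \<and> i < j \<and> j \<le> m \<and> e (s + i) (s + j)" for i j s m
      by (simp add: gr_def pat_def)
    have f: "fst (gr e s c) = c" by (simp add: gr_def)
    consider "j \<le> c" | "i \<le> c" "c < j" | "c < i" "c < j" by linarith
    then show ?thesis
    proof cases
      case 1 then show ?thesis unfolding snd_plus_iff mem f using c by auto
    next
      case 2 then show ?thesis unfolding snd_plus_iff mem f using no[of "s + i" "s + j"] by auto
    next
      case 3
      then have "s + c + (i - c) = s + i" "s + c + (j - c) = s + j" by simp_all
      then show ?thesis unfolding snd_plus_iff mem f using c 3 by auto
    qed
  qed
  then have "snd (gr e s m) = snd (og_plus (gr e s c) (gr e (s + c) (m - c)))" by auto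
  then show ?thesis using c by (simp add: prod_eq_iff) (simp add: gr_def)
qed

lemma occ_gr:
  assumes "s' \<le> s" "s + m \<le> t"
  shows "occ e {s'+1..t} (gr e s m)"
  unfolding occ_def gr_def using assms by (intro exI[of _ "\<lambda>i. s + i"] conjI embI) auto

text \<open>Split off the shortest nonempty initial segment that no edge leaves. By minimality each
  cut inside it is crossed by an edge, and that edge ends inside the segment.\<close>

lemma gr_decompose:
  "\<exists>Bs. gr e s m = og_sum Bs \<and> (\<forall>B\<in>set Bs. indec B \<and> occ e {s+1..s+m} B)"
proof (induction m arbitrary: s rule: less_induct)
  case (less m)
  show ?case
  proof (cases "m = 0")
    case True
    then show ?thesis by (intro exI[of _ "[]"]) (auto simp: gr_def pat_def og_sum_Nil)
  next
    case False
    let ?P = "\<lambda>c. 1 \<le> c \<and> c \<le> m \<and> (\<forall>x y. s < x \<and> x \<le> s + c \<and> s + c < y \<and> y \<le> s + m \<longrightarrow> \<not> e x y)"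
    define c where "c = (LEAST c. ?P c)"
    have "?P m" using False by auto
    then have c: "?P c" unfolding c_def by (rule LeastI)
    have min: "\<not> ?P c'" if "c' < c" for c' using not_less_Least[of c' ?P] that unfolding c_def by blast
    have ind: "indec (gr e s c)"
      unfolding indec_def
    proof (intro conjI allI impI)
      show "1 \<le> fst (gr e s c)" using c by (simp add: gr_def)
      fix k assume k: "1 \<le> k \<and> k < fst (gr e s c)"
      then have kc: "1 \<le> k" "k < c" by (auto simp: gr_def)
      then obtain x y where xy: "s < x" "x \<le> s + k" "s + k < y" "y \<le> s + m" "e x y"
        using min[of k] c by auto
      have "y \<le> s + c"
      proof (rule ccontr)
        assume "\<not> y \<le> s + c"
        then show False using c xy kc by auto
      qed
      then have "(x - s, y - s) \<in> snd (gr e s c)" using xy by (auto simp: gr_def pat_def)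
      then show "\<exists>i j. (i, j) \<in> snd (gr e s c) \<and> i \<le> k \<and> k < j"
        using xy by (intro exI[of _ "x - s"] exI[of _ "y - s"]) auto
    qed
    have "m - c < m" using c by auto
    from less.IH[OF this, of "s + c"] obtain Bs where
      Bs: "gr e (s + c) (m - c) = og_sum Bs" "\<forall>B\<in>set Bs. indec B \<and> occ e {s+c+1..s+c+(m-c)} B"
      by (elim exE conjE) (rule that)
    have "gr e s m = og_plus (gr e s c) (gr e (s + c) (m - c))"
      by (rule gr_plus) (use c in blast)+
    then have "gr e s m = og_sum (gr e s c # Bs)" by (simp add: og_sum_Cons Bs(1))
    moreover have "occ e {s+1..s+m} (gr e s c)" by (rule occ_gr) (use c in auto)
    moreover have "occ e {s+1..s+m} B" if BB: "B \<in> set Bs" for B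
    proof -
      obtain f where "emb (fst B) {s+c+1..s+c+(m-c)} f" "snd B = pat (fst B) e f"
        using bspec[OF Bs(2) BB] unfolding occ_def by (elim exE conjE) (rule that; assumption)
      moreover have "{s+c+1..s+c+(m-c)} \<subseteq> {s+1..s+m}" using c by auto
      ultimately show ?thesis unfolding occ_def using emb_mono by blast
    qed
    ultimately have "gr e s m = og_sum (gr e s c # Bs) \<and>
        (\<forall>B\<in>set (gr e s c # Bs). indec B \<and> occ e {s+1..s+m} B)"
      using ind Bs(2) by simp
    then show ?thesis by (rule exI)
  qed
qed

definition comparable_sum :: "nat \<Rightarrow> ograph \<Rightarrow> bool" where
  "comparable_sum l A \<longleftrightarrow> (\<exists>Bs. A = og_sum Bs \<and> (\<forall>B\<in>set Bs. B \<in> Jset l) \<and>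
     (\<forall>B\<in>set Bs. \<forall>B'\<in>set Bs. ind_sub B B' \<or> ind_sub B' B))"

lemma not_bad_comparable_sum:
  assumes "\<not> bad l e {s+1..s+m}"
  shows "comparable_sum l (gr e s m)"
proof -
  obtain Bs where Bs: "gr e s m = og_sum Bs" "\<forall>B\<in>set Bs. indec B \<and> occ e {s+1..s+m} B"
    using gr_decompose[of e s m] by (elim exE conjE) (rule that)
  have "ind_sub B B' \<or> ind_sub B' B" if "B \<in> set Bs" "B' \<in> set Bs" for B B'
  proof (cases "fst B \<le> fst B'")
    case True
    then have "ind_sub B B'" by (intro not_bad_comparable[OF assms]) (use Bs(2) that in auto)
    then show ?thesis ..
  next
    case False
    then have "ind_sub B' B" by (intro not_bad_comparable[OF assms]) (use Bs(2) that in auto)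
    then show ?thesis ..
  qed
  moreover have "B \<in> Jset l" if "B \<in> set Bs" for B
    by (rule not_bad_in_Jset[OF assms]) (use Bs(2) that in auto)
  ultimately show ?thesis unfolding comparable_sum_def by (intro exI[of _ Bs] conjI Bs(1) ballI)
qed

section \<open>Segmentation and the theorem\<close>

definition bad_both :: "nat \<Rightarrow> (nat \<Rightarrow> nat \<Rightarrow> bool) \<Rightarrow> nat set \<Rightarrow> bool" where
  "bad_both l e W \<longleftrightarrow> bad l e W \<and> bad l (\<lambda>u v. \<not> e u v) W"

text \<open>\<open>J\<close> is the sum of the graphs \<open>As\<close> on the vertices \<open>s + 1, \<dots>, N\<close>; within the interval
  \<open>{c0<..c1}\<close> between two cuts it is \<open>e\<close> (if \<open>\<not> ga\<close>) or the complement of \<open>e\<close> (if \<open>ga\<close>).\<close>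
definition segmented where
  "segmented l e N s k As J C \<longleftrightarrow> length As \<le> k \<and> og_sum As = gr J s (N - s) \<and> (\<forall>A\<in>set As. comparable_sum l A) \<and>
    finite C \<and> card C \<le> k + 1 \<and> s \<in> C \<and>
    (\<forall>i. s < i \<and> i < N \<and> i \<notin> C \<longrightarrow> (\<exists>c0\<in>C. \<exists>c1\<in>C. \<exists>ga. s \<le> c0 \<and> c0 < i \<and> i < c1 \<and> c1 \<le> N \<and>
      (\<forall>x\<in>{i, i + 1}. \<forall>y. s < y \<and> y \<le> N \<longrightarrow>
        (x < y \<longrightarrow> J x y = (y \<le> c1 \<and> e x y \<noteq> (ga::bool))) \<and>
        (y < x \<longrightarrow> J y x = (c0 < y \<and> e y x \<noteq> ga)))))"

lemma segmented_end: "segmented l e N N 0 [] J {N}"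
proof -
  have "og_sum [] = gr J N (N - N)" by (auto simp: og_sum_Nil gr_def pat_def)
  then show ?thesis unfolding segmented_def by (intro conjI allI impI) (simp_all, linarith)
qed

text \<open>At least one of \<open>e\<close> and its complement is not bad on the new interval;
  \<open>ga\<close> selects the complement when \<open>e\<close> is bad. \<open>J'\<close> copies
  the selected relation there, keeps \<open>J\<close> behind \<open>t\<close> and has no edge across
  the cut at \<open>t\<close>.\<close>

lemma segmented_step:
  assumes st: "s \<le> t" "t \<le> N" and nb: "\<not> bad_both l e {s+1..t}" and seg: "segmented l e N t k As J C"
  shows "\<exists>As' J' C'. segmented l e N s (k + 1) As' J' C'"
proof -
  define ga where "ga \<longleftrightarrow> bad l e {s+1..t}"
  define e' where "e' x y \<longleftrightarrow> e x y \<noteq> ga" for x y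
  have "\<not> bad l e' {s+1..s+(t-s)}"
  proof (cases ga)
    case True
    then have "e' = (\<lambda>u v. \<not> e u v)" by (simp add: e'_def fun_eq_iff)
    then show ?thesis using nb True st by (simp add: bad_both_def ga_def)
  next
    case False
    then have "e' = e" by (simp add: e'_def fun_eq_iff)
    then show ?thesis using False st by (simp add: ga_def)
  qed
  then have cs: "comparable_sum l (gr e' s (t - s))" by (rule not_bad_comparable_sum)
  define J' where "J' x y \<longleftrightarrow> (if y \<le> t then e' x y else t < x \<and> J x y)" for x y
  have S: "length As \<le> k" "og_sum As = gr J t (N - t)" "\<forall>A\<in>set As. comparable_sum l A"
    "finite C" "card C \<le> k + 1" "t \<in> C"
    using seg unfolding segmented_def by blast+
  have "gr J' s (N - s) = og_plus (gr J' s (t - s)) (gr J' (s + (t - s)) (N - s - (t - s)))"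
    by (rule gr_plus) (use st in \<open>auto simp: J'_def\<close>)
  also have "gr J' s (t - s) = gr e' s (t - s)"
    by (rule gr_cong) (use st in \<open>auto simp: J'_def\<close>)
  also have "gr J' (s + (t - s)) (N - s - (t - s)) = gr J t (N - t)"
    using st by (auto intro!: gr_cong simp: J'_def)
  finally have sum: "og_sum (gr e' s (t - s) # As) = gr J' s (N - s)"
    by (simp add: og_sum_Cons S(2))
  have "segmented l e N s (k + 1) (gr e' s (t - s) # As) J' (insert s C)"
    unfolding segmented_def
  proof (intro conjI allI impI)
    show "og_sum (gr e' s (t - s) # As) = gr J' s (N - s)" by (rule sum)
    show "card (insert s C) \<le> k + 1 + 1" using S by (simp add: card_insert_if)
    fix i assume i: "s < i \<and> i < N \<and> i \<notin> insert s C"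
    show "\<exists>c0\<in>insert s C. \<exists>c1\<in>insert s C. \<exists>ga. s \<le> c0 \<and> c0 < i \<and> i < c1 \<and> c1 \<le> N \<and>
      (\<forall>x\<in>{i, i + 1}. \<forall>y. s < y \<and> y \<le> N \<longrightarrow>
        (x < y \<longrightarrow> J' x y = (y \<le> c1 \<and> e x y \<noteq> ga)) \<and> (y < x \<longrightarrow> J' y x = (c0 < y \<and> e y x \<noteq> ga)))"
    proof (cases "i < t")
      case True
      then show ?thesis
        using i S(6) st
        by (intro bexI[of _ s] bexI[of _ t] exI[of _ ga]) (auto simp: J'_def e'_def)
    next
      case False
      then have "t < i" using i S(6) by (cases "i = t") auto
      then have "\<exists>c0\<in>C. \<exists>c1\<in>C. \<exists>ga. t \<le> c0 \<and> c0 < i \<and> i < c1 \<and> c1 \<le> N \<and>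
        (\<forall>x\<in>{i, i + 1}. \<forall>y. t < y \<and> y \<le> N \<longrightarrow>
          (x < y \<longrightarrow> J x y = (y \<le> c1 \<and> e x y \<noteq> ga)) \<and> (y < x \<longrightarrow> J y x = (c0 < y \<and> e y x \<noteq> ga)))"
        using seg i unfolding segmented_def by blast
      then obtain c0 c1 g where c: "c0 \<in> C" "c1 \<in> C" "t \<le> c0" "c0 < i" "i < c1" "c1 \<le> N"
        and J: "\<forall>x\<in>{i, i + 1}. \<forall>y. t < y \<and> y \<le> N \<longrightarrow>
          (x < y \<longrightarrow> J x y = (y \<le> c1 \<and> e x y \<noteq> g)) \<and> (y < x \<longrightarrow> J y x = (c0 < y \<and> e y x \<noteq> g))"
        by (elim bexE exE conjE) (rule that; assumption)
      have "(x < y \<longrightarrow> J' x y = (y \<le> c1 \<and> e x y \<noteq> g)) \<and> (y < x \<longrightarrow> J' y x = (c0 < y \<and> e y x \<noteq> g))"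
        if x: "x \<in> {i, i + 1}" and y: "s < y \<and> y \<le> N" for x y
      proof (cases "t < y")
        case True
        then have "(x < y \<longrightarrow> J x y = (y \<le> c1 \<and> e x y \<noteq> g)) \<and> (y < x \<longrightarrow> J y x = (c0 < y \<and> e y x \<noteq> g))"
          using J x y by blast
        moreover have "t < x" using x \<open>t < i\<close> by auto
        ultimately show ?thesis using True by (auto simp: J'_def)
      next
        case False
        moreover have "t < x" using x \<open>t < i\<close> by auto
        ultimately show ?thesis using c(3) by (auto simp: J'_def)
      qed
      then show ?thesis using c st by (intro bexI[of _ c0] bexI[of _ c1] exI[of _ g]) auto
    qed
  qed (use S cs in auto)
  then show ?thesis by blast
qed

text \<open>A single vertex carries only one graph, and its order \<open>1\<close> differs from
  \<open>l + 1\<close> because \<open>1 \<le> l\<close>.\<close>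

lemma not_bad_small:
  assumes l: "1 \<le> l"
  shows "\<not> bad l e {t..t}" "\<not> bad l e {s+1..s}"
proof -
  have sz: "fst A \<le> card W" if occA: "occ e W A" and finW: "finite W" for A W
  proof -
    obtain f where f: "emb (fst A) W f" using occA unfolding occ_def by blast
    have "card (f ` {1..fst A}) \<le> card W"
      using f finW by (intro card_mono) (auto simp: emb_def)
    then show ?thesis using card_image[OF emb_inj_on[OF f]] by simp
  qed
  have no: "\<not> bad l e W" if W: "finite W" "card W \<le> 1" for W
  proof
    assume "bad l e W"
    then obtain A B where AB: "indec A" "indec B" "fst A = fst B" "fst A = l + 1 \<or> A \<noteq> B" "occ e W A" "occ e W B"
      unfolding bad_def by blast
    have "fst A = 1" "fst B = 1" using sz[OF AB(5) W(1)] W(2) AB(1,3) by (auto simp: indec_def)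
    moreover have "snd A = {}" "snd B = {}"
      using \<open>fst A = 1\<close> \<open>fst B = 1\<close> AB(5,6) unfolding occ_def by (auto simp: pat_def)
    ultimately have "A = B" by (simp add: prod_eq_iff)
    then show False using AB(4) \<open>fst A = 1\<close> l by simp
  qed
  show "\<not> bad l e {t..t}" "\<not> bad l e {s+1..s}" by (rule no; simp)+
qed

text \<open>The shortest bad initial interval is split off greedily. Without its last vertex it is
  no longer bad, and that vertex is a segment of its own; hence two segments for each of fewer than
  \<open>r\<close> bad intervals, and a final one.\<close>

lemma segmented_exists:
  assumes l: "1 \<le> l"
  shows "s \<le> N \<Longrightarrow> (\<And>W. (\<forall>a<r. W a \<subseteq> {s+1..N} \<and> bad_both l e (W a)) \<Longrightarrow>
      (\<forall>a b. a < b \<longrightarrow> b < r \<longrightarrow> (\<forall>u\<in>W a. \<forall>v\<in>W b. u < v)) \<Longrightarrow> False) \<Longrightarrow>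
    \<exists>As J C. segmented l e N s (2 * r) As J C"
proof (induction r arbitrary: s)
  case 0
  \<comment> \<open>The empty family is already forbidden, so \<open>r = 0\<close> cannot
    occur.\<close>
  have False by (rule "0.prems"(2)[of "\<lambda>_. {}"]) auto
  then show ?case ..
next
  case (Suc r)
  show ?case
  proof (cases "bad_both l e {s+1..N}")
    case False
    have "\<exists>As J C. segmented l e N s (0 + 1) As J C"
      by (rule segmented_step[OF Suc.prems(1) le_refl False segmented_end])
    then obtain As J C where "segmented l e N s 1 As J C" by auto
    then have "segmented l e N s (2 * Suc r) As J C" by (auto simp: segmented_def)
    then show ?thesis by blast
  next
    case True
    let ?P = "\<lambda>t. s \<le> t \<and> bad_both l e {s+1..t}"
    define t where "t = (LEAST t. ?P t)"
    have PN: "?P N" using True Suc.prems(1) by simp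
    then have t: "s \<le> t" "bad_both l e {s+1..t}" unfolding t_def by (metis (mono_tags, lifting) LeastI)+
    have tN: "t \<le> N" unfolding t_def using PN by (rule Least_le)
    have "t \<noteq> s" using t(2) not_bad_small(2)[OF l] by (auto simp: bad_both_def)
    then have st: "s < t" using t(1) by simp
    have nb: "\<not> bad_both l e {s+1..t-1}"
      using not_less_Least[of "t - 1" ?P] st unfolding t_def[symmetric] by auto
    have rest: "\<exists>As J C. segmented l e N t (2 * r) As J C"
    proof (rule Suc.IH[OF tN])
      fix W
      assume W: "\<forall>a<r. W a \<subseteq> {t+1..N} \<and> bad_both l e (W a)"
        and ord: "\<forall>a b. a < b \<longrightarrow> b < r \<longrightarrow> (\<forall>u\<in>W a. \<forall>v\<in>W b. u < v)"
      \<comment> \<open>A forbidden family behind \<open>t\<close> is prolonged by the bad interval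
        just found, placed in front.\<close>
      define W' where "W' a = (case a of 0 \<Rightarrow> {s+1..t} | Suc b \<Rightarrow> W b)" for a
      show False
      proof (rule Suc.prems(2)[of W'])
        show "\<forall>a<Suc r. W' a \<subseteq> {s+1..N} \<and> bad_both l e (W' a)"
        proof (intro allI impI)
          fix a assume "a < Suc r"
          then show "W' a \<subseteq> {s+1..N} \<and> bad_both l e (W' a)"
            using W t tN st by (cases a) (fastforce simp: W'_def)+
        qed
        show "\<forall>a b. a < b \<longrightarrow> b < Suc r \<longrightarrow> (\<forall>u\<in>W' a. \<forall>v\<in>W' b. u < v)"
        proof (intro allI impI ballI)
          fix a b u v assume ab: "a < b" "b < Suc r" "u \<in> W' a" "v \<in> W' b"
          obtain b' where b': "b = Suc b'" using ab by (cases b) auto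
          then have v: "v \<in> W b'" "b' < r" using ab by (simp_all add: W'_def)
          show "u < v"
          proof (cases a)
            case 0
            then have "u \<le> t" using ab by (simp add: W'_def)
            moreover have "v \<in> {t+1..N}" using W v by blast
            ultimately show ?thesis by simp
          next
            case (Suc a')
            then have "u \<in> W a'" "a' < b'" using ab b' by (simp_all add: W'_def)
            then show ?thesis using ord v by blast
          qed
        qed
      qed
    qed
    have nb1: "\<not> bad_both l e {t - 1 + 1..t}"
      using not_bad_small(1)[OF l, of e t] st by (simp add: bad_both_def)
    obtain As J C where "segmented l e N t (2 * r) As J C" using rest by blast
    from segmented_step[OF _ tN nb1 this] obtain As' J' C' where
      "segmented l e N (t - 1) (2 * r + 1) As' J' C'" by auto
    from segmented_step[OF _ _ nb this] have "\<exists>As J C. segmented l e N s (2 * r + 1 + 1) As J C"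
      using st tN by auto
    then show ?thesis by simp
  qed
qed

section \<open>From subgraph counts to the hereditary property\<close>

lemma card_subs_le_level:
  assumes her: "hereditary P" and G: "G \<in> P"
  shows "card (subs n {1..fst G} (\<lambda>x y. (x, y) \<in> snd G)) \<le> card (level P n)"
proof -
  have og: "ord_graph G" using her G by (simp add: hereditary_def)
  have "finite (level P n)"
    by (rule finite_subset[OF _ finite_ord_graphs[of n]]) (use her in \<open>auto simp: level_def hereditary_def\<close>)
  moreover have "Pair n ` subs n {1..fst G} (\<lambda>x y. (x, y) \<in> snd G) \<subseteq> level P n"
  proof (rule image_subsetI)
    fix p assume "p \<in> subs n {1..fst G} (\<lambda>x y. (x, y) \<in> snd G)"
    then have o: "occ (\<lambda>x y. (x, y) \<in> snd G) {1..fst G} (n, p)" by (auto simp: subs_def occ_def)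
    have "(n, p) \<in> P"
      using her G occ_imp_ind_sub[OF og o] occ_ord_graph[OF o] unfolding hereditary_def by blast
    then show "(n, p) \<in> level P n" by (simp add: level_def)
  qed
  ultimately have "card (Pair n ` subs n {1..fst G} (\<lambda>x y. (x, y) \<in> snd G)) \<le> card (level P n)"
    by (intro card_mono)
  then show ?thesis by (simp add: card_image inj_on_def)
qed

text \<open>\<open>k\<close> and \<open>k'\<close> are fixed before \<open>G\<close>: they come from
  Ramsey numbers that depend on \<open>n\<close> and \<open>l\<close> alone.\<close>

lemma few_subgraphs_structure:
  assumes l: "1 \<le> l" and n: "1 \<le> n"
  shows "\<exists>k k'. \<forall>G. ord_graph G \<longrightarrow> card (subs n {1..fst G} (\<lambda>x y. (x, y) \<in> snd G)) < F n (l + 1) \<longrightarrow>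
    (\<exists>H J. ord_graph H \<and> fst H = fst G \<and> fst J = fst G \<and> num_blocks H \<le> k \<and> J \<in> Jcal k' l \<and>
      snd G = (snd H - snd J) \<union> (snd J - snd H))"
proof -
  obtain T1 where T1: "\<forall>e N c. c \<le> N \<longrightarrow> card (subs n {1..N} e) < 2 ^ (n - 1) \<longrightarrow>
    card {i. 1 \<le> i \<and> i < c \<and> (\<exists>y. c < y \<and> y \<le> N \<and> e i y \<noteq> e (i + 1) y)} \<le> T1"
    using card_row_changes_bounded[OF n] by (elim exE) (rule that)
  obtain T2 where T2: "\<forall>e N c. c \<le> N \<longrightarrow> card (subs n {1..N} e) < 2 ^ (n - 1) \<longrightarrow>
    card {i. c < i \<and> i < N \<and> (\<exists>y. 1 \<le> y \<and> y \<le> c \<and> e y i \<noteq> e y (i + 1))} \<le> T2"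
    using card_col_changes_bounded[OF n] by (elim exE) (rule that)
  obtain R :: nat where R: "\<forall>V e W. (\<forall>a<R. W a \<subseteq> V \<and> bad l e (W a) \<and> bad l (\<lambda>u v. \<not> e u v) (W a)) \<longrightarrow>
    (\<forall>a b. a < b \<longrightarrow> b < R \<longrightarrow> (\<forall>u\<in>W a. \<forall>v\<in>W b. u < v)) \<longrightarrow> F n (l + 1) \<le> card (subs n V e)"
    using many_bad_ge_F[OF n, of l] by (elim exE) (rule that)
  \<comment> \<open>There are at most \<open>2 * R + 1\<close> cuts, each with at most
    \<open>T1\<close> row changes and \<open>T2\<close> column changes; the final \<open>1\<close>
    accounts for the last block.\<close>
  define K where "K = (2 * R + 1) + (2 * R + 1) * T1 + (2 * R + 1) * T2 + 1"
  show ?thesis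
  proof (rule exI[of _ K], rule exI[of _ "2 * R"], intro allI impI)
    fix G :: ograph
    define N where "N = fst G"
    define e where "e x y \<longleftrightarrow> (x, y) \<in> snd G" for x y
    assume og: "ord_graph G" and "card (subs n {1..fst G} (\<lambda>x y. (x, y) \<in> snd G)) < F n (l + 1)"
    moreover have "e = (\<lambda>x y. (x, y) \<in> snd G)" by (simp add: e_def fun_eq_iff)
    ultimately have few: "card (subs n {1..N} e) < F n (l + 1)" by (simp only: N_def)
    have few2: "card (subs n {1..N} e) < 2 ^ (n - 1)" by (rule less_le_trans[OF few F_le]) (use n in simp)
    have "\<exists>As J C. segmented l e N 0 (2 * R) As J C"
    proof (rule segmented_exists[OF l])
      fix W
      assume W: "\<forall>a<R. W a \<subseteq> {0+1..N} \<and> bad_both l e (W a)"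
        and ord: "\<forall>a b. a < b \<longrightarrow> b < R \<longrightarrow> (\<forall>u\<in>W a. \<forall>v\<in>W b. u < v)"
      have W': "\<forall>a<R. W a \<subseteq> {1..N} \<and> bad l e (W a) \<and> bad l (\<lambda>u v. \<not> e u v) (W a)"
        using W unfolding bad_both_def add_0 .
      have "F n (l + 1) \<le> card (subs n {1..N} e)"
        by (rule R[THEN spec, of "{1..N}", THEN spec, of e, THEN spec, of W, THEN mp, THEN mp, OF W' ord])
      then show False using few by simp
    qed simp
    then obtain As J C where seg: "segmented l e N 0 (2 * R) As J C" by blast
    define Jg where "Jg = og_sum As"
    have S: "length As \<le> 2 * R" "\<forall>A\<in>set As. comparable_sum l A" "finite C" "card C \<le> 2 * R + 1"
      "og_sum As = gr J 0 (N - 0)"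
      using seg unfolding segmented_def by blast+
    then have Jg: "Jg = gr J 0 N" by (simp add: Jg_def)
    define H where "H = (N, (snd G - snd Jg) \<union> (snd Jg - snd G))"
    have sJ: "(x, y) \<in> snd Jg \<longleftrightarrow> 1 \<le> x \<and> x < y \<and> y \<le> N \<and> J x y" for x y
      unfolding Jg by (simp add: gr_def pat_def)
    have sH: "(x, y) \<in> snd H \<longleftrightarrow> (e x y \<noteq> J x y)" if "1 \<le> x" "x < y" "y \<le> N" for x y
      using sJ[of x y] that by (auto simp: H_def e_def)
    have ogH: "ord_graph H"
      using og sJ unfolding ord_graph_def H_def N_def by auto
    let ?Rc = "\<lambda>c. {i. 1 \<le> i \<and> i < c \<and> (\<exists>y. c < y \<and> y \<le> N \<and> e i y \<noteq> e (i + 1) y)}"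
    let ?Lc = "\<lambda>c. {i. c < i \<and> i < N \<and> (\<exists>y. 1 \<le> y \<and> y \<le> c \<and> e y i \<noteq> e y (i + 1))}"
    let ?C = "{c \<in> C. c \<le> N}"
    let ?D = "{i. 1 \<le> i \<and> i < fst H \<and> \<not> twins H i (i + 1)}"
    have adjH: "adj H x y \<longleftrightarrow> e x y \<noteq> J x y" "adj H y x \<longleftrightarrow> e x y \<noteq> J x y"
      if "1 \<le> x" "x < y" "y \<le> N" for x y
      using that sH[OF that] unfolding adj_def by (simp_all add: min_def max_def)
    \<comment> \<open>Within its interval \<open>H\<close> is constantly \<open>ga\<close>, and from
      the interval to the outside it agrees with \<open>e\<close>. So \<open>i\<close> and
      \<open>i + 1\<close> can differ only on vertices beyond one of the cuts \<open>c0\<close> and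
      \<open>c1\<close>, where a difference is a change across that cut.\<close>
    have tw: "twins H i (i + 1)"
      if i: "1 \<le> i" "i < N" and iC: "i \<notin> C" and nR: "\<And>c. c \<in> ?C \<Longrightarrow> i \<notin> ?Rc c" and nL: "\<And>c. c \<in> ?C \<Longrightarrow> i \<notin> ?Lc c" for i
    proof -
      have "\<exists>c0\<in>C. \<exists>c1\<in>C. \<exists>ga. 0 \<le> c0 \<and> c0 < i \<and> i < c1 \<and> c1 \<le> N \<and>
        (\<forall>x\<in>{i, i + 1}. \<forall>y. 0 < y \<and> y \<le> N \<longrightarrow>
          (x < y \<longrightarrow> J x y = (y \<le> c1 \<and> e x y \<noteq> ga)) \<and> (y < x \<longrightarrow> J y x = (c0 < y \<and> e y x \<noteq> ga)))"
        using seg i iC unfolding segmented_def by auto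
      then obtain c0 c1 ga where c: "c0 \<in> C" "c1 \<in> C" "c0 < i" "i < c1" "c1 \<le> N"
        and Jx: "\<forall>x\<in>{i, i + 1}. \<forall>y. 0 < y \<and> y \<le> N \<longrightarrow>
          (x < y \<longrightarrow> J x y = (y \<le> c1 \<and> e x y \<noteq> ga)) \<and> (y < x \<longrightarrow> J y x = (c0 < y \<and> e y x \<noteq> ga))"
        by (elim bexE exE conjE) (rule that; assumption)
      have right: "J i y = (y \<le> c1 \<and> e i y \<noteq> ga)" "J (i + 1) y = (y \<le> c1 \<and> e (i + 1) y \<noteq> ga)"
        if "i + 1 < y" "y \<le> N" for y using Jx that by auto
      have left: "J y i = (c0 < y \<and> e y i \<noteq> ga)" "J y (i + 1) = (c0 < y \<and> e y (i + 1) \<noteq> ga)"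
        if "1 \<le> y" "y < i" for y using Jx that i by auto
      have outr: "e i y = e (i + 1) y" if "c1 < y" "y \<le> N" for y
        using nR[of c1] c i that by auto
      have outl: "e y i = e y (i + 1)" if "1 \<le> y" "y \<le> c0" for y
        using nL[of c0] c i that by auto
      have "adj H i y \<longleftrightarrow> adj H (i + 1) y" if y: "y \<in> {1..N}" "y \<noteq> i" "y \<noteq> i + 1" for y
      proof (cases "i < y")
        case True
        then have y': "i + 1 < y" "y \<le> N" using y by auto
        have a: "adj H i y \<longleftrightarrow> e i y \<noteq> J i y" "adj H (i + 1) y \<longleftrightarrow> e (i + 1) y \<noteq> J (i + 1) y"
          by (rule adjH(1); use i y' in simp)+
        show ?thesis unfolding a right[OF y'] using outr[of y] y' by (cases "y \<le> c1") auto
      next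
        case False
        then have y': "1 \<le> y" "y < i" using y by auto
        have a: "adj H i y \<longleftrightarrow> e y i \<noteq> J y i" "adj H (i + 1) y \<longleftrightarrow> e y (i + 1) \<noteq> J y (i + 1)"
          by (rule adjH(2); use i y' in simp)+
        show ?thesis unfolding a left[OF y'] using outl[of y] y' by (cases "c0 < y") auto
      qed
      moreover have "\<not> adj H w w" for w by (simp add: adj_def)
      moreover have "fst H = N" by (simp add: H_def)
      ultimately show ?thesis unfolding twins_def nbhd_def by blast
    qed
    have bRc: "card (?Rc c) \<le> T1" and bLc: "card (?Lc c) \<le> T2" if "c \<in> ?C" for c
    proof -
      have "c \<le> N" using that by simp
      then show "card (?Rc c) \<le> T1" "card (?Lc c) \<le> T2"
        by (rule T1[THEN spec, THEN spec, THEN spec, THEN mp, THEN mp, OF _ few2],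
            rule T2[THEN spec, THEN spec, THEN spec, THEN mp, THEN mp, OF _ few2])
    qed
    have "?D \<subseteq> C \<union> (\<Union>c\<in>?C. ?Rc c) \<union> (\<Union>c\<in>?C. ?Lc c)"
    proof (rule subsetI, rule ccontr)
      fix i assume i: "i \<in> ?D" and "i \<notin> C \<union> (\<Union>c\<in>?C. ?Rc c) \<union> (\<Union>c\<in>?C. ?Lc c)"
      then have "i \<notin> C" "\<And>c. c \<in> ?C \<Longrightarrow> i \<notin> ?Rc c" "\<And>c. c \<in> ?C \<Longrightarrow> i \<notin> ?Lc c" by blast+
      moreover have "1 \<le> i" "i < N" "\<not> twins H i (i + 1)" using i by (simp_all add: H_def)
      ultimately show False using tw[of i] by blast
    qed
    moreover have finC: "finite ?C" "card ?C \<le> 2 * R + 1"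
      using S(3,4) card_mono[of C ?C] by auto
    moreover have "finite (?Rc c)" "finite (?Lc c)" if "c \<in> ?C" for c
      by (rule finite_subset[of _ "{..N}"]; use that in auto)+
    ultimately have "card ?D \<le> card (C \<union> (\<Union>c\<in>?C. ?Rc c) \<union> (\<Union>c\<in>?C. ?Lc c))"
      using S(3) by (intro card_mono) auto
    also have "\<dots> \<le> card C + card (\<Union>c\<in>?C. ?Rc c) + card (\<Union>c\<in>?C. ?Lc c)"
      by (meson add_le_mono card_Un_le le_refl le_trans)
    also have "\<dots> \<le> (2 * R + 1) + (2 * R + 1) * T1 + (2 * R + 1) * T2"
    proof (intro add_mono S(4))
      have "card (\<Union>c\<in>?C. ?Rc c) \<le> (\<Sum>c\<in>?C. card (?Rc c))" by (rule card_UN_le[OF finC(1)])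
      also have "\<dots> \<le> card ?C * T1" by (rule sum_bounded_above[of ?C "\<lambda>c. card (?Rc c)" T1, OF bRc, unfolded of_nat_id])
      also have "\<dots> \<le> (2 * R + 1) * T1" using finC(2) by (rule mult_le_mono1)
      finally show "card (\<Union>c\<in>?C. ?Rc c) \<le> (2 * R + 1) * T1" .
      have "card (\<Union>c\<in>?C. ?Lc c) \<le> (\<Sum>c\<in>?C. card (?Lc c))" by (rule card_UN_le[OF finC(1)])
      also have "\<dots> \<le> card ?C * T2" by (rule sum_bounded_above[of ?C "\<lambda>c. card (?Lc c)" T2, OF bLc, unfolded of_nat_id])
      also have "\<dots> \<le> (2 * R + 1) * T2" using finC(2) by (rule mult_le_mono1)
      finally show "card (\<Union>c\<in>?C. ?Lc c) \<le> (2 * R + 1) * T2" .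
    qed
    finally have "num_blocks H \<le> K" using num_blocks_le[of H] unfolding K_def by linarith
    moreover have "Jg \<in> Jcal (2 * R) l"
      unfolding Jcal_def
    proof (rule CollectI, rule exI[of _ As], intro conjI ballI)
      fix A assume "A \<in> set As"
      then have "comparable_sum l A" using S(2) by blast
      then show "\<exists>Bs. A = og_sum Bs \<and> (\<forall>B\<in>set Bs. B \<in> Jset l) \<and>
          (\<forall>B\<in>set Bs. \<forall>B'\<in>set Bs. ind_sub B B' \<or> ind_sub B' B)" by (simp only: comparable_sum_def)
    qed (use S Jg_def in auto)
    moreover have "fst Jg = fst G" unfolding Jg by (simp add: gr_def N_def)
    moreover have "fst H = fst G" by (simp add: H_def N_def)
    moreover have "snd G = (snd H - snd Jg) \<union> (snd Jg - snd H)" by (auto simp: H_def)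
    ultimately show "\<exists>H J. ord_graph H \<and> fst H = fst G \<and> fst J = fst G \<and> num_blocks H \<le> K \<and> J \<in> Jcal (2 * R) l \<and>
      snd G = (snd H - snd J) \<union> (snd J - snd H)"
      using ogH by blast
  qed
qed

theorem theorem23:
  fixes n l :: nat and P :: "ograph set"
  assumes "1 \<le> l"
    and "hereditary P"
    and "card (level P n) < F n (l + 1)"
  shows "\<exists>k k'. \<forall>G\<in>P. \<exists>H J. ord_graph H \<and> fst H = fst G \<and> fst J = fst G \<and>
           num_blocks H \<le> k \<and> J \<in> Jcal k' l \<and>
           snd G = (snd H - snd J) \<union> (snd J - snd H)"
proof (cases "n = 0")
  case True
  \<comment> \<open>For \<open>n = 0\<close> the hypothesis says that \<open>P\<close> has no graph
    of order \<open>0\<close>. The empty graph is an induced subgraph of every graph, so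
    \<open>P\<close> is empty.\<close>
  have "card (subs 0 V e) = 1" for V e
  proof -
    have "subs 0 V e = {{}}" by (auto simp: subs_def pat_def emb_def)
    then show ?thesis by simp
  qed
  then have "G \<notin> P" for G
    using card_subs_le_level[OF assms(2), of G n] assms(3) True by (auto simp: F_0)
  then show ?thesis by blast
next
  case False
  then have n: "1 \<le> n" by simp
  obtain k k' where K: "\<forall>G. ord_graph G \<longrightarrow> card (subs n {1..fst G} (\<lambda>x y. (x, y) \<in> snd G)) < F n (l + 1) \<longrightarrow>
    (\<exists>H J. ord_graph H \<and> fst H = fst G \<and> fst J = fst G \<and> num_blocks H \<le> k \<and> J \<in> Jcal k' l \<and>
      snd G = (snd H - snd J) \<union> (snd J - snd H))"
    using few_subgraphs_structure[OF assms(1) n] by (elim exE) (rule that)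
  show ?thesis
  proof (rule exI[of _ k], rule exI[of _ k'], rule ballI)
    fix G assume G: "G \<in> P"
    have "ord_graph G" using assms(2) G by (simp add: hereditary_def)
    moreover have "card (subs n {1..fst G} (\<lambda>x y. (x, y) \<in> snd G)) < F n (l + 1)"
      by (rule le_less_trans[OF card_subs_le_level[OF assms(2) G] assms(3)])
    ultimately show "\<exists>H J. ord_graph H \<and> fst H = fst G \<and> fst J = fst G \<and> num_blocks H \<le> k \<and> J \<in> Jcal k' l \<and>
        snd G = (snd H - snd J) \<union> (snd J - snd H)"
      by (rule K[THEN spec, THEN mp, THEN mp])
  qed
qed

end
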